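(* Let $X\in\mathfrak{so}^*(2n)$ be a non-zero nilpotent element, and let $\{X,H,Y\}$ be an $\mathfrak{sl}_2(\mathbb R)$-triple in $\mathfrak{so}^*(2n)$. Let the nilpotent orbit $\mathcal O_X$ correspond to a signed Young diagram of size $n$ with underlying partition $\mathbf d$ (with even parts $\mathbb E_{\mathbf d}$, odd parts $\mathbb O_{\mathbf d}$, and multiplicities $t_d$). For $\eta\in\mathbb E_{\mathbf d}$ let $p_\eta$ (respectively $q_\eta$) be the number of $+1$ (respectively $-1$) in the first column of the block of size $t_\eta\times\eta$. Then $$\mathcal Z_{\mathrm{SO}^*(2n)}(X,H,Y)\simeq\prod_{\theta\in\mathbb O_{\mathbf d}}\mathrm{SO}^*(2t_\theta)\times\prod_{\eta\in\mathbb E_{\mathbf d}}\mathrm{Sp}(p_\eta,q_\eta).$$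
   Context: $\mathbb H$ is the real quaternions with units $\mathbf i,\mathbf j,\mathbf k$. $\mathrm{SO}^*(2m)$ is the group of $\mathbb H$-linear automorphisms of the right $\mathbb H$-space $\mathbb H^m$ (of reduced norm $1$) preserving a non-degenerate skew-Hermitian form $\langle\cdot,\cdot\rangle$, e.g. $\langle x,y\rangle=\bar x^t\mathbf jy$; $\mathfrak{so}^*(2m)$ is its Lie algebra. $\mathrm{Sp}(p,q)=\{g\in\mathrm{SL}_{p+q}(\mathbb H):\bar g^t\mathrm I_{p,q}g=\mathrm I_{p,q}\}$, $\mathrm I_{p,q}=\mathrm{diag}(\mathrm I_p,-\mathrm I_q)$. An $\mathfrak{sl}_2(\mathbb R)$-triple satisfies $X\ne0$, $[H,X]=2X$, $[H,Y]=-2Y$, $[X,Y]=H$. $\mathcal Z_G(X,H,Y)$ is the subgroup of $G$ fixing $X,H,Y$ under the adjoint action; $\mathcal O_X$ is the adjoint $\mathrm{SO}^*(2n)$-orbit. Signed Young diagram of $\mathcal O_X$: on $V=\mathbb H^n$ let $M(d-1)$ be the sum of all irreducible $\mathrm{Span}_{\mathbb R}\{X,H,Y\}$-submodules of real dimension $d$, $L(d-1)=M(d-1)\cap\ker Y$ (an $\mathbb H$-subspace), $t_d=\dim_{\mathbb H}L(d-1)$; the parts of $\mathbf d$ are the $d$ with $t_d>0$, with multiplicity $t_d$. The form $(v,u)_d=\langle v,X^{d-1}u\rangle$ on $L(d-1)$ is Hermitian for $d$ even and skew-Hermitian for $d$ odd. For each even part $\eta$, the first column of the $t_\eta\times\eta$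 block of the diagram contains $p_\eta$ entries $+1$ and $q_\eta$ entries $-1$, where $(p_\eta,q_\eta)$ is the signature of $(\cdot,\cdot)_\eta$ on $L(\eta-1)$; for each odd part all first-column entries are $+1$. *)

theory Defs
  imports
    Jordan_Normal_Form.Determinant
    "HOL-Analysis.Inner_Product"
    "HOL-Analysis.Product_Topology"
    "HOL-Algebra.Product_Groups"
begin

section \<open>Quaternions\<close>

datatype quat = Quat (QRe: real) (QI: real) (QJ: real) (QK: real)

lemma quat_eq_iff: "x = y \<longleftrightarrow> QRe x = QRe y \<and> QI x = QI y \<and> QJ x = QJ y \<and> QK x = QK y"
  by (cases x; cases y) simp

instantiation quat :: ring_1
begin

definition "0 = Quat 0 0 0 0"
definition "1 = Quat 1 0 0 0"
definition "x + y = Quat (QRe x + QRe y) (QI x + QI y) (QJ x + QJ y) (QK x + QK y)"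
definition "- x = Quat (- QRe x) (- QI x) (- QJ x) (- QK x)"
definition "x - y = Quat (QRe x - QRe y) (QI x - QI y) (QJ x - QJ y) (QK x - QK y)"
definition "x * y =
  Quat (QRe x * QRe y - QI x * QI y - QJ x * QJ y - QK x * QK y)
       (QRe x * QI y + QI x * QRe y + QJ x * QK y - QK x * QJ y)
       (QRe x * QJ y - QI x * QK y + QJ x * QRe y + QK x * QI y)
       (QRe x * QK y + QI x * QJ y - QJ x * QI y + QK x * QRe y)"

lemmas quat_ring_defs =
  zero_quat_def one_quat_def plus_quat_def uminus_quat_def minus_quat_def times_quat_def

instance
  by standard (auto simp: quat_ring_defs quat_eq_iff algebra_simps)

end

definition qi :: quat where "qi = Quat 0 1 0 0"
definition qj :: quat where "qj = Quat 0 0 1 0"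
definition qk :: quat where "qk = Quat 0 0 0 1"

lemma quat_units:
  "qi * qi = -1" "qj * qj = -1" "qk * qk = -1"
  "qi * qj = qk" "qj * qk = qi" "qk * qi = qj"
  "qj * qi = - qk" "qk * qj = - qi" "qi * qk = - qj"
  by (simp_all add: quat_ring_defs qi_def qj_def qk_def)

definition qcnj :: "quat \<Rightarrow> quat" where
  "qcnj x = Quat (QRe x) (- QI x) (- QJ x) (- QK x)"

instantiation quat :: real_algebra_1
begin

definition "scaleR r x = Quat (r * QRe x) (r * QI x) (r * QJ x) (r * QK x)" for x :: quat

instance
  by standard (auto simp: quat_ring_defs scaleR_quat_def quat_eq_iff algebra_simps)

end

instantiation quat :: real_inner
begin

definition "inner x y = QRe x * QRe y + QI x * QI y + QJ x * QJ y + QK x * QK y"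
definition "norm x = sqrt (QRe x ^ 2 + QI x ^ 2 + QJ x ^ 2 + QK x ^ 2)"
definition "sgn x = x /\<^sub>R norm x" for x :: quat
definition "dist x y = norm (x - y)" for x y :: quat
definition [code del]:
  "(uniformity :: (quat \<times> quat) filter) = (INF e\<in>{0 <..}. principal {(x, y). dist x y < e})"
definition [code del]:
  "open (U :: quat set) \<longleftrightarrow> (\<forall>x\<in>U. eventually (\<lambda>(x', y). x' = x \<longrightarrow> y \<in> U) uniformity)"

instance
proof
  fix x :: quat
  have "inner x x = 0 \<longleftrightarrow> QRe x ^ 2 + QI x ^ 2 + QJ x ^ 2 + QK x ^ 2 = 0"
    by (simp add: inner_quat_def power2_eq_square)
  also have "\<dots> \<longleftrightarrow> x = 0"
    by (simp add: add_nonneg_eq_0_iff quat_eq_iff zero_quat_def)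
  finally show "inner x x = 0 \<longleftrightarrow> x = 0" .
qed (auto simp: inner_quat_def norm_quat_def sgn_quat_def dist_quat_def uniformity_quat_def
      open_quat_def scaleR_quat_def plus_quat_def power2_eq_square algebra_simps)

end

instantiation quat :: real_normed_div_algebra
begin

definition "inverse x = qcnj x /\<^sub>R (norm x ^ 2)" for x :: quat
definition "x div y = x * inverse y" for x y :: quat

instance
proof
  fix x y :: quat
  have sq: "norm z ^ 2 = QRe z ^ 2 + QI z ^ 2 + QJ z ^ 2 + QK z ^ 2" for z :: quat
    by (simp add: norm_quat_def)
  have cnj: "qcnj z * z = of_real (norm z ^ 2)" "z * qcnj z = of_real (norm z ^ 2)" for z :: quat
    by (simp_all only: sq of_real_def)
       (simp_all add: qcnj_def quat_ring_defs scaleR_quat_def power2_eq_square algebra_simps)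
  show "x \<noteq> 0 \<Longrightarrow> inverse x * x = 1" "x \<noteq> 0 \<Longrightarrow> x * inverse x = 1"
    by (simp_all add: inverse_quat_def cnj del: of_real_power) (simp_all add: of_real_def)
  show "inverse (0 :: quat) = 0"
    by (simp add: inverse_quat_def qcnj_def zero_quat_def scaleR_quat_def)
  have "norm (x * y) ^ 2 = (norm x * norm y) ^ 2"
    unfolding power_mult_distrib sq
    by (simp add: times_quat_def power2_eq_square algebra_simps)
  then show "norm (x * y) = norm x * norm y"
    by (simp add: power2_eq_iff_nonneg)
qed (simp add: divide_quat_def)

end


section \<open>The right vector space \<open>\<bbbH>\<^sup>n\<close>\<close>

text \<open>Vectors of \<open>\<bbbH>\<^sup>n\<close> are columns, on which matrices act from the left and scalars
  from the right. The notions below are relative to a division subring \<open>K\<close> of scalars; only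
  \<open>K = \<real>\<close> and \<open>K = UNIV\<close> (that is, \<open>\<bbbH>\<close>) are used.\<close>

definition right_smult :: "quat vec \<Rightarrow> quat \<Rightarrow> quat vec" where
  "right_smult v a = map_vec (\<lambda>x. x * a) v"

definition is_subspace :: "quat set \<Rightarrow> nat \<Rightarrow> quat vec set \<Rightarrow> bool" where
  "is_subspace K n W \<longleftrightarrow> W \<subseteq> carrier_vec n \<and> 0\<^sub>v n \<in> W \<and>
     (\<forall>v\<in>W. \<forall>w\<in>W. v + w \<in> W) \<and> (\<forall>v\<in>W. \<forall>a\<in>K. right_smult v a \<in> W)"

definition lin_comb :: "nat \<Rightarrow> quat vec list \<Rightarrow> (nat \<Rightarrow> quat) \<Rightarrow> quat vec" where
  "lin_comb n vs c = vec n (\<lambda>k. \<Sum>i<length vs. vs ! i $ k * c i)"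

definition span_over :: "quat set \<Rightarrow> nat \<Rightarrow> quat vec set \<Rightarrow> quat vec set" where
  "span_over K n S = {lin_comb n vs c | vs c. set vs \<subseteq> S \<and> range c \<subseteq> K}"

definition is_basis :: "quat set \<Rightarrow> nat \<Rightarrow> quat vec set \<Rightarrow> quat vec list \<Rightarrow> bool" where
  "is_basis K n W bs \<longleftrightarrow> set bs \<subseteq> W \<and> span_over K n (set bs) = W \<and>
     (\<forall>c. range c \<subseteq> K \<and> lin_comb n bs c = 0\<^sub>v n \<longrightarrow> (\<forall>i<length bs. c i = 0))"

definition dim_over :: "quat set \<Rightarrow> nat \<Rightarrow> quat vec set \<Rightarrow> nat" where
  "dim_over K n W = length (SOME bs. is_basis K n W bs)"


section \<open>Forms\<close>

definition sesquilinear :: "nat \<Rightarrow> (quat vec \<Rightarrow> quat vec \<Rightarrow> quat) \<Rightarrow> bool" where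
  "sesquilinear n B \<longleftrightarrow> (\<forall>x\<in>carrier_vec n. \<forall>y\<in>carrier_vec n. \<forall>z\<in>carrier_vec n.
     B (x + y) z = B x z + B y z \<and> B x (y + z) = B x y + B x z) \<and>
   (\<forall>x\<in>carrier_vec n. \<forall>y\<in>carrier_vec n. \<forall>a.
     B (right_smult x a) y = qcnj a * B x y \<and> B x (right_smult y a) = B x y * a)"

definition skew_hermitian :: "nat \<Rightarrow> (quat vec \<Rightarrow> quat vec \<Rightarrow> quat) \<Rightarrow> bool" where
  "skew_hermitian n B \<longleftrightarrow> sesquilinear n B \<and>
     (\<forall>x\<in>carrier_vec n. \<forall>y\<in>carrier_vec n. B y x = - qcnj (B x y))"

definition nondegenerate :: "nat \<Rightarrow> (quat vec \<Rightarrow> quat vec \<Rightarrow> quat) \<Rightarrow> bool" where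
  "nondegenerate n B \<longleftrightarrow>
     (\<forall>x\<in>carrier_vec n. (\<forall>y\<in>carrier_vec n. B x y = 0) \<longrightarrow> x = 0\<^sub>v n)"

definition std_skew_form :: "nat \<Rightarrow> quat vec \<Rightarrow> quat vec \<Rightarrow> quat" where
  "std_skew_form m x y = (\<Sum>i<m. qcnj (x $ i) * qj * y $ i)"

text \<open>The signature of a Hermitian form \<open>h\<close> on an \<open>\<bbbH>\<close>-subspace \<open>W\<close>: the numbers of positive and
  negative diagonal values in an orthogonal basis. The diagonal values are real, so \<open>QRe\<close> loses
  nothing; by Sylvester's law of inertia the choice of basis does not matter.\<close>

definition is_orthogonal_basis ::
  "nat \<Rightarrow> quat vec set \<Rightarrow> (quat vec \<Rightarrow> quat vec \<Rightarrow> quat) \<Rightarrow> quat vec list \<Rightarrow> bool" where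
  "is_orthogonal_basis n W h bs \<longleftrightarrow> is_basis UNIV n W bs \<and>
     (\<forall>i<length bs. \<forall>j<length bs. i \<noteq> j \<longrightarrow> h (bs ! i) (bs ! j) = 0)"

definition signature ::
  "nat \<Rightarrow> quat vec set \<Rightarrow> (quat vec \<Rightarrow> quat vec \<Rightarrow> quat) \<Rightarrow> nat \<times> nat" where
  "signature n W h = (let bs = (SOME bs. is_orthogonal_basis n W h bs) in
     (card {i. i < length bs \<and> QRe (h (bs ! i) (bs ! i)) > 0},
      card {i. i < length bs \<and> QRe (h (bs ! i) (bs ! i)) < 0}))"


section \<open>The classical groups\<close>

text \<open>Writing a quaternion as \<open>z + w j\<close> with \<open>z\<close>, \<open>w\<close> complex, the map
  \<open>Z + W j \<mapsto> (Z, W; - cnj W, cnj Z)\<close> embeds the \<open>m \<times> m\<close> quaternionic matrices into the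
  \<open>2m \<times> 2m\<close> complex ones; the reduced norm is the determinant of the image.\<close>

definition reduced_norm :: "quat mat \<Rightarrow> complex" where
  "reduced_norm A = det (four_block_mat
      (map_mat (\<lambda>x. Complex (QRe x) (QI x)) A)
      (map_mat (\<lambda>x. Complex (QJ x) (QK x)) A)
      (map_mat (\<lambda>x. - cnj (Complex (QJ x) (QK x))) A)
      (map_mat (\<lambda>x. cnj (Complex (QRe x) (QI x))) A))"

definition SL_H :: "nat \<Rightarrow> quat mat set" where
  "SL_H m = {g \<in> carrier_mat m m. reduced_norm g = 1}"

definition mat_group :: "nat \<Rightarrow> quat mat set \<Rightarrow> quat mat monoid" where
  "mat_group m S = \<lparr>carrier = S, monoid.mult = (*), one = 1\<^sub>m m\<rparr>"

definition SO_star_form :: "nat \<Rightarrow> (quat vec \<Rightarrow> quat vec \<Rightarrow> quat) \<Rightarrow> quat mat monoid" where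
  "SO_star_form m B = mat_group m
     {g \<in> SL_H m. \<forall>x\<in>carrier_vec m. \<forall>y\<in>carrier_vec m. B (g *\<^sub>v x) (g *\<^sub>v y) = B x y}"

text \<open>\<open>SO_star m\<close> is the group written \<open>SO\<^sup>*(2m)\<close>.\<close>

definition SO_star :: "nat \<Rightarrow> quat mat monoid" where
  "SO_star m = SO_star_form m (std_skew_form m)"

definition adjoint_mat :: "quat mat \<Rightarrow> quat mat" where
  "adjoint_mat A = map_mat qcnj (transpose_mat A)"

definition I_mat :: "nat \<Rightarrow> nat \<Rightarrow> quat mat" where
  "I_mat p q = four_block_mat (1\<^sub>m p) (0\<^sub>m p q) (0\<^sub>m q p) (- 1\<^sub>m q)"

definition Sp :: "nat \<Rightarrow> nat \<Rightarrow> quat mat monoid" where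
  "Sp p q = mat_group (p + q)
     {g \<in> SL_H (p + q). adjoint_mat g * I_mat p q * g = I_mat p q}"

text \<open>The Lie algebra of a matrix group, as the tangent space at the identity: the velocities at
  time 0 of the curves in the group that start at the identity.\<close>

definition lie_algebra :: "nat \<Rightarrow> quat mat monoid \<Rightarrow> quat mat set" where
  "lie_algebra n G = {A \<in> carrier_mat n n. \<exists>\<gamma> :: real \<Rightarrow> quat mat.
     (\<forall>s. \<gamma> s \<in> carrier G) \<and> \<gamma> 0 = 1\<^sub>m n \<and>
     (\<forall>i<n. \<forall>j<n. ((\<lambda>s. \<gamma> s $$ (i, j)) has_vector_derivative A $$ (i, j)) (at 0))}"

definition bracket :: "quat mat \<Rightarrow> quat mat \<Rightarrow> quat mat" where
  "bracket A C = A * C - C * A"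

definition sl2_triple :: "nat \<Rightarrow> quat mat set \<Rightarrow> quat mat \<Rightarrow> quat mat \<Rightarrow> quat mat \<Rightarrow> bool" where
  "sl2_triple n \<gg> X H Y \<longleftrightarrow> {X, H, Y} \<subseteq> \<gg> \<and> X \<noteq> 0\<^sub>m n n \<and>
     bracket H X = 2 \<cdot>\<^sub>m X \<and> bracket H Y = (- 2) \<cdot>\<^sub>m Y \<and> bracket X Y = H"

definition nilpotent_mat :: "nat \<Rightarrow> quat mat \<Rightarrow> bool" where
  "nilpotent_mat n X \<longleftrightarrow> (\<exists>k. X ^\<^sub>m k = 0\<^sub>m n n)"

definition Ad :: "quat mat monoid \<Rightarrow> quat mat \<Rightarrow> quat mat \<Rightarrow> quat mat" where
  "Ad G g A = g * A * inv\<^bsub>G\<^esub> g"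

definition triple_centralizer ::
  "quat mat monoid \<Rightarrow> quat mat \<Rightarrow> quat mat \<Rightarrow> quat mat \<Rightarrow> quat mat monoid" where
  "triple_centralizer G X H Y =
     G\<lparr>carrier := {g \<in> carrier G. Ad G g X = X \<and> Ad G g H = H \<and> Ad G g Y = Y}\<rparr>"


section \<open>The signed Young diagram\<close>

text \<open>Being stable under \<open>X\<close>, \<open>H\<close> and \<open>Y\<close> is the same, for a real subspace, as being stable under
  their real span.\<close>

definition sl2_submodule ::
  "nat \<Rightarrow> quat mat \<Rightarrow> quat mat \<Rightarrow> quat mat \<Rightarrow> quat vec set \<Rightarrow> bool" where
  "sl2_submodule n X H Y W \<longleftrightarrow> is_subspace \<real> n W \<and>
     (\<forall>w\<in>W. X *\<^sub>v w \<in> W \<and> H *\<^sub>v w \<in> W \<and> Y *\<^sub>v w \<in> W)"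

definition irreducible_submodule ::
  "nat \<Rightarrow> quat mat \<Rightarrow> quat mat \<Rightarrow> quat mat \<Rightarrow> quat vec set \<Rightarrow> bool" where
  "irreducible_submodule n X H Y W \<longleftrightarrow> sl2_submodule n X H Y W \<and> W \<noteq> {0\<^sub>v n} \<and>
     (\<forall>U. sl2_submodule n X H Y U \<and> U \<subseteq> W \<longrightarrow> U = {0\<^sub>v n} \<or> U = W)"

text \<open>\<open>isotypic n X H Y d\<close> and \<open>lowest n X H Y d\<close> are usually written \<open>M(d - 1)\<close> and
  \<open>L(d - 1)\<close>: they are indexed here by the dimension \<open>d\<close> instead of the highest weight.\<close>

definition isotypic ::
  "nat \<Rightarrow> quat mat \<Rightarrow> quat mat \<Rightarrow> quat mat \<Rightarrow> nat \<Rightarrow> quat vec set" where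
  "isotypic n X H Y d =
     span_over \<real> n (\<Union>{W. irreducible_submodule n X H Y W \<and> dim_over \<real> n W = d})"

definition lowest ::
  "nat \<Rightarrow> quat mat \<Rightarrow> quat mat \<Rightarrow> quat mat \<Rightarrow> nat \<Rightarrow> quat vec set" where
  "lowest n X H Y d = isotypic n X H Y d \<inter> {v \<in> carrier_vec n. Y *\<^sub>v v = 0\<^sub>v n}"

definition multiplicity_of :: "nat \<Rightarrow> quat mat \<Rightarrow> quat mat \<Rightarrow> quat mat \<Rightarrow> nat \<Rightarrow> nat" where
  "multiplicity_of n X H Y d = dim_over UNIV n (lowest n X H Y d)"

definition parts :: "nat \<Rightarrow> quat mat \<Rightarrow> quat mat \<Rightarrow> quat mat \<Rightarrow> nat set" where
  "parts n X H Y = {d. multiplicity_of n X H Y d > 0}"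

definition block_form ::
  "(quat vec \<Rightarrow> quat vec \<Rightarrow> quat) \<Rightarrow> quat mat \<Rightarrow> nat \<Rightarrow> quat vec \<Rightarrow> quat vec \<Rightarrow> quat" where
  "block_form B X d v u = B v ((X ^\<^sub>m (d - 1)) *\<^sub>v u)"

text \<open>The signed Young diagram attached to the orbit of \<open>X\<close> has, for each part \<open>d\<close>, a block of
  \<open>multiplicity_of n X H Y d\<close> rows of length \<open>d\<close>, whose first column is listed here from top to
  bottom. Only the orbit of \<open>X\<close> matters, since any two triples through \<open>X\<close> are conjugate under
  the stabiliser of \<open>X\<close>.\<close>

definition first_column ::
  "nat \<Rightarrow> (quat vec \<Rightarrow> quat vec \<Rightarrow> quat) \<Rightarrow> quat mat \<Rightarrow> quat mat \<Rightarrow> quat mat \<Rightarrow> nat \<Rightarrow> int list" where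
  "first_column n B X H Y d =
     (if even d
      then (case signature n (lowest n X H Y d) (block_form B X d) of
              (p, q) \<Rightarrow> replicate p 1 @ replicate q (- 1))
      else replicate (multiplicity_of n X H Y d) 1)"


section \<open>Isomorphisms of matrix Lie groups\<close>

definition mat_topology :: "nat \<Rightarrow> quat mat topology" where
  "mat_topology m = pullback_topology (carrier_mat m m)
     (\<lambda>A. restrict (\<lambda>ij. A $$ ij) ({..<m} \<times> {..<m}))
     (product_topology (\<lambda>_. euclidean) ({..<m} \<times> {..<m}))"

definition group_topology :: "nat \<Rightarrow> quat mat monoid \<Rightarrow> quat mat topology" where
  "group_topology m G = subtopology (mat_topology m) (carrier G)"

text \<open>A continuous homomorphism between Lie groups is smooth, so for closed linear groups and their
  finite products the isomorphisms of Lie groups are the isomorphisms of topological groups.\<close>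

definition lie_group_iso :: "('a, 'c) monoid_scheme \<Rightarrow> 'a topology \<Rightarrow>
    ('b, 'e) monoid_scheme \<Rightarrow> 'b topology \<Rightarrow> bool" where
  "lie_group_iso G S H T \<longleftrightarrow> (\<exists>\<phi>. \<phi> \<in> iso G H \<and> homeomorphic_map S T \<phi>)"

end

theory Submission
  imports Defs "HOL-Analysis.Abstract_Limits"
begin

text \<open>The space \<open>V\<close> is the direct sum of the \<open>X\<^sup>l L(d - 1)\<close> with \<open>l < d\<close>. An isometry commuting with
  the triple preserves each \<open>L(d - 1)\<close> and the form \<open>\<langle>v, X\<^bsup>d - 1\<^esup> u\<rangle>\<close> on it, and it is determined by
  its restrictions to these spaces; conversely any family of isometries of these forms extends. The
  form on \<open>L(d - 1)\<close> is nondegenerate: if \<open>u\<close> is in its radical then \<open>X\<^bsup>d - 1\<^esup> u\<close> is orthogonal to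
  \<open>ker Y\<close>, hence lies in \<open>im Y\<close>, but \<open>ker X\<close> and \<open>im Y\<close> meet only in \<open>0\<close>. Complete reducibility
  follows, since the orthogonal complement of all \<open>X\<^sup>l L(d - 1)\<close> is a stable subspace without lowest
  weight vectors.

  In bases of the \<open>L(d - 1)\<close> that bring the forms to \<open>j\<close> times the identity (\<open>d\<close> odd) or to \<open>I\<^bsub>p,q\<^esub>\<close>
  (\<open>d\<close> even), restriction and extension are linear in the matrix entries, hence continuous. Reduced
  norm 1 is automatic for isometries: the reduced norm is a nonnegative real number, and the isometry
  equation makes its square 1.\<close>

section \<open>Quaternionic conjugation\<close>


text \<open>Two obstacles shape the argument: matrices over the quaternions have no determinant, and
  \<open>H\<close> is not known to be diagonalisable. Inverses are therefore borrowed from complex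
  matrices, and all spectral information is drawn from nilpotency. By [Y, X^(k+1)] = -(k+1) X^k (H +
  k), a vector v of ker Y with X^(k+1) v = 0 satisfies X^k (H + k) v = 0: each factor H + k saves
  one power of X, which produces integral weights on ker Y. Under the form the same device shows
  that X^(d-1) u is orthogonal to all of ker Y once it is orthogonal to L(d - 1). The diagram is
  defined by irreducible real submodules, whereas the centralizer acts on quaternionic spaces. The
  Casimir operator connects the two: it identifies L(d - 1) with the vectors of ker Y of weight 1 -
  d. The parity of d decides between the two kinds of factors. For even d the diagonal values of the
  form on L(d - 1) are real and their signs survive every rescaling. For odd d they are purely
  imaginary, and over the quaternions each nonzero one can be rescaled to j, so that only the
  multiplicity remains.\<close>

lemma qcnj_simps [simp]:
  "qcnj 0 = 0" "qcnj 1 = 1" "qcnj (qcnj x) = x" "qcnj (x + y) = qcnj x + qcnj y"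
  "qcnj (x - y) = qcnj x - qcnj y" "qcnj (- x) = - qcnj x"
  by (simp_all add: qcnj_def quat_ring_defs)

lemma qcnj_mult: "qcnj (x * y) = qcnj y * qcnj x"
  by (simp add: qcnj_def quat_ring_defs algebra_simps)

lemma qcnj_sum: "qcnj (sum f A) = (\<Sum>x\<in>A. qcnj (f x))"
  by (induction A rule: infinite_finite_induct) simp_all

lemma qcnj_of_real [simp]: "qcnj (of_real r) = of_real r"
  by (simp add: of_real_def scaleR_quat_def one_quat_def qcnj_def)

lemma adjoint_mat_dim [simp]:
  "dim_row (adjoint_mat A) = dim_col A" "dim_col (adjoint_mat A) = dim_row A"
  by (simp_all add: adjoint_mat_def)

lemma adjoint_mat_carrier [simp]: "A \<in> carrier_mat a b \<Longrightarrow> adjoint_mat A \<in> carrier_mat b a"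
  by (simp add: adjoint_mat_def)

lemma adjoint_mat_index [simp]:
  "i < dim_col A \<Longrightarrow> j < dim_row A \<Longrightarrow> adjoint_mat A $$ (i, j) = qcnj (A $$ (j, i))"
  by (simp add: adjoint_mat_def)

text \<open>Entries as sums over \<open>{..<n}\<close>, the shape on which \<open>sum.swap\<close>
  and the distributivity rules act. The simp rule \<open>index_mult_mat(1)\<close> yields scalar
  products of rows and columns instead and is therefore often switched off next to it.\<close>

lemma mult_index_sum:
  "i < dim_row A \<Longrightarrow> j < dim_col B \<Longrightarrow>
    (A * B) $$ (i, j) = (\<Sum>k<dim_row B. A $$ (i, k) * B $$ (k, j))"
  if "dim_col A = dim_row B"
  using that by (simp add: scalar_prod_def lessThan_atLeast0 row_def col_def)

lemma adjoint_mat_mult: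
  "dim_col A = dim_row B \<Longrightarrow> adjoint_mat (A * B) = adjoint_mat B * adjoint_mat A"
  by (rule eq_matI) (simp_all add: mult_index_sum qcnj_sum qcnj_mult del: index_mult_mat(1))

lemma adjoint_mat_adjoint [simp]: "adjoint_mat (adjoint_mat A) = A"
  by (rule eq_matI) simp_all

lemma adjoint_mat_one [simp]: "adjoint_mat (1\<^sub>m n) = 1\<^sub>m n"
  by (rule eq_matI) simp_all

section \<open>The reduced norm\<close>

definition cpart :: "quat \<Rightarrow> complex" where
  "cpart x = Complex (QRe x) (QI x)"

definition jpart :: "quat \<Rightarrow> complex" where
  "jpart x = Complex (QJ x) (QK x)"

lemma cpart_simps [simp]:
  "cpart 0 = 0" "cpart 1 = 1" "jpart 0 = 0" "jpart 1 = 0"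
  "cpart (x + y) = cpart x + cpart y" "jpart (x + y) = jpart x + jpart y"
  "cpart (qcnj x) = cnj (cpart x)" "jpart (qcnj x) = - jpart x"
  by (simp_all add: cpart_def jpart_def quat_ring_defs qcnj_def complex_eq_iff)

text \<open>Multiplication of z + w j by z' + w' j, using j w = cnj w j and j j = -1.\<close>

lemma cpart_mult:
  "cpart (x * y) = cpart x * cpart y - jpart x * cnj (jpart y)"
  "jpart (x * y) = cpart x * jpart y + jpart x * cnj (cpart y)"
  by (simp_all add: cpart_def jpart_def quat_ring_defs complex_eq_iff algebra_simps)

lemma cpart_sum:
  "cpart (sum f A) = (\<Sum>x\<in>A. cpart (f x))" "jpart (sum f A) = (\<Sum>x\<in>A. jpart (f x))"
  by (induction A rule: infinite_finite_induct) simp_all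

lemma quat_eq_parts: "x = y \<longleftrightarrow> cpart x = cpart y \<and> jpart x = jpart y"
  by (auto simp: cpart_def jpart_def quat_eq_iff)

text \<open>The matrix under the determinant of \<open>reduced_norm\<close>, named separately
  because it is an injective ring homomorphism: determinants and inverses are transported along
  it.\<close>

definition complex_mat :: "quat mat \<Rightarrow> complex mat" where
  "complex_mat A = four_block_mat (map_mat cpart A) (map_mat jpart A)
     (map_mat (\<lambda>x. - cnj (jpart x)) A) (map_mat (\<lambda>x. cnj (cpart x)) A)"

lemma reduced_norm_complex_mat: "reduced_norm A = det (complex_mat A)"
  by (simp add: reduced_norm_def complex_mat_def cpart_def jpart_def[abs_def] cpart_def[abs_def])

lemma complex_mat_dim [simp]:
  "dim_row (complex_mat A) = dim_row A + dim_row A"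
  "dim_col (complex_mat A) = dim_col A + dim_col A"
  by (simp_all add: complex_mat_def)

lemma complex_mat_carrier [simp]:
  "A \<in> carrier_mat a b \<Longrightarrow> complex_mat A \<in> carrier_mat (a + a) (b + b)"
  by (intro carrier_matI) auto

lemma complex_mat_mult:
  assumes A: "A \<in> carrier_mat a b" and B: "B \<in> carrier_mat b c"
  shows "complex_mat (A * B) = complex_mat A * complex_mat B"
  unfolding complex_mat_def
proof (subst mult_four_block_mat[of _ a b _ b _ a _ _ c _ c])
  show "four_block_mat (map_mat cpart (A * B)) (map_mat jpart (A * B))
     (map_mat (\<lambda>x. - cnj (jpart x)) (A * B)) (map_mat (\<lambda>x. cnj (cpart x)) (A * B)) =
    four_block_mat
     (map_mat cpart A * map_mat cpart B + map_mat jpart A * map_mat (\<lambda>x. - cnj (jpart x)) B)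
     (map_mat cpart A * map_mat jpart B + map_mat jpart A * map_mat (\<lambda>x. cnj (cpart x)) B)
     (map_mat (\<lambda>x. - cnj (jpart x)) A * map_mat cpart B +
      map_mat (\<lambda>x. cnj (cpart x)) A * map_mat (\<lambda>x. - cnj (jpart x)) B)
     (map_mat (\<lambda>x. - cnj (jpart x)) A * map_mat jpart B +
      map_mat (\<lambda>x. cnj (cpart x)) A * map_mat (\<lambda>x. cnj (cpart x)) B)"
    using A B
    by (intro cong_four_block_mat eq_matI)
       (simp_all add: mult_index_sum cpart_sum cpart_mult sum.distrib[symmetric] sum_subtractf
         sum_negf[symmetric] algebra_simps del: index_mult_mat(1) cnj_sum sum_negf add: cnj_sum)
qed (use A B in auto)

lemma complex_mat_one: "complex_mat (1\<^sub>m n) = 1\<^sub>m (n + n)"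
proof -
  have "map_mat cpart (1\<^sub>m n) = 1\<^sub>m n" "map_mat jpart (1\<^sub>m n) = 0\<^sub>m n n"
    "map_mat (\<lambda>x. - cnj (jpart x)) (1\<^sub>m n) = 0\<^sub>m n n" "map_mat (\<lambda>x. cnj (cpart x)) (1\<^sub>m n) = 1\<^sub>m n"
    by (auto intro!: eq_matI)
  then show ?thesis
    by (simp add: complex_mat_def)
qed

lemma complex_mat_inj:
  assumes "A \<in> carrier_mat a b" "B \<in> carrier_mat a b" "complex_mat A = complex_mat B"
  shows "A = B"
proof (rule eq_matI)
  fix i j assume ij: "i < dim_row B" "j < dim_col B"
  from assms have "complex_mat A $$ (i, j) = complex_mat B $$ (i, j)"
    "complex_mat A $$ (i, j + b) = complex_mat B $$ (i, j + b)"
    by simp_all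
  with assms(1,2) ij show "A $$ (i, j) = B $$ (i, j)"
    by (simp add: complex_mat_def quat_eq_parts)
qed (use assms in auto)

text \<open>For complex matrices a one-sided inverse is two-sided; \<open>complex_mat\<close> is
  multiplicative and injective, so the statement descends to the noncommutative entries.\<close>

lemma quat_mat_left_right_inverse:
  fixes A B :: "quat mat"
  assumes A: "A \<in> carrier_mat n n" and B: "B \<in> carrier_mat n n" and AB: "A * B = 1\<^sub>m n"
  shows "B * A = 1\<^sub>m n"
proof (rule complex_mat_inj)
  have "complex_mat A * complex_mat B = 1\<^sub>m (n + n)"
    using complex_mat_mult[OF A B] AB by (simp add: complex_mat_one)
  then have "complex_mat B * complex_mat A = 1\<^sub>m (n + n)"
    by (rule mat_mult_left_right_inverse[OF complex_mat_carrier[OF A] complex_mat_carrier[OF B]])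
  then show "complex_mat (B * A) = complex_mat (1\<^sub>m n)"
    using complex_mat_mult[OF B A] by (simp add: complex_mat_one)
qed (use A B in auto)

section \<open>Multiplicativity, block matrices and positivity of the reduced norm\<close>

lemma reduced_norm_mult:
  assumes "A \<in> carrier_mat n n" "B \<in> carrier_mat n n"
  shows "reduced_norm (A * B) = reduced_norm A * reduced_norm B"
  using assms
  by (simp add: reduced_norm_complex_mat complex_mat_mult det_mult[OF complex_mat_carrier complex_mat_carrier])

lemma reduced_norm_one: "reduced_norm (1\<^sub>m n) = 1"
  by (simp add: reduced_norm_complex_mat complex_mat_one)

text \<open>The complex matrix of the adjoint is the conjugate transpose of the complex
  matrix.\<close>

lemma reduced_norm_adjoint:
  assumes A: "A \<in> carrier_mat n n"
  shows "reduced_norm (adjoint_mat A) = cnj (reduced_norm A)"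
proof -
  have "complex_mat (adjoint_mat A) = map_mat cnj (transpose_mat (complex_mat A))"
    using A by (intro eq_matI) (auto simp: complex_mat_def)
  moreover have "det (map_mat cnj M) = cnj (det M)" for M
    by (simp add: det_def sign_def)
  moreover have "det (transpose_mat (complex_mat A)) = det (complex_mat A)"
    using A by (intro det_transpose) auto
  ultimately show ?thesis
    by (simp add: reduced_norm_complex_mat)
qed

text \<open>The sign of the permutation enters once for the rows and once for the columns, the
  latter treated as rows of the transpose, and squares to 1.\<close>

lemma det_permute_both:
  fixes M :: "'a :: comm_ring_1 mat"
  assumes M: "M \<in> carrier_mat N N" and s: "s permutes {0..<N}"
  shows "det (mat N N (\<lambda>(i, j). M $$ (s i, s j))) = det M"
proof -
  define M1 where "M1 = mat N N (\<lambda>(i, j). M $$ (s i, j))"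
  define M2 where "M2 = mat N N (\<lambda>(i, j). transpose_mat M1 $$ (s i, j))"
  have lt: "s i < N" if "i < N" for i
    using permutes_in_image[OF s, of i] that by simp
  have M1: "M1 \<in> carrier_mat N N" and M2: "M2 \<in> carrier_mat N N"
    by (auto simp: M1_def M2_def)
  have "mat N N (\<lambda>(i, j). M $$ (s i, s j)) = transpose_mat M2"
    using lt by (intro eq_matI) (auto simp: M1_def M2_def)
  then have "det (mat N N (\<lambda>(i, j). M $$ (s i, s j))) = det M2"
    using det_transpose[OF M2] by simp
  also have "\<dots> = signof s * det (transpose_mat M1)"
    unfolding M2_def by (rule det_permute_rows[OF _ s]) (use M1 in auto)
  also have "det (transpose_mat M1) = signof s * det M"
    unfolding det_transpose[OF M1] unfolding M1_def by (rule det_permute_rows[OF M s])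
  finally show ?thesis
    by (simp add: sign_def)
qed

text \<open>Interleaving the two copies of the blocks turns \<open>complex_mat\<close> of a block matrix into the
  block matrix of the \<open>complex_mat\<close>s.\<close>

lemma reduced_norm_four_block:
  assumes A: "A \<in> carrier_mat a a" and B: "B \<in> carrier_mat a b"
    and C: "C \<in> carrier_mat b a" and D: "D \<in> carrier_mat b b"
  shows "reduced_norm (four_block_mat A B C D) =
    det (four_block_mat (complex_mat A) (complex_mat B) (complex_mat C) (complex_mat D))"
proof -
  \<comment> \<open>The block matrix of the \<open>complex_mat\<close>s orders its index ranges as
    a, a, b, b, while \<open>complex_mat\<close> of the block matrix has a, b, a, b;
    \<open>s\<close> exchanges the two middle ranges.\<close>
  define s where "s i = (if i < a then i else if i < 2 * a then i + b
    else if i < 2 * a + b then i - a else i)" for i :: nat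
  have "bij_betw s {0..<2 * (a + b)} {0..<2 * (a + b)}"
  proof (rule bij_betwI')
    fix x y show "(s x = s y) = (x = y)"
      by (auto simp: s_def)
  next
    fix x assume "x \<in> {0..<2 * (a + b)}" then show "s x \<in> {0..<2 * (a + b)}"
      by (auto simp: s_def)
  next
    fix y assume y: "y \<in> {0..<2 * (a + b)}"
    show "\<exists>x\<in>{0..<2 * (a + b)}. y = s x"
    proof (rule bexI)
      let ?x = "if y < a then y else if y < a + b then y + a
        else if y < 2 * a + b then y - b else y"
      show "y = s ?x"
        by (auto simp: s_def)
      show "?x \<in> {0..<2 * (a + b)}"
        using y by auto
    qed
  qed
  then have s: "s permutes {0..<2 * (a + b)}"
    by (rule bij_imp_permutes) (auto simp: s_def)
  let ?M = "complex_mat (four_block_mat A B C D)"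
  have M: "?M \<in> carrier_mat (2 * (a + b)) (2 * (a + b))"
    using A B C D by (intro carrier_matI) auto
  have "four_block_mat (complex_mat A) (complex_mat B) (complex_mat C) (complex_mat D) =
    mat (2 * (a + b)) (2 * (a + b)) (\<lambda>(i, j). ?M $$ (s i, s j))"
  proof (rule eq_matI, goal_cases)
    case (1 i j)
    have split: "x < a \<or> (\<exists>y<a. x = a + y) \<or> (\<exists>y<b. x = a + a + y) \<or> (\<exists>y<b. x = a + a + b + y)"
      if "x < 2 * (a + b)" for x
      using that by presburger
    have s_simps: "x < a \<Longrightarrow> s x = x" "y < a \<Longrightarrow> s (a + y) = a + b + y"
      "z < b \<Longrightarrow> s (a + a + z) = a + z" "s (a + a + b + z) = a + a + b + z" for x y z
      by (simp_all add: s_def)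
    from 1 have "i < 2 * (a + b)" "j < 2 * (a + b)"
      by simp_all
    from split[OF this(1)] split[OF this(2)] show ?case
      by (elim disjE exE conjE)
         (use A B C D in \<open>simp_all add: complex_mat_def s_simps\<close>)
  qed (use A D in auto)
  with det_permute_both[OF M s] show ?thesis
    by (simp add: reduced_norm_complex_mat)
qed

lemma reduced_norm_block_triangular:
  assumes A: "A \<in> carrier_mat a a" and B: "B \<in> carrier_mat a b"
    and C: "C \<in> carrier_mat b a" and D: "D \<in> carrier_mat b b"
  shows "reduced_norm (four_block_mat A B (0\<^sub>m b a) D) = reduced_norm A * reduced_norm D"
    and "reduced_norm (four_block_mat A (0\<^sub>m a b) C D) = reduced_norm A * reduced_norm D"
proof -
  have z: "complex_mat (0\<^sub>m r c) = 0\<^sub>m (r + r) (c + c)" for r c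
    by (rule eq_matI) (auto simp: complex_mat_def)
  show "reduced_norm (four_block_mat A B (0\<^sub>m b a) D) = reduced_norm A * reduced_norm D"
    unfolding reduced_norm_four_block[OF A B zero_carrier_mat D] z
    unfolding reduced_norm_complex_mat
    using A B D by (intro det_four_block_mat_lower_left_zero) auto
  show "reduced_norm (four_block_mat A (0\<^sub>m a b) C D) = reduced_norm A * reduced_norm D"
    unfolding reduced_norm_four_block[OF A zero_carrier_mat C D] z
    unfolding reduced_norm_complex_mat
    using A C D by (intro det_four_block_mat_upper_right_zero) auto
qed

text \<open>The complex image of z + w j has determinant z cnj z + w cnj w, the square of the
  quaternionic norm.\<close>

lemma reduced_norm_1x1:
  assumes A: "A \<in> carrier_mat 1 1"
  shows "reduced_norm A = of_real (norm (A $$ (0, 0)) ^ 2)"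
proof -
  define x where "x = A $$ (0, 0)"
  have "reduced_norm A = det (four_block_mat (mat 1 1 (\<lambda>_. cpart x)) (mat 1 1 (\<lambda>_. jpart x))
     (mat 1 1 (\<lambda>_. - cnj (jpart x))) (mat 1 1 (\<lambda>_. cnj (cpart x))))"
    unfolding reduced_norm_complex_mat complex_mat_def x_def
    using A by (intro arg_cong[where f = det] cong_four_block_mat eq_matI) auto
  also have "\<dots> = det (mat 1 1 (\<lambda>_. cpart x) * mat 1 1 (\<lambda>_. cnj (cpart x)) -
      mat 1 1 (\<lambda>_. jpart x) * mat 1 1 (\<lambda>_. - cnj (jpart x)))"
    by (rule det_four_block_mat[of _ 1]) (auto simp: scalar_prod_def mult.commute intro!: eq_matI)
  also have "\<dots> = cpart x * cnj (cpart x) + jpart x * cnj (jpart x)"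
    by (subst det_single) (auto simp: scalar_prod_def)
  also have "\<dots> = of_real (norm x ^ 2)"
    by (simp add: complex_eq_iff cpart_def jpart_def norm_quat_def power2_eq_square)
  finally show ?thesis
    by (simp add: x_def)
qed

text \<open>Gaussian elimination over a division ring. A nonzero corner entry splits off its squared
  norm and leaves a smaller Schur complement; a zero first column gives reduced norm 0; otherwise a
  unipotent row operation of reduced norm 1 brings a nonzero entry into the corner.\<close>

lemma reduced_norm_nonneg:
  assumes "A \<in> carrier_mat n n"
  shows "\<exists>r\<ge>0. reduced_norm A = of_real r"
  using assms
proof (induction n arbitrary: A)
  case 0
  then have "A = 1\<^sub>m 0"
    by (intro eq_matI) auto
  then show ?case
    by (auto simp: reduced_norm_one intro!: exI[of _ 1])
next
  case (Suc m A)
  have pivot: "\<exists>r\<ge>0. reduced_norm (four_block_mat a b c D) = of_real r"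
    if a: "a \<in> carrier_mat 1 1" and b: "b \<in> carrier_mat 1 m"
      and c: "c \<in> carrier_mat m 1" and D: "D \<in> carrier_mat m m" and a0: "a $$ (0, 0) \<noteq> 0"
    for a b c D
  proof -
    define ai where "ai = mat 1 1 (\<lambda>_. inverse (a $$ (0, 0)))"
    have ai: "ai \<in> carrier_mat 1 1"
      by (simp add: ai_def)
    have aia: "ai * a = 1\<^sub>m 1"
      using a a0 by (intro eq_matI) (auto simp: ai_def scalar_prod_def)
    have S: "D - c * ai * b \<in> carrier_mat m m"
      using b c D ai by auto
    obtain r where r: "r \<ge> 0" "reduced_norm (D - c * ai * b) = of_real r"
      using Suc.IH[OF S] by auto
    \<comment> \<open>Block LU factorisation with the Schur complement D - c a^(-1) b, the factors
      in the order that noncommutativity dictates.\<close>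
    have "four_block_mat (1\<^sub>m 1) (0\<^sub>m 1 m) (c * ai) (1\<^sub>m m) *
        four_block_mat a b (0\<^sub>m m 1) (D - c * ai * b) = four_block_mat a b c D"
    proof (subst mult_four_block_mat[of _ 1 1 _ m _ m _ _ 1 _ m])
      have "c * ai * a = c"
        using c ai a by (simp add: aia del: One_nat_def)
      moreover have "c * ai * b + (D - c * ai * b) = D"
        using b c D ai by (intro eq_matI) auto
      ultimately show "four_block_mat (1\<^sub>m 1 * a + 0\<^sub>m 1 m * 0\<^sub>m m 1)
         (1\<^sub>m 1 * b + 0\<^sub>m 1 m * (D - c * ai * b)) (c * ai * a + 1\<^sub>m m * 0\<^sub>m m 1)
         (c * ai * b + 1\<^sub>m m * (D - c * ai * b)) = four_block_mat a b c D"
        using a b c D S ai by (simp del: One_nat_def)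
    qed (use a b c D S ai in auto)
    moreover have cai: "c * ai \<in> carrier_mat m 1"
      using c ai by simp
    ultimately have "reduced_norm (four_block_mat a b c D) =
        reduced_norm (four_block_mat (1\<^sub>m 1) (0\<^sub>m 1 m) (c * ai) (1\<^sub>m m)) *
        reduced_norm (four_block_mat a b (0\<^sub>m m 1) (D - c * ai * b))"
      using reduced_norm_mult[OF four_block_carrier_mat[OF one_carrier_mat one_carrier_mat]
          four_block_carrier_mat[OF a S]] by metis
    also have "\<dots> = of_real (norm (a $$ (0, 0)) ^ 2) * of_real r"
      unfolding reduced_norm_block_triangular(2)[OF one_carrier_mat zero_carrier_mat cai one_carrier_mat]
        reduced_norm_block_triangular(1)[OF a b zero_carrier_mat S] reduced_norm_1x1[OF a]
        reduced_norm_one r(2)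
      by simp
    finally show ?thesis
      using r by (intro exI[of _ "norm (a $$ (0, 0)) ^ 2 * r"]) simp
  qed
  obtain a b c D where "split_block A 1 1 = (a, b, c, D)"
    by (rule prod_cases4)
  from split_block[OF this, of m m] Suc.prems
  have a: "a \<in> carrier_mat 1 1" and b: "b \<in> carrier_mat 1 m"
      and c: "c \<in> carrier_mat m 1" and D: "D \<in> carrier_mat m m"
      and A: "A = four_block_mat a b c D"
    by auto
  consider "a $$ (0, 0) \<noteq> 0" | "a $$ (0, 0) = 0" "c = 0\<^sub>m m 1"
    | k where "a $$ (0, 0) = 0" "k < m" "c $$ (k, 0) \<noteq> 0"
  proof (cases "a $$ (0, 0) = 0 \<and> c \<noteq> 0\<^sub>m m 1")
    case True
    then obtain k where "k < m" "c $$ (k, 0) \<noteq> 0"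
      using c by (metis (no_types, lifting) eq_matI carrier_matD index_zero_mat less_one)
    with True that show ?thesis by blast
  qed (use that in blast)
  then show ?case
  proof cases
    case 1
    with pivot[OF a b c D] A show ?thesis by simp
  next
    case 2
    then have "reduced_norm A = 0"
      unfolding A 2(2) reduced_norm_block_triangular(1)[OF a b zero_carrier_mat D] reduced_norm_1x1[OF a]
      by simp
    then show ?thesis by (intro exI[of _ 0]) simp
  next
    case (3 k)
    \<comment> \<open>Left multiplication by \<open>r\<close> selects row \<open>k\<close>, so the
      operation adds row \<open>k\<close> of the lower blocks to the first row and makes the corner
      c_k.\<close>
    define r :: "quat mat" where "r = mat 1 m (\<lambda>(i, j). if j = k then 1 else 0)"
    have r: "r \<in> carrier_mat 1 m"
      by (simp add: r_def)
    let ?T = "four_block_mat (1\<^sub>m 1) r (0\<^sub>m m 1) (1\<^sub>m m)"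
    have "?T * A = four_block_mat (a + r * c) (b + r * D) c D"
      unfolding A using a b c D r
      by (subst mult_four_block_mat[of _ 1 1 _ m _ m _ _ 1 _ m]) (auto simp del: One_nat_def)
    moreover have "reduced_norm (?T * A) = reduced_norm A"
      using reduced_norm_mult[OF four_block_carrier_mat[OF one_carrier_mat one_carrier_mat], of A 1 m r "0\<^sub>m m 1"]
        Suc.prems
      unfolding reduced_norm_block_triangular(1)[OF one_carrier_mat r zero_carrier_mat one_carrier_mat]
        reduced_norm_one
      by simp
    moreover have "(a + r * c) $$ (0, 0) = c $$ (k, 0)"
      using a c r 3 by (simp add: mult_index_sum r_def if_distrib[of "\<lambda>x. x * _"] cong: if_cong
        del: index_mult_mat(1))
    moreover have "a + r * c \<in> carrier_mat 1 1" "b + r * D \<in> carrier_mat 1 m"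
      using a b c D r by auto
    ultimately show ?thesis
      using pivot[of "a + r * c" "b + r * D" c D] c D 3 by simp
  qed
qed

lemma reduced_norm_isometry:
  assumes g: "g \<in> carrier_mat m m" and J: "J \<in> carrier_mat m m" and K: "K \<in> carrier_mat m m"
    and JK: "J * K = 1\<^sub>m m" and iso: "adjoint_mat g * J * g = J"
  shows "reduced_norm g = 1"
proof -
  have "reduced_norm J * reduced_norm K = 1"
    using reduced_norm_mult[OF J K] by (simp add: JK reduced_norm_one)
  then have J0: "reduced_norm J \<noteq> 0"
    by auto
  have "reduced_norm (adjoint_mat g * J * g) = cnj (reduced_norm g) * reduced_norm J * reduced_norm g"
    using g J reduced_norm_mult[of "adjoint_mat g * J" m g] reduced_norm_mult[of "adjoint_mat g" m J]
      reduced_norm_adjoint[OF g] mult_carrier_mat[OF adjoint_mat_carrier[OF g] J]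
    by simp
  then have "cnj (reduced_norm g) * reduced_norm J * reduced_norm g = reduced_norm J"
    by (simp only: iso)
  with J0 have "cnj (reduced_norm g) * reduced_norm g = 1"
    by (simp add: mult.commute mult.left_commute)
  moreover obtain r where r: "r \<ge> 0" "reduced_norm g = of_real r"
    using reduced_norm_nonneg[OF g] by auto
  ultimately have "complex_of_real (r * r) = of_real 1"
    by simp
  then have "r * r = 1"
    unfolding of_real_eq_iff .
  with r have "r = 1"
    using power2_eq_iff_nonneg[of r 1] by (simp add: power2_eq_square)
  with r show ?thesis by simp
qed

section \<open>Linear combinations, bases and dimension\<close>

lemma right_smult_dim [simp]: "dim_vec (right_smult v a) = dim_vec v"
  by (simp add: right_smult_def)

lemma right_smult_carrier [simp]: "right_smult v a \<in> carrier_vec n \<longleftrightarrow> v \<in> carrier_vec n"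
  by (simp add: right_smult_def)

lemma right_smult_index [simp]: "i < dim_vec v \<Longrightarrow> right_smult v a $ i = v $ i * a"
  by (simp add: right_smult_def)

lemma right_smult_simps [simp]:
  "right_smult v 1 = v" "right_smult (0\<^sub>v n) a = 0\<^sub>v n"
  "right_smult (right_smult v a) b = right_smult v (a * b)"
  by (auto simp: right_smult_def mult.assoc)

lemma right_smult_zero [simp]: "v \<in> carrier_vec n \<Longrightarrow> right_smult v 0 = 0\<^sub>v n"
  by (auto simp: right_smult_def)

lemma right_smult_eq_0:
  assumes "right_smult v a = 0\<^sub>v n" "v \<in> carrier_vec n"
  shows "a = 0 \<or> v = 0\<^sub>v n"
proof (rule disjCI)
  assume "v \<noteq> 0\<^sub>v n"
  then obtain i where "i < n" "v $ i \<noteq> 0"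
    using assms(2) by (metis carrier_vecD eq_vecI index_zero_vec)
  moreover have "right_smult v a $ i = 0"
    using assms \<open>i < n\<close> by simp
  ultimately show "a = 0" using assms(2) by simp
qed

lemma mat_right_smult:
  fixes A :: "quat mat"
  assumes "dim_vec v = dim_col A"
  shows "A *\<^sub>v right_smult v a = right_smult (A *\<^sub>v v) a"
  using assms by (intro eq_vecI) (auto simp: scalar_prod_def sum_distrib_right mult.assoc)

lemma lin_comb_dim [simp]: "dim_vec (lin_comb n vs c) = n"
  by (simp add: lin_comb_def)

lemma lin_comb_carrier [simp]: "lin_comb n vs c \<in> carrier_vec n"
  by (simp add: carrier_vecI)

lemma lin_comb_index [simp]:
  "k < n \<Longrightarrow> lin_comb n vs c $ k = (\<Sum>i<length vs. vs ! i $ k * c i)"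
  by (simp add: lin_comb_def)

lemma lin_comb_Nil [simp]: "lin_comb n [] c = 0\<^sub>v n"
  by (auto simp: lin_comb_def)

lemma lin_comb_snoc:
  "v \<in> carrier_vec n \<Longrightarrow>
    lin_comb n (vs @ [v]) c = lin_comb n vs c + right_smult v (c (length vs))"
  by (intro eq_vecI) (auto simp: nth_append)

lemma lin_comb_append:
  "lin_comb n (vs @ ws) c = lin_comb n vs c + lin_comb n ws (\<lambda>i. c (i + length vs))"
proof (rule eq_vecI)
  fix k assume "k < dim_vec (lin_comb n vs c + lin_comb n ws (\<lambda>i. c (i + length vs)))"
  then have k: "k < n" by simp
  have "(\<Sum>i<length vs + m. (vs @ ws) ! i $ k * c i) =
    (\<Sum>i<length vs. vs ! i $ k * c i) + (\<Sum>i<m. ws ! i $ k * c (i + length vs))" for m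
    by (induction m) (auto simp: nth_append add.commute add.assoc)
  with k show "lin_comb n (vs @ ws) c $ k =
      (lin_comb n vs c + lin_comb n ws (\<lambda>i. c (i + length vs))) $ k"
    by simp
qed simp

lemma lin_comb_cong:
  "(\<And>i. i < length vs \<Longrightarrow> c i = d i) \<Longrightarrow> lin_comb n vs c = lin_comb n vs d"
  by (intro eq_vecI) auto

lemma lin_comb_unit:
  assumes "i < length vs" "vs ! i \<in> carrier_vec n"
  shows "lin_comb n vs (\<lambda>k. if k = i then a else 0) = right_smult (vs ! i) a"
  using assms by (intro eq_vecI) (auto simp: if_distrib[of "\<lambda>x. _ * x"] cong: if_cong)

text \<open>Scalars act from the right, so the inner coefficient \<open>P j k\<close> stands to the
  left of the outer coefficient \<open>c j\<close>.\<close>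

lemma lin_comb_lin_comb:
  assumes "length cs = m" "\<And>j. j < m \<Longrightarrow> cs ! j = lin_comb n bs (P j)"
  shows "lin_comb n cs c = lin_comb n bs (\<lambda>k. \<Sum>j<m. P j k * c j)"
proof (rule eq_vecI)
  fix k assume "k < dim_vec (lin_comb n bs (\<lambda>k. \<Sum>j<m. P j k * c j))"
  then have k: "k < n" by simp
  have "lin_comb n cs c $ k = (\<Sum>j<m. \<Sum>i<length bs. bs ! i $ k * (P j i * c j))"
    using k assms by (simp add: sum_distrib_right mult.assoc)
  also have "\<dots> = (\<Sum>i<length bs. \<Sum>j<m. bs ! i $ k * (P j i * c j))"
    by (rule sum.swap)
  finally show "lin_comb n cs c $ k = lin_comb n bs (\<lambda>k. \<Sum>j<m. P j k * c j) $ k"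
    using k by (simp add: sum_distrib_left)
qed simp

lemma mat_lin_comb:
  fixes A :: "quat mat"
  assumes A: "A \<in> carrier_mat m n" and vs: "set vs \<subseteq> carrier_vec n"
  shows "A *\<^sub>v lin_comb n vs c = lin_comb m (map ((*\<^sub>v) A) vs) c"
proof (rule eq_vecI)
  fix k assume "k < dim_vec (lin_comb m (map ((*\<^sub>v) A) vs) c)"
  then have k: "k < m" by simp
  have dim: "dim_vec (vs ! i) = n" if "i < length vs" for i
    using vs that by (metis carrier_vecD nth_mem subsetD)
  have "(A *\<^sub>v lin_comb n vs c) $ k = (\<Sum>j<n. \<Sum>i<length vs. A $$ (k, j) * (vs ! i $ j * c i))"
    using k A by (simp add: scalar_prod_def lessThan_atLeast0 sum_distrib_left)
  also have "\<dots> = (\<Sum>i<length vs. \<Sum>j<n. A $$ (k, j) * (vs ! i $ j * c i))"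
    by (rule sum.swap)
  also have "\<dots> = lin_comb m (map ((*\<^sub>v) A) vs) c $ k"
    using k A dim
    by (simp add: scalar_prod_def lessThan_atLeast0 sum_distrib_right mult.assoc)
  finally show "(A *\<^sub>v lin_comb n vs c) $ k = lin_comb m (map ((*\<^sub>v) A) vs) c $ k" .
qed (use A in simp)

lemma lin_comb_diff:
  "lin_comb n vs (\<lambda>i. c i - d i) = lin_comb n vs c - lin_comb n vs d"
  by (intro eq_vecI) (auto simp: right_diff_distrib sum_subtractf)

lemma lin_comb_add:
  "lin_comb n vs (\<lambda>i. c i + d i) = lin_comb n vs c + lin_comb n vs d"
  by (intro eq_vecI) (auto simp: distrib_left sum.distrib)

lemma right_smult_lin_comb:
  "right_smult (lin_comb n vs c) a = lin_comb n vs (\<lambda>i. c i * a)"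
  by (intro eq_vecI) (auto simp: sum_distrib_right mult.assoc)

text \<open>The real numbers serve for submodules and their dimensions, \<open>UNIV\<close> for the
  lowest weight spaces and their bases; the closure properties are read off in both cases at
  once.\<close>

definition scalar_field :: "quat set \<Rightarrow> bool" where
  "scalar_field K \<longleftrightarrow> K = \<real> \<or> K = UNIV"

lemma scalar_field_simps [simp]: "scalar_field \<real>" "scalar_field UNIV"
  by (auto simp: scalar_field_def)

lemma scalar_field_closed:
  assumes "scalar_field K"
  shows "0 \<in> K" "1 \<in> K" "a \<in> K \<Longrightarrow> b \<in> K \<Longrightarrow> a + b \<in> K" "a \<in> K \<Longrightarrow> b \<in> K \<Longrightarrow> a - b \<in> K"
    "a \<in> K \<Longrightarrow> b \<in> K \<Longrightarrow> a * b \<in> K" "(\<And>i. i \<in> I \<Longrightarrow> f i \<in> K) \<Longrightarrow> sum f I \<in> K"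
    "- 1 \<in> K"
  using assms by (auto simp: scalar_field_def intro: sum_in_Reals)

lemma subspace_carrier: "is_subspace K n W \<Longrightarrow> W \<subseteq> carrier_vec n"
  and subspace_zero: "is_subspace K n W \<Longrightarrow> 0\<^sub>v n \<in> W"
  and subspace_add: "is_subspace K n W \<Longrightarrow> v \<in> W \<Longrightarrow> w \<in> W \<Longrightarrow> v + w \<in> W"
  and subspace_smult: "is_subspace K n W \<Longrightarrow> v \<in> W \<Longrightarrow> a \<in> K \<Longrightarrow> right_smult v a \<in> W"
  by (auto simp: is_subspace_def)

lemma subspace_diff:
  assumes "is_subspace K n W" "scalar_field K" "v \<in> W" "w \<in> W"
  shows "v - w \<in> W"
proof -
  have "v - w = v + right_smult w (- 1)"
    using subspace_carrier[OF assms(1)] assms(3,4) by (intro eq_vecI) auto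
  then show ?thesis
    using assms by (simp add: subspace_add subspace_smult scalar_field_closed)
qed

lemma subspace_lin_comb:
  assumes W: "is_subspace K n W" and "set vs \<subseteq> W" "range c \<subseteq> K"
  shows "lin_comb n vs c \<in> W"
  using assms(2)
proof (induction vs rule: rev_induct)
  case Nil
  with W show ?case by (simp add: subspace_zero)
next
  case (snoc v vs)
  with subspace_carrier[OF W] have "v \<in> carrier_vec n" by auto
  with snoc W assms(3) show ?case
    by (auto simp: lin_comb_snoc intro!: subspace_add[OF W] subspace_smult[OF W])
qed

lemma span_minimal:
  "is_subspace K n W \<Longrightarrow> S \<subseteq> W \<Longrightarrow> span_over K n S \<subseteq> W"
  by (auto simp: span_over_def intro!: subspace_lin_comb)

lemma span_superset:
  assumes "scalar_field K" "S \<subseteq> carrier_vec n"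
  shows "S \<subseteq> span_over K n S"
proof
  fix v assume v: "v \<in> S"
  then have "v = lin_comb n [v] (\<lambda>_. 1)"
    using assms(2) by (intro eq_vecI) auto
  with v show "v \<in> span_over K n S"
    unfolding span_over_def using scalar_field_closed(2)[OF assms(1)]
    by (intro CollectI exI[of _ "[v]"] exI[of _ "\<lambda>_. 1"]) auto
qed

lemma span_subspace:
  assumes K: "scalar_field K"
  shows "is_subspace K n (span_over K n S)"
  unfolding is_subspace_def
proof (intro conjI ballI)
  show "span_over K n S \<subseteq> carrier_vec n"
    by (auto simp: span_over_def)
  show "0\<^sub>v n \<in> span_over K n S"
    unfolding span_over_def using scalar_field_closed(1)[OF K]
    by (intro CollectI exI[of _ "[]"] exI[of _ "\<lambda>_. 0"]) auto
next
  fix v w assume "v \<in> span_over K n S" "w \<in> span_over K n S"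
  then obtain vs c ws d where *: "v = lin_comb n vs c" "set vs \<subseteq> S" "range c \<subseteq> K"
      "w = lin_comb n ws d" "set ws \<subseteq> S" "range d \<subseteq> K"
    by (auto simp: span_over_def)
  let ?e = "\<lambda>i. if i < length vs then c i else d (i - length vs)"
  have "v + w = lin_comb n (vs @ ws) ?e"
    unfolding * lin_comb_append by (intro arg_cong2[where f = "(+)"] lin_comb_cong) auto
  with * show "v + w \<in> span_over K n S"
    unfolding span_over_def by (intro CollectI exI[of _ "vs @ ws"] exI[of _ ?e]) auto
next
  fix v a assume "v \<in> span_over K n S" and a: "a \<in> K"
  then obtain vs c where *: "v = lin_comb n vs c" "set vs \<subseteq> S" "range c \<subseteq> K"
    by (auto simp: span_over_def)
  with a K show "right_smult v a \<in> span_over K n S"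
    unfolding span_over_def right_smult_lin_comb *
    by (intro CollectI exI[of _ vs] exI[of _ "\<lambda>i. c i * a"])
       (auto simp: right_smult_lin_comb intro!: scalar_field_closed)
qed

text \<open>Left matrices commute with right scalars, so the preimage of the span is again a
  subspace; it contains the generators and hence the span.\<close>

lemma span_mat_stable:
  assumes K: "scalar_field K" and A: "A \<in> carrier_mat n n" and S: "S \<subseteq> carrier_vec n"
    and stable: "\<And>v. v \<in> S \<Longrightarrow> A *\<^sub>v v \<in> span_over K n S" and w: "w \<in> span_over K n S"
  shows "A *\<^sub>v w \<in> span_over K n S"
proof -
  note sub = span_subspace[OF K, of n S]
  have zero: "A *\<^sub>v 0\<^sub>v n = 0\<^sub>v n"
    using A by (intro eq_vecI) auto
  have "is_subspace K n {v \<in> carrier_vec n. A *\<^sub>v v \<in> span_over K n S}"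
    using A sub
    by (auto simp: is_subspace_def zero mult_add_distrib_mat_vec[OF A] mat_right_smult)
  from span_minimal[OF this, of S] stable S w show ?thesis
    by auto
qed

text \<open>\<open>span_over\<close> admits every list of vectors from the set, in any order and
  with repetitions. Since the combinations of one fixed list are already a subspace, a basis can be
  used as its own list in expansions.\<close>

lemma lin_comb_subspace:
  assumes K: "scalar_field K"
  shows "is_subspace K n {lin_comb n bs c | c. range c \<subseteq> K}"
  unfolding is_subspace_def
proof (intro conjI ballI)
  have "0\<^sub>v n = lin_comb n bs (\<lambda>_. 0)"
    by (intro eq_vecI) auto
  then show "0\<^sub>v n \<in> {lin_comb n bs c | c. range c \<subseteq> K}"
    using scalar_field_closed(1)[OF K] by auto
next
  fix v w assume "v \<in> {lin_comb n bs c | c. range c \<subseteq> K}" "w \<in> {lin_comb n bs c | c. range c \<subseteq> K}"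
  then obtain c d where "v = lin_comb n bs c" "w = lin_comb n bs d" "range c \<subseteq> K" "range d \<subseteq> K"
    by auto
  then show "v + w \<in> {lin_comb n bs c | c. range c \<subseteq> K}"
    using scalar_field_closed(3)[OF K]
    by (intro CollectI exI[of _ "\<lambda>i. c i + d i"]) (auto simp: lin_comb_add)
next
  fix v a assume "v \<in> {lin_comb n bs c | c. range c \<subseteq> K}" and a: "a \<in> K"
  then obtain c where "v = lin_comb n bs c" "range c \<subseteq> K"
    by auto
  then show "right_smult v a \<in> {lin_comb n bs c | c. range c \<subseteq> K}"
    using scalar_field_closed(5)[OF K] a
    by (intro CollectI exI[of _ "\<lambda>i. c i * a"]) (auto simp: right_smult_lin_comb)
qed auto

lemma basis_expand:
  assumes K: "scalar_field K" and b: "is_basis K n W bs" and W: "W \<subseteq> carrier_vec n" and w: "w \<in> W"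
  obtains c where "range c \<subseteq> K" "w = lin_comb n bs c"
proof -
  have "set bs \<subseteq> {lin_comb n bs c | c. range c \<subseteq> K}"
  proof
    fix v assume "v \<in> set bs"
    then obtain i where i: "i < length bs" "v = bs ! i"
      by (auto simp: in_set_conv_nth)
    moreover from b W have "set bs \<subseteq> carrier_vec n"
      by (auto simp: is_basis_def)
    ultimately have "v = lin_comb n bs (\<lambda>k. if k = i then 1 else 0)"
      by (subst lin_comb_unit) (auto dest: nth_mem)
    then show "v \<in> {lin_comb n bs c | c. range c \<subseteq> K}"
      using scalar_field_closed(1,2)[OF K] by auto
  qed
  from span_minimal[OF lin_comb_subspace[OF K] this] b w that show thesis
    by (auto simp: is_basis_def)
qed

lemma is_basisI:
  assumes "scalar_field K" "is_subspace K n W" "set bs \<subseteq> W"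
    and "\<And>w. w \<in> W \<Longrightarrow> \<exists>c. range c \<subseteq> K \<and> w = lin_comb n bs c"
    and "\<And>c i. range c \<subseteq> K \<Longrightarrow> lin_comb n bs c = 0\<^sub>v n \<Longrightarrow> i < length bs \<Longrightarrow> c i = 0"
  shows "is_basis K n W bs"
  using assms span_minimal[OF assms(2,3)] unfolding is_basis_def span_over_def
  by blast

lemma QRe_sum: "QRe (sum f A) = (\<Sum>x\<in>A. QRe (f x))"
  by (induction A rule: infinite_finite_induct) (simp_all add: zero_quat_def plus_quat_def)

lemma QRe_of_nat [simp]: "QRe 1 = 1" "QRe (of_nat m) = real m"
  by (induction m) (simp_all add: zero_quat_def one_quat_def plus_quat_def)

lemma QRe_mult_commute: "QRe (x * y) = QRe (y * x)"
  by (simp add: times_quat_def)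

text \<open>The real part of the trace of a quaternionic matrix is invariant under cyclic permutations,
  so mutually inverse base change matrices have the same number of rows and columns.\<close>

lemma basis_length_unique:
  assumes K: "scalar_field K" and W: "W \<subseteq> carrier_vec n"
    and bs: "is_basis K n W bs" and cs: "is_basis K n W cs"
  shows "length bs = length cs"
proof -
  have base_change: "\<exists>P. (\<forall>j. range (P j) \<subseteq> K) \<and> (\<forall>j<length cs. cs ! j = lin_comb n bs (P j))"
    if b: "is_basis K n W bs" and c: "is_basis K n W cs" for bs cs
  proof -
    \<comment> \<open>Indices beyond the list only need some family with values in \<open>K\<close>,
      so that a single choice function covers all \<open>j\<close>.\<close>
    have "\<exists>p. range p \<subseteq> K \<and> (j < length cs \<longrightarrow> cs ! j = lin_comb n bs p)" for j
    proof (cases "j < length cs")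
      case True
      with c have "cs ! j \<in> W" by (auto simp: is_basis_def)
      from basis_expand[OF K b W this] True show ?thesis by metis
    next
      case False
      with scalar_field_closed(1)[OF K] show ?thesis by auto
    qed
    then show ?thesis by metis
  qed
  obtain P where P: "\<And>j. range (P j) \<subseteq> K" "\<And>j. j < length cs \<Longrightarrow> cs ! j = lin_comb n bs (P j)"
    using base_change[OF bs cs] by blast
  obtain Q where Q: "\<And>j. range (Q j) \<subseteq> K" "\<And>j. j < length bs \<Longrightarrow> bs ! j = lin_comb n cs (Q j)"
    using base_change[OF cs bs] by blast
  have inverse: "(\<Sum>j<length cs. P j k * Q i j) = (if k = i then 1 else 0)"
    if b: "is_basis K n W bs" and i: "i < length bs" and k: "k < length bs"
      and P: "\<And>j. range (P j) \<subseteq> K" "\<And>j. j < length cs \<Longrightarrow> cs ! j = lin_comb n bs (P j)"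
      and Q: "\<And>j. range (Q j) \<subseteq> K" "\<And>j. j < length bs \<Longrightarrow> bs ! j = lin_comb n cs (Q j)"
    for bs cs and P Q :: "nat \<Rightarrow> nat \<Rightarrow> quat" and i k
  proof -
    let ?c = "\<lambda>k. \<Sum>j<length cs. P j k * Q i j" and ?d = "\<lambda>k. if k = i then 1 else 0"
    have bi: "bs ! i \<in> carrier_vec n"
      using b W nth_mem[OF i] unfolding is_basis_def by blast
    have "lin_comb n bs ?c = bs ! i"
      using Q(2)[OF i] lin_comb_lin_comb[OF refl P(2), of "Q i"] by simp
    also have "\<dots> = lin_comb n bs ?d"
      using lin_comb_unit[OF i bi, of 1] by simp
    finally have "lin_comb n bs (\<lambda>k. ?c k - ?d k) = 0\<^sub>v n"
      unfolding lin_comb_diff by simp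
    moreover have "range (\<lambda>k. ?c k - ?d k) \<subseteq> K"
      using P(1) Q(1)[of i] K by (auto intro!: scalar_field_closed)
    ultimately have "?c k - ?d k = 0"
      using b k unfolding is_basis_def by blast
    then show ?thesis by simp
  qed
  have "real (length bs) = QRe (\<Sum>i<length bs. \<Sum>j<length cs. P j i * Q i j)"
    using inverse[OF bs _ _ P Q] by simp
  also have "\<dots> = (\<Sum>i<length bs. \<Sum>j<length cs. QRe (Q i j * P j i))"
    by (simp add: QRe_sum QRe_mult_commute)
  also have "\<dots> = QRe (\<Sum>j<length cs. \<Sum>i<length bs. Q i j * P j i)"
    unfolding QRe_sum by (rule sum.swap)
  also have "\<dots> = real (length cs)"
    using inverse[OF cs _ _ Q P] by simp
  finally show ?thesis by simp
qed

lemma dim_over_eq: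
  assumes "scalar_field K" "W \<subseteq> carrier_vec n" "is_basis K n W bs"
  shows "dim_over K n W = length bs"
  unfolding dim_over_def
  by (rule basis_length_unique[OF assms(1,2) _ assms(3)]) (rule someI, rule assms(3))

section \<open>Orthogonal bases\<close>

text \<open>If \<open>m\<close> exceeded \<open>n\<close>, padding both factors with zeros to square
  size would keep the product equal to 1; then the reversed product would be 1 as well, although its
  row \<open>n\<close> is zero.\<close>

lemma one_factor_dim:
  fixes F E :: "quat mat"
  assumes F: "F \<in> carrier_mat m n" and E: "E \<in> carrier_mat n m" and FE: "F * E = 1\<^sub>m m"
  shows "m \<le> n"
proof (rule ccontr)
  assume "\<not> m \<le> n"
  then have mn: "n < m" by simp
  define F' where "F' = mat m m (\<lambda>(i, j). if j < n then F $$ (i, j) else 0)"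
  define E' where "E' = mat m m (\<lambda>(i, j). if i < n then E $$ (i, j) else 0)"
  have c: "F' \<in> carrier_mat m m" "E' \<in> carrier_mat m m"
    by (auto simp: F'_def E'_def)
  have "F' * E' = F * E"
  proof (rule eq_matI)
    fix i j assume ij: "i < dim_row (F * E)" "j < dim_col (F * E)"
    have "(F' * E') $$ (i, j) = (\<Sum>k<m. if k < n then F $$ (i, k) * E $$ (k, j) else 0)"
      using ij F E c
      by (subst mult_index_sum) (auto simp: F'_def E'_def intro!: sum.cong)
    also have "\<dots> = (\<Sum>k<n. F $$ (i, k) * E $$ (k, j))"
      using mn by (intro sum.mono_neutral_cong_right) auto
    also have "\<dots> = (F * E) $$ (i, j)"
      using ij F E by (subst mult_index_sum) auto
    finally show "(F' * E') $$ (i, j) = (F * E) $$ (i, j)" .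
  qed (use F E c in auto)
  then have "E' * F' = 1\<^sub>m m"
    unfolding FE by (rule quat_mat_left_right_inverse[OF c])
  then have "(E' * F') $$ (n, n) = 1"
    using mn by simp
  moreover have "(E' * F') $$ (n, n) = 0"
    using mn c by (subst mult_index_sum) (auto simp: E'_def)
  ultimately show False by simp
qed

text \<open>One notion for Hermitian and skew-Hermitian forms, since the forms on the L(d - 1)
  alternate between the two with the parity of d.\<close>

definition eps_hermitian :: "quat \<Rightarrow> nat \<Rightarrow> (quat vec \<Rightarrow> quat vec \<Rightarrow> quat) \<Rightarrow> bool" where
  "eps_hermitian e n h \<longleftrightarrow> (e = 1 \<or> e = - 1) \<and> sesquilinear n h \<and>
     (\<forall>x\<in>carrier_vec n. \<forall>y\<in>carrier_vec n. h y x = e * qcnj (h x y))"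

lemma sesquilinearD:
  assumes "sesquilinear n h" "x \<in> carrier_vec n" "y \<in> carrier_vec n"
  shows "z \<in> carrier_vec n \<Longrightarrow> h (x + y) z = h x z + h y z"
    "z \<in> carrier_vec n \<Longrightarrow> h x (y + z) = h x y + h x z"
    "h (right_smult x a) y = qcnj a * h x y" "h x (right_smult y a) = h x y * a"
  using assms by (auto simp: sesquilinear_def)

lemma sesquilinear_zero:
  assumes "sesquilinear n h" "x \<in> carrier_vec n"
  shows "h x (0\<^sub>v n) = 0" "h (0\<^sub>v n) x = 0"
  using sesquilinearD(4)[OF assms, of "0\<^sub>v n" 0] sesquilinearD(3)[OF assms(1) _ assms(2), of "0\<^sub>v n" 0]
  by simp_all

lemma sesquilinear_lin_comb:
  assumes h: "sesquilinear n h" and x: "x \<in> carrier_vec n" and "set vs \<subseteq> carrier_vec n"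
  shows "h x (lin_comb n vs c) = (\<Sum>i<length vs. h x (vs ! i) * c i)"
  using assms(3)
  by (induction vs rule: rev_induct)
     (simp_all add: lin_comb_snoc nth_append sesquilinear_zero[OF h x] sesquilinearD[OF h x])

lemma sesquilinear_diff:
  assumes "sesquilinear n h" "x \<in> carrier_vec n" "y \<in> carrier_vec n" "z \<in> carrier_vec n"
  shows "h x (y - z) = h x y - h x z"
proof -
  have "y - z = y + right_smult z (- 1)"
    using assms(3,4) by (intro eq_vecI) auto
  with assms show ?thesis
    by (simp add: sesquilinearD)
qed

lemma eps_hermitianD:
  assumes "eps_hermitian e n h"
  shows "sesquilinear n h" "e = 1 \<or> e = - 1"
    "x \<in> carrier_vec n \<Longrightarrow> y \<in> carrier_vec n \<Longrightarrow> h y x = e * qcnj (h x y)"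
    "x \<in> carrier_vec n \<Longrightarrow> y \<in> carrier_vec n \<Longrightarrow> h y x = 0 \<longleftrightarrow> h x y = 0"
proof -
  show "h y x = 0 \<longleftrightarrow> h x y = 0" if "x \<in> carrier_vec n" "y \<in> carrier_vec n"
  proof -
    have "h y x = e * qcnj (h x y)" "e \<noteq> 0"
      using that assms unfolding eps_hermitian_def by (blast, force)
    moreover have "qcnj z = 0 \<longleftrightarrow> z = 0" for z
      by (metis qcnj_simps(1) qcnj_simps(3))
    ultimately show ?thesis by simp
  qed
qed (use assms in \<open>unfold eps_hermitian_def, blast+\<close>)

text \<open>Orthogonal vectors with nonzero diagonal values are automatically independent, so such
  lists can be enlarged greedily until they form a basis.\<close>

definition anisotropic_list :: "(quat vec \<Rightarrow> quat vec \<Rightarrow> quat) \<Rightarrow> quat vec list \<Rightarrow> bool" where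
  "anisotropic_list h bs \<longleftrightarrow> (\<forall>i<length bs. h (bs ! i) (bs ! i) \<noteq> 0 \<and>
     (\<forall>j<length bs. i \<noteq> j \<longrightarrow> h (bs ! i) (bs ! j) = 0))"

lemma anisotropic_list_coefficient:
  assumes h: "sesquilinear n h" and bs: "anisotropic_list h bs" "set bs \<subseteq> carrier_vec n"
    and i: "i < length bs"
  shows "h (bs ! i) (lin_comb n bs c) = h (bs ! i) (bs ! i) * c i"
proof -
  have "h (bs ! i) (lin_comb n bs c) = (\<Sum>j<length bs. h (bs ! i) (bs ! j) * c j)"
    using bs i by (intro sesquilinear_lin_comb[OF h]) auto
  also have "\<dots> = (\<Sum>j<length bs. if j = i then h (bs ! i) (bs ! i) * c i else 0)"
    using bs i by (intro sum.cong) (auto simp: anisotropic_list_def)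
  finally show ?thesis using i by simp
qed

lemma anisotropic_list_independent:
  assumes h: "sesquilinear n h" and bs: "anisotropic_list h bs" "set bs \<subseteq> carrier_vec n"
    and i: "i < length bs" and "lin_comb n bs c = 0\<^sub>v n"
  shows "c i = 0"
proof -
  have "h (bs ! i) (bs ! i) * c i = 0"
    using anisotropic_list_coefficient[OF h bs i, of c] assms(5) bs(2) i
    by (simp add: sesquilinear_zero[OF h] subset_iff)
  with bs(1) i show ?thesis by (auto simp: anisotropic_list_def)
qed

text \<open>The rows of the left factor are the functionals h(b_i, -) divided by h(b_i, b_i), the
  columns of the right factor are the b_j. Orthogonality says that their product is the identity,
  and \<open>one_factor_dim\<close> bounds its size.\<close>

lemma anisotropic_list_length:
  assumes h: "sesquilinear n h" and bs: "anisotropic_list h bs" "set bs \<subseteq> carrier_vec n"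
  shows "length bs \<le> n"
proof (rule one_factor_dim)
  let ?m = "length bs"
  let ?F = "mat ?m n (\<lambda>(i, k). inverse (h (bs ! i) (bs ! i)) * h (bs ! i) (unit_vec n k))"
  let ?E = "mat n ?m (\<lambda>(k, j). bs ! j $ k)"
  show "?F \<in> carrier_mat ?m n" "?E \<in> carrier_mat n ?m"
    by auto
  show "?F * ?E = 1\<^sub>m ?m"
  proof (rule eq_matI)
    fix i j assume "i < dim_row (1\<^sub>m ?m :: quat mat)" "j < dim_col (1\<^sub>m ?m :: quat mat)"
    then have ij: "i < ?m" "j < ?m" by auto
    have b: "bs ! i \<in> carrier_vec n" "bs ! j \<in> carrier_vec n"
      using bs ij by auto
    have "lin_comb n (map (unit_vec n) [0..<n]) (\<lambda>k. bs ! j $ k) = bs ! j"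
      using b by (intro eq_vecI) (auto simp: unit_vec_def if_distrib[of "\<lambda>x. x * _"] cong: if_cong)
    moreover have "h (bs ! i) (lin_comb n (map (unit_vec n) [0..<n]) (\<lambda>k. bs ! j $ k)) =
        (\<Sum>k<n. h (bs ! i) (unit_vec n k) * bs ! j $ k)"
      by (subst sesquilinear_lin_comb[OF h b(1)]) auto
    ultimately have "(\<Sum>k<n. h (bs ! i) (unit_vec n k) * bs ! j $ k) = h (bs ! i) (bs ! j)"
      by simp
    then have "(?F * ?E) $$ (i, j) = inverse (h (bs ! i) (bs ! i)) * h (bs ! i) (bs ! j)"
      using ij by (subst mult_index_sum) (auto simp: mult.assoc sum_distrib_left[symmetric])
    then show "(?F * ?E) $$ (i, j) = 1\<^sub>m ?m $$ (i, j)"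
      using bs(1) ij by (auto simp: anisotropic_list_def)
  qed auto
qed

lemma orthogonal_projection:
  assumes h: "sesquilinear n h" and bs: "anisotropic_list h bs" "set bs \<subseteq> carrier_vec n"
    and w: "w \<in> carrier_vec n"
  obtains c where "\<And>i. i < length bs \<Longrightarrow> h (bs ! i) (w - lin_comb n bs c) = 0"
proof
  fix i assume i: "i < length bs"
  let ?c = "\<lambda>i. inverse (h (bs ! i) (bs ! i)) * h (bs ! i) w"
  from i bs have "bs ! i \<in> carrier_vec n" "h (bs ! i) (bs ! i) \<noteq> 0"
    by (auto simp: anisotropic_list_def)
  then show "h (bs ! i) (w - lin_comb n bs ?c) = 0"
    using anisotropic_list_coefficient[OF h bs i, of ?c] w
    by (simp add: sesquilinear_diff[OF h] mult.assoc[symmetric])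
qed

text \<open>Polarisation gives h(u, v') + h(v', u) = 0. If h(u, v) were nonzero, right multiples v'
  of v would give h(u, v') any prescribed value w, so w = - e cnj(w) for all w; w = 1 contradicts e
  = 1, and w = i contradicts e = -1. Thus a quaternionic skew-Hermitian form cannot be alternating
  unless it vanishes.\<close>

lemma totally_isotropic:
  assumes h: "eps_hermitian e n h" and W: "is_subspace UNIV n W"
    and iso: "\<And>u. u \<in> W \<Longrightarrow> h u u = 0" and uv: "u \<in> W" "v \<in> W"
  shows "h u v = 0"
proof (rule ccontr)
  note s = eps_hermitianD(1)[OF h]
  define z where "z = h u v"
  assume "h u v \<noteq> 0"
  then have z: "z \<noteq> 0" by (simp add: z_def)
  have "w = - (e * qcnj w)" for w
  proof -
    \<comment> \<open>Scaled so that h(u, v') = z z^(-1) w = w.\<close>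
    define v' where "v' = right_smult v (inverse z * w)"
    have c: "u \<in> carrier_vec n" "v \<in> carrier_vec n" "v' \<in> carrier_vec n"
      using uv subspace_carrier[OF W] by (auto simp: v'_def)
    have "v' \<in> W"
      unfolding v'_def using uv(2) by (rule subspace_smult[OF W]) simp
    then have "h (u + v') (u + v') = 0" "h u u = 0" "h v' v' = 0"
      using iso uv(1) subspace_add[OF W] by blast+
    moreover have "h (u + v') (u + v') = (h u u + h u v') + (h v' u + h v' v')"
      by (simp only: sesquilinearD(1)[OF s c(1,3) add_carrier_vec[OF c(1,3)]]
          sesquilinearD(2)[OF s c(1) c(1) c(3)] sesquilinearD(2)[OF s c(3) c(1) c(3)])
    ultimately have "h u v' + h v' u = 0"
      by (simp only: add_0_left add_0_right)
    moreover have "h v' u = e * qcnj (h u v')"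
      using eps_hermitianD(3)[OF h] c by blast
    moreover have "h u v' = w"
      using sesquilinearD(4)[OF s c(1,2), of "inverse z * w"] z
      by (simp add: v'_def z_def[symmetric] mult.assoc[symmetric])
    ultimately show ?thesis
      by (simp only: eq_neg_iff_add_eq_0)
  qed
  from this[of 1] this[of qi] eps_hermitianD(2)[OF h] show False
    by (auto simp: qi_def qcnj_def quat_ring_defs)
qed

lemma vec_minus_eq_0:
  fixes v w :: "quat vec"
  assumes "v - w = 0\<^sub>v n" "v \<in> carrier_vec n" "w \<in> carrier_vec n"
  shows "v = w"
proof (rule eq_vecI)
  fix i assume "i < dim_vec w"
  with assms(2,3) arg_cong[OF assms(1), of "\<lambda>u. u $ i"] show "v $ i = w $ i"
    by simp
qed (use assms in simp)

text \<open>A longest anisotropic list exists because lengths are bounded by \<open>n\<close>. A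
  vector of its orthogonal complement in \<open>W\<close> with nonzero diagonal value would extend
  the list, so the form vanishes on the complement; the complement then lies in the radical and is
  zero. Orthogonal projection shows that the list spans.\<close>

lemma orthogonal_basis_exists:
  assumes h: "eps_hermitian e n h" and W: "is_subspace UNIV n W"
    and nondeg: "\<And>u. u \<in> W \<Longrightarrow> (\<And>v. v \<in> W \<Longrightarrow> h u v = 0) \<Longrightarrow> u = 0\<^sub>v n"
  obtains bs where "is_orthogonal_basis n W h bs" "anisotropic_list h bs"
proof -
  note s = eps_hermitianD(1)[OF h] and Wc = subspace_carrier[OF W]
  let ?P = "\<lambda>bs. set bs \<subseteq> W \<and> anisotropic_list h bs"
  have "\<exists>bs. ?P bs \<and> (\<forall>cs. ?P cs \<longrightarrow> length cs \<le> length bs)"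
  proof (rule ex_has_greatest_nat)
    show "?P []" by (simp add: anisotropic_list_def)
    show "\<forall>bs. ?P bs \<longrightarrow> length bs < Suc n"
      using anisotropic_list_length[OF s] Wc by (metis less_Suc_eq_le subset_trans)
  qed
  then obtain bs where bs: "set bs \<subseteq> W" "anisotropic_list h bs"
      and max: "\<And>cs. set cs \<subseteq> W \<Longrightarrow> anisotropic_list h cs \<Longrightarrow> length cs \<le> length bs"
    by (elim exE conjE) simp
  have bsc: "set bs \<subseteq> carrier_vec n"
    using bs Wc by auto
  let ?U = "{u \<in> W. \<forall>i<length bs. h (bs ! i) u = 0}"
  have bi: "bs ! i \<in> carrier_vec n" if "i < length bs" for i
    using bsc that by auto
  have U: "is_subspace UNIV n ?U"
    unfolding is_subspace_def
  proof (intro conjI ballI)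
    show "?U \<subseteq> carrier_vec n" using Wc by auto
    show "0\<^sub>v n \<in> ?U"
      using subspace_zero[OF W] sesquilinear_zero(1)[OF s bi] by simp
  next
    fix v w assume vw: "v \<in> ?U" "w \<in> ?U"
    then have "v \<in> carrier_vec n" "w \<in> carrier_vec n" using Wc by auto
    then have "h (bs ! i) (v + w) = 0" if "i < length bs" for i
      using sesquilinearD(2)[OF s bi[OF that], of v w] vw that by simp
    with vw subspace_add[OF W] show "v + w \<in> ?U" by simp
  next
    fix v and a :: quat assume v: "v \<in> ?U"
    then have "v \<in> carrier_vec n" using Wc by auto
    then have "h (bs ! i) (right_smult v a) = 0" if "i < length bs" for i
      using sesquilinearD(4)[OF s bi[OF that], of v a] v that by simp
    with v subspace_smult[OF W] show "right_smult v a \<in> ?U" by simp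
  qed
  have iso: "h u u = 0" if u: "u \<in> ?U" for u
  proof (rule ccontr)
    assume nz: "h u u \<noteq> 0"
    have "h u (bs ! i) = 0" if "i < length bs" for i
    proof -
      have "u \<in> carrier_vec n" "h (bs ! i) u = 0" using u Wc that by auto
      with eps_hermitianD(4)[OF h bi[OF that], of u] show ?thesis by blast
    qed
    with u nz bs(2) have "anisotropic_list h (bs @ [u])"
      by (auto simp: anisotropic_list_def nth_append less_Suc_eq)
    with max[of "bs @ [u]"] u bs show False by auto
  qed
  have spans: "\<exists>c. range c \<subseteq> UNIV \<and> w = lin_comb n bs c" if w: "w \<in> W" for w
  proof -
    have wc: "w \<in> carrier_vec n" using w Wc by auto
    have perp: "\<exists>c. x - lin_comb n bs c \<in> ?U" if "x \<in> W" for x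
    proof -
      have "x \<in> carrier_vec n" using that Wc by auto
      from orthogonal_projection[OF s bs(2) bsc this] obtain c
        where "\<And>i. i < length bs \<Longrightarrow> h (bs ! i) (x - lin_comb n bs c) = 0" by blast
      moreover have "x - lin_comb n bs c \<in> W"
        using that W bs by (intro subspace_diff subspace_lin_comb) auto
      ultimately show ?thesis by blast
    qed
    from perp[OF w] obtain c where c: "w - lin_comb n bs c \<in> ?U" by blast
    have "w - lin_comb n bs c = 0\<^sub>v n"
    proof (rule nondeg)
      show w': "w - lin_comb n bs c \<in> W" using c by simp
      fix v assume v: "v \<in> W"
      from perp[OF v] obtain d where d: "v - lin_comb n bs d \<in> ?U" by blast
      define w' where "w' = w - lin_comb n bs c"
      have w'c: "w' \<in> carrier_vec n" and vc: "v \<in> carrier_vec n"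
        using wc v Wc by (auto simp: w'_def)
      have "h w' (v - lin_comb n bs d) = 0"
        unfolding w'_def by (rule totally_isotropic[OF h U iso c d])
      then have "h w' v = h w' (lin_comb n bs d)"
        unfolding sesquilinear_diff[OF s w'c vc lin_comb_carrier] by simp
      also have "\<dots> = (\<Sum>i<length bs. h w' (bs ! i) * d i)"
        by (rule sesquilinear_lin_comb[OF s w'c bsc])
      also have "\<dots> = 0"
      proof (intro sum.neutral ballI)
        fix i assume "i \<in> {..<length bs}"
        then have i: "i < length bs" by simp
        then have "h (bs ! i) w' = 0" using c by (simp add: w'_def)
        with eps_hermitianD(4)[OF h bi[OF i] w'c] show "h w' (bs ! i) * d i = 0" by simp
      qed
      finally show "h (w - lin_comb n bs c) v = 0"
        unfolding w'_def .
    qed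
    then have "w = lin_comb n bs c"
      using vec_minus_eq_0 wc lin_comb_carrier by blast
    then show ?thesis by blast
  qed
  have "is_basis UNIV n W bs"
    by (rule is_basisI[OF scalar_field_simps(2) W bs(1) spans])
       (simp_all add: anisotropic_list_independent[OF s bs(2) bsc])
  with bs(2) have "is_orthogonal_basis n W h bs"
    by (auto simp: is_orthogonal_basis_def anisotropic_list_def)
  with bs(2) that show thesis by blast
qed

lemma basis_independent:
  "is_basis K n W bs \<Longrightarrow> range c \<subseteq> K \<Longrightarrow> lin_comb n bs c = 0\<^sub>v n \<Longrightarrow> i < length bs \<Longrightarrow> c i = 0"
  unfolding is_basis_def by blast

text \<open>A basis vector with diagonal value 0 would be orthogonal to the whole basis, hence in
  the radical and zero, against independence. It covers arbitrary orthogonal bases because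
  \<open>signature\<close> picks one by \<open>SOME\<close>.\<close>

lemma orthogonal_basis_anisotropic:
  assumes h: "eps_hermitian e n h" and W: "is_subspace UNIV n W"
    and nondeg: "\<And>u. u \<in> W \<Longrightarrow> (\<And>v. v \<in> W \<Longrightarrow> h u v = 0) \<Longrightarrow> u = 0\<^sub>v n"
    and bs: "is_orthogonal_basis n W h bs"
  shows "anisotropic_list h bs"
proof -
  note s = eps_hermitianD(1)[OF h] and Wc = subspace_carrier[OF W]
  have basis: "is_basis UNIV n W bs"
    using bs by (simp add: is_orthogonal_basis_def)
  then have bsW: "set bs \<subseteq> W" by (simp add: is_basis_def)
  have "h (bs ! i) (bs ! i) \<noteq> 0" if i: "i < length bs" for i
  proof
    assume zero: "h (bs ! i) (bs ! i) = 0"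
    have biW: "bs ! i \<in> W" using bsW i by auto
    then have bic: "bs ! i \<in> carrier_vec n" using Wc by auto
    have "bs ! i = 0\<^sub>v n"
    proof (rule nondeg[OF biW])
      fix v assume "v \<in> W"
      from basis_expand[OF scalar_field_simps(2) basis Wc this] obtain c
        where v: "v = lin_comb n bs c" by blast
      have "h (bs ! i) v = (\<Sum>j<length bs. h (bs ! i) (bs ! j) * c j)"
        unfolding v using bsW Wc by (intro sesquilinear_lin_comb[OF s bic]) auto
      also have "\<dots> = 0"
        using bs i zero by (intro sum.neutral) (auto simp: is_orthogonal_basis_def)
      finally show "h (bs ! i) v = 0" .
    qed
    then have "lin_comb n bs (\<lambda>k. if k = i then 1 else 0) = 0\<^sub>v n"
      using lin_comb_unit[OF i bic, of 1] by simp
    from basis_independent[OF basis _ this i] show False by simp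
  qed
  with bs show ?thesis
    by (auto simp: anisotropic_list_def is_orthogonal_basis_def)
qed

text \<open>An auxiliary positive definite form. Every other form is written as
  \<open>std_inner n x (J *\<^sub>v y)\<close>, which makes adjoints and Gram matrices
  available.\<close>

definition std_inner :: "nat \<Rightarrow> quat vec \<Rightarrow> quat vec \<Rightarrow> quat" where
  "std_inner n x y = (\<Sum>i<n. qcnj (x $ i) * y $ i)"

lemma std_inner_hermitian: "eps_hermitian 1 n (std_inner n)"
  unfolding eps_hermitian_def sesquilinear_def std_inner_def
proof (intro conjI ballI allI)
  fix x y z :: "quat vec" and a :: quat
  assume "x \<in> carrier_vec n" "y \<in> carrier_vec n"
  then have [simp]: "dim_vec x = n" "dim_vec y = n" by auto
  show "(\<Sum>i<n. qcnj (right_smult x a $ i) * y $ i) = qcnj a * (\<Sum>i<n. qcnj (x $ i) * y $ i)"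
    "(\<Sum>i<n. qcnj (x $ i) * right_smult y a $ i) = (\<Sum>i<n. qcnj (x $ i) * y $ i) * a"
    "(\<Sum>i<n. qcnj (y $ i) * x $ i) = 1 * qcnj (\<Sum>i<n. qcnj (x $ i) * y $ i)"
    unfolding sum_distrib_left sum_distrib_right qcnj_sum mult_1_left
    by (auto intro!: sum.cong simp: qcnj_mult mult.assoc)
  assume "z \<in> carrier_vec n"
  then have [simp]: "dim_vec z = n" by auto
  show "(\<Sum>i<n. qcnj ((x + y) $ i) * z $ i) =
      (\<Sum>i<n. qcnj (x $ i) * z $ i) + (\<Sum>i<n. qcnj (y $ i) * z $ i)"
    "(\<Sum>i<n. qcnj (x $ i) * (y + z) $ i) =
      (\<Sum>i<n. qcnj (x $ i) * y $ i) + (\<Sum>i<n. qcnj (x $ i) * z $ i)"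
    unfolding sum.distrib[symmetric]
    by (auto intro!: sum.cong simp: distrib_left distrib_right)
qed simp

lemma qcnj_mult_self: "qcnj x * x = of_real (norm x ^ 2)"
  by (simp add: of_real_def norm_quat_def qcnj_def quat_ring_defs scaleR_quat_def
      power2_eq_square algebra_simps)

lemma std_inner_self_eq_0:
  assumes "x \<in> carrier_vec n" "std_inner n x x = 0"
  shows "x = 0\<^sub>v n"
proof -
  have "std_inner n x x = of_real (\<Sum>i<n. norm (x $ i) ^ 2)"
    unfolding std_inner_def qcnj_mult_self by simp
  with assms(2) have "(\<Sum>i<n. norm (x $ i) ^ 2) = 0"
    by (metis of_real_eq_0_iff)
  then have "norm (x $ i) ^ 2 = 0" if "i < n" for i
    using that by (subst (asm) sum_nonneg_eq_0_iff) auto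
  with assms(1) show ?thesis by (intro eq_vecI) auto
qed

lemma std_inner_ext:
  assumes v: "v \<in> carrier_vec m" and w: "w \<in> carrier_vec m"
    and eq: "\<And>x. x \<in> carrier_vec m \<Longrightarrow> std_inner m x v = std_inner m x w"
  shows "v = w"
proof (rule vec_minus_eq_0[OF _ v w])
  have c: "v - w \<in> carrier_vec m" using v w by simp
  have "std_inner m (v - w) (v - w) = 0"
    unfolding sesquilinear_diff[OF eps_hermitianD(1)[OF std_inner_hermitian] c v w] using eq[OF c] by simp
  then show "v - w = 0\<^sub>v m" by (rule std_inner_self_eq_0[OF c])
qed

text \<open>The component z of \<open>w\<close> orthogonal to \<open>W\<close> works: z is nonzero,
  and its pairing with \<open>w\<close> equals its pairing with itself. Contrapositively, a vector
  annihilated by everything orthogonal to a subspace lies in it.\<close>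

lemma subspace_separation:
  assumes W: "is_subspace UNIV n W" and w: "w \<in> carrier_vec n" "w \<notin> W"
  obtains z where "z \<in> carrier_vec n" "\<forall>v\<in>W. std_inner n z v = 0" "std_inner n z w \<noteq> 0"
proof -
  let ?h = "std_inner n"
  note herm = std_inner_hermitian[of n] and Wc = subspace_carrier[OF W]
  note s = eps_hermitianD(1)[OF herm]
  obtain bs where bs: "is_orthogonal_basis n W ?h bs" "anisotropic_list ?h bs"
    using orthogonal_basis_exists[OF herm W] std_inner_self_eq_0 Wc by (metis subsetD)
  then have basis: "is_basis UNIV n W bs" by (simp add: is_orthogonal_basis_def)
  then have bsW: "set bs \<subseteq> W" and bsc: "set bs \<subseteq> carrier_vec n"
    using Wc by (auto simp: is_basis_def)
  obtain c where c: "\<And>i. i < length bs \<Longrightarrow> ?h (bs ! i) (w - lin_comb n bs c) = 0"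
    using orthogonal_projection[OF s bs(2) bsc w(1)] by blast
  let ?z = "w - lin_comb n bs c"
  have zc: "?z \<in> carrier_vec n" using w by auto
  have pW: "lin_comb n bs c \<in> W"
    using bsW by (intro subspace_lin_comb[OF W]) auto
  have w_eq: "w = ?z + lin_comb n bs c"
    using w by (intro eq_vecI) auto
  have "?z \<noteq> 0\<^sub>v n"
    using w_eq w(2) pW by auto
  have perp: "?h ?z v = 0" if v: "v \<in> W" for v
  proof -
    from basis_expand[OF scalar_field_simps(2) basis Wc v] obtain d where "v = lin_comb n bs d" by blast
    then have "?h ?z v = (\<Sum>i<length bs. ?h ?z (bs ! i) * d i)"
      using sesquilinear_lin_comb[OF s zc bsc] by blast
    also have "\<dots> = 0"
    proof (intro sum.neutral ballI)
      fix i assume "i \<in> {..<length bs}"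
      then have i: "i < length bs" by simp
      then have "bs ! i \<in> carrier_vec n" using bsc by auto
      from eps_hermitianD(4)[OF herm this zc] c[OF i] show "?h ?z (bs ! i) * d i = 0" by simp
    qed
    finally show ?thesis .
  qed
  have "?h ?z w = ?h ?z ?z + ?h ?z (lin_comb n bs c)"
    using sesquilinearD(2)[OF s zc zc lin_comb_carrier, of bs c] unfolding w_eq[symmetric] .
  then have "?h ?z w = ?h ?z ?z"
    using perp[OF pW] by simp
  with std_inner_self_eq_0[OF zc] \<open>?z \<noteq> 0\<^sub>v n\<close> have "?h ?z w \<noteq> 0" by metis
  with that[OF zc] perp show thesis by blast
qed

section \<open>Representations of the triple on column vectors\<close>

lemma square_mult_mat_vec_carrier [simp]:
  "A \<in> carrier_mat n n \<Longrightarrow> v \<in> carrier_vec n \<Longrightarrow> A *\<^sub>v v \<in> carrier_vec n"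
  by (rule mult_mat_vec_carrier)

lemma pow_mat_Suc_vec:
  fixes A :: "quat mat"
  assumes "A \<in> carrier_mat n n" "v \<in> carrier_vec n"
  shows "A ^\<^sub>m Suc k *\<^sub>v v = A ^\<^sub>m k *\<^sub>v (A *\<^sub>v v)" "A ^\<^sub>m Suc k *\<^sub>v v = A *\<^sub>v (A ^\<^sub>m k *\<^sub>v v)"
proof -
  have 1: "A ^\<^sub>m Suc k *\<^sub>v v = A ^\<^sub>m k *\<^sub>v (A *\<^sub>v v)" if "v \<in> carrier_vec n" for k v
    using assoc_mult_mat_vec[OF pow_carrier_mat[OF assms(1)] assms(1) that] by simp
  show "A ^\<^sub>m Suc k *\<^sub>v v = A ^\<^sub>m k *\<^sub>v (A *\<^sub>v v)"
    by (rule 1[OF assms(2)])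
  show "A ^\<^sub>m Suc k *\<^sub>v v = A *\<^sub>v (A ^\<^sub>m k *\<^sub>v v)"
    using assms(2)
  proof (induction k arbitrary: v)
    case 0
    with assms(1) show ?case by simp
  next
    case (Suc k)
    have Av: "A *\<^sub>v v \<in> carrier_vec n" using assms(1) Suc.prems by simp
    have "A ^\<^sub>m Suc (Suc k) *\<^sub>v v = A ^\<^sub>m Suc k *\<^sub>v (A *\<^sub>v v)"
      by (rule 1[OF Suc.prems])
    also have "\<dots> = A *\<^sub>v (A ^\<^sub>m k *\<^sub>v (A *\<^sub>v v))"
      by (rule Suc.IH[OF Av])
    also have "A ^\<^sub>m k *\<^sub>v (A *\<^sub>v v) = A ^\<^sub>m Suc k *\<^sub>v v"
      by (rule 1[OF Suc.prems, symmetric])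
    finally show ?case .
  qed
qed

lemma pow_mat_0_vec: "A \<in> carrier_mat n n \<Longrightarrow> v \<in> carrier_vec n \<Longrightarrow> A ^\<^sub>m 0 *\<^sub>v v = (v :: quat vec)"
  by simp

lemma mat_vec_zero: "A \<in> carrier_mat m n \<Longrightarrow> A *\<^sub>v 0\<^sub>v n = (0\<^sub>v m :: quat vec)"
  by (intro eq_vecI) auto

lemma zero_mat_vec: "v \<in> carrier_vec n \<Longrightarrow> 0\<^sub>m m n *\<^sub>v v = (0\<^sub>v m :: quat vec)"
  by (intro eq_vecI) auto

lemma pow_mat_add_vec:
  fixes A :: "quat mat"
  assumes A: "A \<in> carrier_mat n n" and v: "v \<in> carrier_vec n"
  shows "A ^\<^sub>m (j + k) *\<^sub>v v = A ^\<^sub>m j *\<^sub>v (A ^\<^sub>m k *\<^sub>v v)"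
proof (induction j)
  case 0
  have "A ^\<^sub>m k *\<^sub>v v \<in> carrier_vec n" using A v by simp
  from pow_mat_0_vec[OF A this] show ?case by simp
next
  case (Suc j)
  have c: "A ^\<^sub>m k *\<^sub>v v \<in> carrier_vec n" using A v by simp
  show ?case
    using pow_mat_Suc_vec(2)[OF A v, of "j + k"] pow_mat_Suc_vec(2)[OF A c, of j] Suc by simp
qed

lemma pow_mat_vec_zero_mono:
  fixes A :: "quat mat"
  assumes A: "A \<in> carrier_mat n n" and v: "v \<in> carrier_vec n"
    and "A ^\<^sub>m k *\<^sub>v v = 0\<^sub>v n" "k \<le> l"
  shows "A ^\<^sub>m l *\<^sub>v v = 0\<^sub>v n"
proof -
  have "A ^\<^sub>m l *\<^sub>v v = A ^\<^sub>m (l - k) *\<^sub>v (A ^\<^sub>m k *\<^sub>v v)"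
    using pow_mat_add_vec[OF A v, of "l - k" k] assms(4) by simp
  with assms(3) mat_vec_zero[OF pow_carrier_mat[OF A]] show ?thesis by simp
qed

text \<open>The last nonzero vector among w, A w, A^2 w, ... lies in the kernel and remains in
  \<open>W\<close>.\<close>

lemma nilpotent_kernel:
  fixes A :: "quat mat"
  assumes A: "A \<in> carrier_mat n n" and W: "W \<subseteq> carrier_vec n" "\<And>w. w \<in> W \<Longrightarrow> A *\<^sub>v w \<in> W"
    and w: "w \<in> W" "w \<noteq> 0\<^sub>v n" "A ^\<^sub>m k *\<^sub>v w = 0\<^sub>v n"
  obtains v where "v \<in> W" "v \<noteq> 0\<^sub>v n" "A *\<^sub>v v = 0\<^sub>v n"
  using w
proof (induction k arbitrary: w thesis)
  case 0
  then have "w \<in> carrier_vec n" using W(1) by blast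
  with 0 pow_mat_0_vec[OF A this] show ?case by simp
next
  case (Suc k)
  have wc: "w \<in> carrier_vec n" using Suc.prems W(1) by auto
  show ?case
  proof (cases "A *\<^sub>v w = 0\<^sub>v n")
    case True
    show ?thesis by (rule Suc.prems(1)[OF Suc.prems(2,3) True])
  next
    case False
    have "A ^\<^sub>m k *\<^sub>v (A *\<^sub>v w) = 0\<^sub>v n"
      using Suc.prems(4) unfolding pow_mat_Suc_vec(1)[OF A wc] .
    from Suc.IH[OF Suc.prems(1) W(2)[OF Suc.prems(2)] False this] show ?thesis .
  qed
qed

lemma quat_mult_4: "(x :: quat) * 4 = x + x + x + x"
  using distrib_left[of x 2 2] by (simp add: mult_2_right add.assoc)

text \<open>The bare relations. Nilpotency is assumed only in \<open>sl2_rep\<close>, so that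
  nilpotency of \<open>Y\<close> can be derived here and then handed to that locale.\<close>

locale sl2_mats =
  fixes n :: nat and X H Y :: "quat mat"
  assumes X_carrier [simp]: "X \<in> carrier_mat n n"
    and H_carrier [simp]: "H \<in> carrier_mat n n"
    and Y_carrier [simp]: "Y \<in> carrier_mat n n"
    and bracket_HX: "H * X - X * H = 2 \<cdot>\<^sub>m X"
    and bracket_HY: "H * Y - Y * H = (- 2) \<cdot>\<^sub>m Y"
    and bracket_XY: "X * Y - Y * X = H"
begin

lemma dims [simp]: "dim_row X = n" "dim_col X = n" "dim_row H = n" "dim_col H = n"
  "dim_row Y = n" "dim_col Y = n"
  using X_carrier H_carrier Y_carrier by (blast dest: carrier_matD)+

lemma bracket_vec:
  assumes A: "A \<in> carrier_mat n n" and B: "B \<in> carrier_mat n n" and v: "v \<in> carrier_vec n"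
  shows "(A * B - B * A) *\<^sub>v v = A *\<^sub>v (B *\<^sub>v v) - B *\<^sub>v (A *\<^sub>v (v :: quat vec))"
  using minus_mult_distrib_mat_vec[OF mult_carrier_mat[OF A B] mult_carrier_mat[OF B A] v]
    assoc_mult_mat_vec[OF A B v] assoc_mult_mat_vec[OF B A v] by simp

lemma smult_mat_vec_index:
  "A \<in> carrier_mat n n \<Longrightarrow> v \<in> carrier_vec n \<Longrightarrow> i < n \<Longrightarrow>
    ((a :: quat) \<cdot>\<^sub>m A *\<^sub>v v) $ i = a * (A *\<^sub>v v) $ i"
  by (auto simp: scalar_prod_def sum_distrib_left mult.assoc)

lemma HX: assumes v: "v \<in> carrier_vec n"
  shows "H *\<^sub>v (X *\<^sub>v v) = X *\<^sub>v (H *\<^sub>v v) + right_smult (X *\<^sub>v v) 2"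
proof (rule eq_vecI)
  fix i assume "i < dim_vec (X *\<^sub>v (H *\<^sub>v v) + right_smult (X *\<^sub>v v) 2)"
  then have i: "i < n" by simp
  have "((H * X - X * H) *\<^sub>v v) $ i = 2 * (X *\<^sub>v v) $ i"
    unfolding bracket_HX by (rule smult_mat_vec_index[OF X_carrier v i])
  then show "(H *\<^sub>v (X *\<^sub>v v)) $ i = (X *\<^sub>v (H *\<^sub>v v) + right_smult (X *\<^sub>v v) 2) $ i"
    unfolding bracket_vec[OF H_carrier X_carrier v]
    using i by (simp del: index_mult_mat_vec add: mult_2 mult_2_right algebra_simps)
qed simp

lemma HY: assumes v: "v \<in> carrier_vec n"
  shows "H *\<^sub>v (Y *\<^sub>v v) = Y *\<^sub>v (H *\<^sub>v v) - right_smult (Y *\<^sub>v v) 2"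
proof (rule eq_vecI)
  fix i assume "i < dim_vec (Y *\<^sub>v (H *\<^sub>v v) - right_smult (Y *\<^sub>v v) 2)"
  then have i: "i < n" by simp
  have "((H * Y - Y * H) *\<^sub>v v) $ i = (- 2) * (Y *\<^sub>v v) $ i"
    unfolding bracket_HY by (rule smult_mat_vec_index[OF Y_carrier v i])
  then show "(H *\<^sub>v (Y *\<^sub>v v)) $ i = (Y *\<^sub>v (H *\<^sub>v v) - right_smult (Y *\<^sub>v v) 2) $ i"
    unfolding bracket_vec[OF H_carrier Y_carrier v]
    using i by (simp del: index_mult_mat_vec add: mult_2 mult_2_right algebra_simps)
qed simp

lemma YX: assumes v: "v \<in> carrier_vec n"
  shows "Y *\<^sub>v (X *\<^sub>v v) = X *\<^sub>v (Y *\<^sub>v v) - H *\<^sub>v v"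
proof (rule eq_vecI)
  fix i assume "i < dim_vec (X *\<^sub>v (Y *\<^sub>v v) - H *\<^sub>v v)"
  then have i: "i < n" by simp
  have "((X * Y - Y * X) *\<^sub>v v) $ i = (H *\<^sub>v v) $ i"
    unfolding bracket_XY ..
  then show "(Y *\<^sub>v (X *\<^sub>v v)) $ i = (X *\<^sub>v (Y *\<^sub>v v) - H *\<^sub>v v) $ i"
    unfolding bracket_vec[OF X_carrier Y_carrier v]
    using i by (simp del: index_mult_mat_vec add: algebra_simps)
qed simp

lemma mat_lin_simps:
  assumes "A \<in> carrier_mat n n" "v \<in> carrier_vec n" "w \<in> carrier_vec n"
  shows "A *\<^sub>v (v + w) = A *\<^sub>v v + A *\<^sub>v w" "A *\<^sub>v (v - w) = A *\<^sub>v v - A *\<^sub>v w"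
    "A *\<^sub>v right_smult v a = right_smult (A *\<^sub>v (v :: quat vec)) a"
  using assms mult_add_distrib_mat_vec[OF assms] mult_minus_distrib_mat_vec[OF assms]
  by (auto simp: mat_right_smult)

lemma H_pow_Y:
  assumes v: "v \<in> carrier_vec n"
  shows "H *\<^sub>v (Y ^\<^sub>m k *\<^sub>v v) = Y ^\<^sub>m k *\<^sub>v (H *\<^sub>v v) - right_smult (Y ^\<^sub>m k *\<^sub>v v) (of_nat (2 * k))"
  using v
proof (induction k arbitrary: v)
  case 0
  have c: "H *\<^sub>v v \<in> carrier_vec n" using 0 by simp
  show ?case
    unfolding pow_mat_0_vec[OF Y_carrier 0] pow_mat_0_vec[OF Y_carrier c]
    using 0 by (intro eq_vecI) (simp_all del: index_mult_mat_vec)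
next
  case (Suc k)
  have c: "Y *\<^sub>v v \<in> carrier_vec n" "H *\<^sub>v v \<in> carrier_vec n" "Y *\<^sub>v (H *\<^sub>v v) \<in> carrier_vec n"
    using Suc.prems by simp_all
  have Yk: "Y ^\<^sub>m k \<in> carrier_mat n n" and dYk: "dim_row (Y ^\<^sub>m k) = n" by simp_all
  have 1: "Y ^\<^sub>m k *\<^sub>v (H *\<^sub>v (Y *\<^sub>v v)) = Y ^\<^sub>m k *\<^sub>v (Y *\<^sub>v (H *\<^sub>v v)) - right_smult (Y ^\<^sub>m k *\<^sub>v (Y *\<^sub>v v)) 2"
    unfolding HY[OF Suc.prems] using c by (simp only: mat_lin_simps[OF Yk] right_smult_carrier)
  have scalar: "of_nat (2 * Suc k) = 2 + (of_nat (2 * k) :: quat)" by simp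
  show ?case
    unfolding pow_mat_Suc_vec(1)[OF Y_carrier Suc.prems] pow_mat_Suc_vec(1)[OF Y_carrier c(2)]
      Suc.IH[OF c(1)] 1 scalar
    by (intro eq_vecI) (simp_all add: dYk distrib_left del: index_mult_mat_vec of_nat_mult)
qed

text \<open>\<open>[H, Y\<^sup>k] = -2k Y\<^sup>k\<close> has norm at most \<open>2 N(H) N(Y\<^sup>k)\<close> for a submultiplicative norm \<open>N\<close>,
  which forces \<open>Y\<^sup>k = 0\<close> once \<open>k > N(H)\<close>.\<close>

lemma Y_nilpotent: "\<exists>k. Y ^\<^sub>m k = 0\<^sub>m n n"
proof -
  define N :: "quat mat \<Rightarrow> real" where "N A = (\<Sum>i<n. \<Sum>j<n. norm (A $$ (i, j)))" for A
  have N_mult: "N (A * C) \<le> N A * N C" if A: "A \<in> carrier_mat n n" and C: "C \<in> carrier_mat n n" for A C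
  proof -
    have "N (A * C) \<le> (\<Sum>i<n. \<Sum>j<n. \<Sum>k<n. norm (A $$ (i, k)) * norm (C $$ (k, j)))"
      unfolding N_def
    proof (intro sum_mono)
      fix i j assume "i \<in> {..<n}" "j \<in> {..<n}"
      then have "(A * C) $$ (i, j) = (\<Sum>k<n. A $$ (i, k) * C $$ (k, j))"
        using A C by (subst mult_index_sum) auto
      then show "norm ((A * C) $$ (i, j)) \<le> (\<Sum>k<n. norm (A $$ (i, k)) * norm (C $$ (k, j)))"
        using norm_sum[of "\<lambda>k. A $$ (i, k) * C $$ (k, j)" "{..<n}"] by (simp add: norm_mult)
    qed
    also have "\<dots> = (\<Sum>i<n. \<Sum>k<n. norm (A $$ (i, k)) * (\<Sum>j<n. norm (C $$ (k, j))))"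
      unfolding sum_distrib_left by (intro sum.cong refl sum.swap)
    also have "\<dots> \<le> (\<Sum>i<n. \<Sum>k<n. norm (A $$ (i, k)) * N C)"
      unfolding N_def
      by (intro sum_mono mult_left_mono member_le_sum) (auto intro: sum_nonneg)
    also have "\<dots> = N A * N C"
      unfolding N_def[of A] sum_distrib_right ..
    finally show ?thesis .
  qed
  have N_nonneg: "0 \<le> N A" for A
    unfolding N_def by (intro sum_nonneg) simp
  obtain k where k: "N H < real k" using reals_Archimedean2 by blast
  have Yk: "Y ^\<^sub>m k \<in> carrier_mat n n" by simp
  \<comment> \<open>\<open>H_pow_Y\<close> speaks of vectors with right scalars; evaluated on unit
    vectors it becomes a relation between entries, to which the multiplicative norm applies.\<close>
  have bracket: "(Y ^\<^sub>m k * H) $$ (i, j) - (H * Y ^\<^sub>m k) $$ (i, j) = (Y ^\<^sub>m k) $$ (i, j) * of_nat (2 * k)"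
    if ij: "i < n" "j < n" for i j
  proof -
    have u: "unit_vec n j \<in> carrier_vec n" by simp
    have entry: "(A *\<^sub>v unit_vec n j) $ i = A $$ (i, j)" if "A \<in> carrier_mat n n" for A :: "quat mat"
      using that ij by simp
    have vec: "(H * Y ^\<^sub>m k) *\<^sub>v unit_vec n j = (Y ^\<^sub>m k * H) *\<^sub>v unit_vec n j -
        right_smult (Y ^\<^sub>m k *\<^sub>v unit_vec n j) (of_nat (2 * k))"
      unfolding assoc_mult_mat_vec[OF H_carrier Yk u] assoc_mult_mat_vec[OF Yk H_carrier u]
      by (rule H_pow_Y[OF u])
    have "((H * Y ^\<^sub>m k) *\<^sub>v unit_vec n j) $ i = ((Y ^\<^sub>m k * H) *\<^sub>v unit_vec n j) $ i -
        (Y ^\<^sub>m k *\<^sub>v unit_vec n j) $ i * of_nat (2 * k)"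
      unfolding vec using ij by (simp del: index_mult_mat_vec of_nat_mult)
    then show ?thesis
      unfolding entry[OF mult_carrier_mat[OF H_carrier Yk]] entry[OF mult_carrier_mat[OF Yk H_carrier]]
        entry[OF Yk] by (simp only: algebra_simps)
  qed
  have "2 * real k * N (Y ^\<^sub>m k) =
      (\<Sum>i<n. \<Sum>j<n. norm ((Y ^\<^sub>m k * H) $$ (i, j) - (H * Y ^\<^sub>m k) $$ (i, j)))"
    unfolding N_def sum_distrib_left
  proof (intro sum.cong refl)
    fix i j assume "i \<in> {..<n}" "j \<in> {..<n}"
    then have ij: "i < n" "j < n" by simp_all
    show "2 * real k * norm ((Y ^\<^sub>m k) $$ (i, j)) =
        norm ((Y ^\<^sub>m k * H) $$ (i, j) - (H * Y ^\<^sub>m k) $$ (i, j))"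
      unfolding bracket[OF ij] norm_mult norm_of_nat by simp
  qed
  also have "\<dots> \<le> (\<Sum>i<n. \<Sum>j<n. norm ((Y ^\<^sub>m k * H) $$ (i, j)) + norm ((H * Y ^\<^sub>m k) $$ (i, j)))"
    by (intro sum_mono norm_triangle_ineq4)
  also have "\<dots> = N (Y ^\<^sub>m k * H) + N (H * Y ^\<^sub>m k)"
    unfolding N_def sum.distrib ..
  also have "\<dots> \<le> N (Y ^\<^sub>m k) * N H + N H * N (Y ^\<^sub>m k)"
    by (intro add_mono N_mult Yk H_carrier)
  also have "\<dots> = 2 * N H * N (Y ^\<^sub>m k)"
    by simp
  finally have le: "2 * real k * N (Y ^\<^sub>m k) \<le> 2 * N H * N (Y ^\<^sub>m k)" .
  have "N (Y ^\<^sub>m k) = 0"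
  proof (rule ccontr)
    assume "N (Y ^\<^sub>m k) \<noteq> 0"
    then have "0 < N (Y ^\<^sub>m k)" using N_nonneg[of "Y ^\<^sub>m k"] by simp
    with le k show False by simp
  qed
  have "(Y ^\<^sub>m k) $$ (i, j) = 0" if "i < n" "j < n" for i j
  proof -
    have "norm ((Y ^\<^sub>m k) $$ (i, j)) \<le> (\<Sum>j<n. norm ((Y ^\<^sub>m k) $$ (i, j)))"
      using that by (intro member_le_sum) auto
    also have "\<dots> \<le> N (Y ^\<^sub>m k)"
      unfolding N_def using that by (intro member_le_sum[of i]) (auto intro: sum_nonneg)
    finally show ?thesis using \<open>N (Y ^\<^sub>m k) = 0\<close> by simp
  qed
  then have "Y ^\<^sub>m k = 0\<^sub>m n n"
    by (intro eq_matI) simp_all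
  then show ?thesis by blast
qed

end

section \<open>Weight vectors from nilpotency, and the intersection of im Y with ker X\<close>

locale sl2_rep = sl2_mats +
  assumes nilpotent_X: "\<exists>k. X ^\<^sub>m k = 0\<^sub>m n n"
    and nilpotent_Y: "\<exists>k. Y ^\<^sub>m k = 0\<^sub>m n n"
begin

text \<open>The commutator identity [Y, X^(k+1)] = -(k+1) X^k (H + k) applied to a vector. The
  induction detaches the innermost factor X, so that the hypothesis is used for X v.\<close>

lemma Y_pow_X:
  assumes v: "v \<in> carrier_vec n"
  shows "Y *\<^sub>v (X ^\<^sub>m Suc k *\<^sub>v v) = X ^\<^sub>m Suc k *\<^sub>v (Y *\<^sub>v v) -
    right_smult (X ^\<^sub>m k *\<^sub>v (H *\<^sub>v v)) (of_nat (Suc k)) -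
    right_smult (X ^\<^sub>m k *\<^sub>v v) (of_nat k * of_nat (Suc k))"
  using v
proof (induction k arbitrary: v)
  case 0
  then show ?case
    using YX[OF 0] pow_mat_Suc_vec(2)[OF X_carrier, of _ 0]
    by (intro eq_vecI) (simp_all del: index_mult_mat_vec pow_mat.simps(2))
next
  case (Suc k)
  define P where "P = X ^\<^sub>m Suc k"
  have P: "P \<in> carrier_mat n n" by (simp add: P_def del: pow_mat.simps)
  have Xv: "X *\<^sub>v v \<in> carrier_vec n" and Hv: "H *\<^sub>v v \<in> carrier_vec n"
    and Yv: "Y *\<^sub>v v \<in> carrier_vec n" and XYv: "X *\<^sub>v (Y *\<^sub>v v) \<in> carrier_vec n"
    and XHv: "X *\<^sub>v (H *\<^sub>v v) \<in> carrier_vec n"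
    using Suc.prems by simp_all
  have PX: "X ^\<^sub>m Suc (Suc k) *\<^sub>v w = P *\<^sub>v (X *\<^sub>v w)" "X ^\<^sub>m k *\<^sub>v (X *\<^sub>v w) = P *\<^sub>v w"
    if "w \<in> carrier_vec n" for w
    unfolding P_def by (rule pow_mat_Suc_vec(1)[OF X_carrier that])
      (rule pow_mat_Suc_vec(1)[OF X_carrier that, symmetric])
  have Xk: "X ^\<^sub>m k \<in> carrier_mat n n" by simp
  have "Y *\<^sub>v (X ^\<^sub>m Suc (Suc k) *\<^sub>v v) = Y *\<^sub>v (X ^\<^sub>m Suc k *\<^sub>v (X *\<^sub>v v))"
    by (simp only: pow_mat_Suc_vec(1)[OF X_carrier Suc.prems, of "Suc k"])
  also have "\<dots> = P *\<^sub>v (Y *\<^sub>v (X *\<^sub>v v)) -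
      right_smult (X ^\<^sub>m k *\<^sub>v (H *\<^sub>v (X *\<^sub>v v))) (of_nat (Suc k)) -
      right_smult (X ^\<^sub>m k *\<^sub>v (X *\<^sub>v v)) (of_nat k * of_nat (Suc k))"
    unfolding P_def by (rule Suc.IH[OF Xv])
  also have "P *\<^sub>v (Y *\<^sub>v (X *\<^sub>v v)) = P *\<^sub>v (X *\<^sub>v (Y *\<^sub>v v)) - P *\<^sub>v (H *\<^sub>v v)"
    by (simp only: YX[OF Suc.prems] mat_lin_simps[OF P XYv Hv])
  also have "X ^\<^sub>m k *\<^sub>v (H *\<^sub>v (X *\<^sub>v v)) = P *\<^sub>v (H *\<^sub>v v) + right_smult (P *\<^sub>v v) 2"
    using Xv XHv by (simp only: HX[OF Suc.prems] mat_lin_simps[OF Xk] right_smult_carrier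
        PX(2)[OF Hv] PX(2)[OF Suc.prems])
  also have "X ^\<^sub>m k *\<^sub>v (X *\<^sub>v v) = P *\<^sub>v v"
    by (rule PX(2)[OF Suc.prems])
  finally have eq: "Y *\<^sub>v (X ^\<^sub>m Suc (Suc k) *\<^sub>v v) =
      P *\<^sub>v (X *\<^sub>v (Y *\<^sub>v v)) - P *\<^sub>v (H *\<^sub>v v) -
      right_smult (P *\<^sub>v (H *\<^sub>v v) + right_smult (P *\<^sub>v v) 2) (of_nat (Suc k)) -
      right_smult (P *\<^sub>v v) (of_nat k * of_nat (Suc k))" .
  have dP: "dim_row P = n" using P by simp
  show ?case
    unfolding eq PX(1)[OF Yv] P_def[symmetric]
    by (rule eq_vecI)
       (simp_all add: dP algebra_simps mult_2_right mult_2 del: index_mult_mat_vec)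
qed

text \<open>The commutator identity reduces to (k+1) X^k (H + k) v = 0, and k+1 is invertible: one
  power of X is traded for the factor H + k.\<close>

lemma Y_pow_X_ker:
  assumes v: "v \<in> carrier_vec n" and 0: "X ^\<^sub>m Suc k *\<^sub>v v = 0\<^sub>v n"
    and 1: "X ^\<^sub>m Suc k *\<^sub>v (Y *\<^sub>v v) = 0\<^sub>v n"
  shows "X ^\<^sub>m k *\<^sub>v (H *\<^sub>v v + right_smult v (of_nat k)) = 0\<^sub>v n"
proof -
  have Xk: "X ^\<^sub>m k \<in> carrier_mat n n" and dXk: "dim_row (X ^\<^sub>m k) = n" by simp_all
  have Hv: "H *\<^sub>v v \<in> carrier_vec n" using v by simp
  have eq: "X ^\<^sub>m k *\<^sub>v (H *\<^sub>v v + right_smult v (of_nat k)) =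
      X ^\<^sub>m k *\<^sub>v (H *\<^sub>v v) + right_smult (X ^\<^sub>m k *\<^sub>v v) (of_nat k)"
    using v Hv by (simp only: mat_lin_simps[OF Xk] right_smult_carrier)
  have "right_smult (X ^\<^sub>m k *\<^sub>v (H *\<^sub>v v + right_smult v (of_nat k))) (of_nat (Suc k)) = 0\<^sub>v n"
  proof (rule eq_vecI)
    fix i assume "i < dim_vec (0\<^sub>v n :: quat vec)"
    then have i: "i < n" by simp
    have "(0\<^sub>v n :: quat vec) $ i = (0\<^sub>v n -
        right_smult (X ^\<^sub>m k *\<^sub>v (H *\<^sub>v v)) (of_nat (Suc k)) -
        right_smult (X ^\<^sub>m k *\<^sub>v v) (of_nat k * of_nat (Suc k))) $ i"
      using Y_pow_X[OF v, of k] unfolding 0 1 mat_vec_zero[OF Y_carrier] by simp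
    then show "right_smult (X ^\<^sub>m k *\<^sub>v (H *\<^sub>v v + right_smult v (of_nat k))) (of_nat (Suc k)) $ i =
        0\<^sub>v n $ i"
      unfolding eq using i dXk
      by (simp add: algebra_simps eq_neg_iff_add_eq_0 del: index_mult_mat_vec)
  qed (simp add: dXk)
  moreover have "(of_nat (Suc k) :: quat) \<noteq> 0"
    by (rule of_nat_neq_0)
  moreover have "X ^\<^sub>m k *\<^sub>v (H *\<^sub>v v + right_smult v (of_nat k)) \<in> carrier_vec n"
    using v by simp
  ultimately show ?thesis
    using right_smult_eq_0 by blast
qed

text \<open>With X^(k+1) v = 0, either (H + k) v = 0 and v has weight -k, or (H + k) v is a nonzero
  vector of ker Y already killed by X^k. The process stops since X^0 kills only 0. No eigenvalue of
  \<open>H\<close> has to be found beforehand, and \<open>W\<close> is only required to be closed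
  under the operators H + c.\<close>

lemma weight_vector_exists:
  assumes W: "W \<subseteq> carrier_vec n" "\<And>w c. w \<in> W \<Longrightarrow> H *\<^sub>v w + right_smult w (of_nat c) \<in> W"
    and v: "v \<in> W" "v \<noteq> 0\<^sub>v n" "Y *\<^sub>v v = 0\<^sub>v n" "X ^\<^sub>m k *\<^sub>v v = 0\<^sub>v n"
  obtains w j where "w \<in> W" "w \<noteq> 0\<^sub>v n" "Y *\<^sub>v w = 0\<^sub>v n" "H *\<^sub>v w + right_smult w (of_nat j) = 0\<^sub>v n"
  using v
proof (induction k arbitrary: v thesis)
  case 0
  then have "v \<in> carrier_vec n" using W(1) by blast
  with 0 pow_mat_0_vec[OF X_carrier this] show ?case by simp
next
  case (Suc k)
  have vc: "v \<in> carrier_vec n" using Suc.prems(2) W(1) by blast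
  let ?v = "H *\<^sub>v v + right_smult v (of_nat k)"
  show ?case
  proof (cases "?v = 0\<^sub>v n")
    case True
    show ?thesis by (rule Suc.prems(1)[OF Suc.prems(2-4) True])
  next
    case False
    have "X ^\<^sub>m Suc k *\<^sub>v (Y *\<^sub>v v) = 0\<^sub>v n"
      unfolding Suc.prems(4) by (rule mat_vec_zero[OF pow_carrier_mat[OF X_carrier]])
    then have 1: "X ^\<^sub>m k *\<^sub>v ?v = 0\<^sub>v n"
      by (rule Y_pow_X_ker[OF vc Suc.prems(5)])
    have 2: "Y *\<^sub>v ?v = 0\<^sub>v n"
    proof -
      have Hv: "H *\<^sub>v v \<in> carrier_vec n" using vc by simp
      have "Y *\<^sub>v (H *\<^sub>v v) = H *\<^sub>v (Y *\<^sub>v v) + right_smult (Y *\<^sub>v v) 2"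
        unfolding HY[OF vc] by (rule eq_vecI) (simp_all del: index_mult_mat_vec)
      then have "Y *\<^sub>v (H *\<^sub>v v) = 0\<^sub>v n"
        unfolding Suc.prems(4) mat_vec_zero[OF H_carrier] by simp
      then show ?thesis
        using vc Hv by (simp only: mat_lin_simps[OF Y_carrier] right_smult_carrier Suc.prems(4)) simp
    qed
    from Suc.IH[OF Suc.prems(1) W(2)[OF Suc.prems(2)] False 2 1] show ?thesis .
  qed
qed

text \<open>The symmetry that exchanges X and Y and negates H. It makes the results on ker Y
  available for ker X.\<close>

lemma opposite: "sl2_rep n Y (- H) X"
proof
  show "- H * Y - Y * - H = 2 \<cdot>\<^sub>m Y"
  proof (rule eq_matI)
    fix i j assume "i < dim_row (2 \<cdot>\<^sub>m Y)" "j < dim_col (2 \<cdot>\<^sub>m Y)"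
    then have ij: "i < n" "j < n" by simp_all
    have "(H * Y - Y * H) $$ (i, j) = ((- 2) \<cdot>\<^sub>m Y) $$ (i, j)"
      unfolding bracket_HY ..
    with ij show "(- H * Y - Y * - H) $$ (i, j) = (2 \<cdot>\<^sub>m Y) $$ (i, j)"
      by (simp add: mult_index_sum sum_negf algebra_simps minus_equation_iff del: index_mult_mat(1))
  qed simp_all
  show "- H * X - X * - H = - 2 \<cdot>\<^sub>m X"
  proof (rule eq_matI)
    fix i j assume "i < dim_row (- 2 \<cdot>\<^sub>m X)" "j < dim_col (- 2 \<cdot>\<^sub>m X)"
    then have ij: "i < n" "j < n" by simp_all
    have "(H * X - X * H) $$ (i, j) = (2 \<cdot>\<^sub>m X) $$ (i, j)"
      unfolding bracket_HX ..
    with ij show "(- H * X - X * - H) $$ (i, j) = (- 2 \<cdot>\<^sub>m X) $$ (i, j)"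
      by (simp add: mult_index_sum sum_negf algebra_simps minus_equation_iff del: index_mult_mat(1))
  qed simp_all
  show "Y * X - X * Y = - H"
  proof (rule eq_matI)
    fix i j assume "i < dim_row (- H)" "j < dim_col (- H)"
    then have ij: "i < n" "j < n" by simp_all
    have "(X * Y - Y * X) $$ (i, j) = H $$ (i, j)"
      unfolding bracket_XY ..
    with ij show "(Y * X - X * Y) $$ (i, j) = (- H) $$ (i, j)"
      by (simp add: mult_index_sum algebra_simps minus_equation_iff del: index_mult_mat(1))
  qed simp_all
qed (simp_all add: nilpotent_X nilpotent_Y)

text \<open>X raises and Y lowers the weight by 2, so X Y commutes with H.\<close>

lemma XYH: assumes v: "v \<in> carrier_vec n" and 0: "X *\<^sub>v (Y *\<^sub>v v) = 0\<^sub>v n"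
  shows "X *\<^sub>v (Y *\<^sub>v (H *\<^sub>v v)) = 0\<^sub>v n"
proof -
  have Yv: "Y *\<^sub>v v \<in> carrier_vec n" and HYv: "H *\<^sub>v (Y *\<^sub>v v) \<in> carrier_vec n"
    and Hv: "H *\<^sub>v v \<in> carrier_vec n" using v by simp_all
  have "Y *\<^sub>v (H *\<^sub>v v) = H *\<^sub>v (Y *\<^sub>v v) + right_smult (Y *\<^sub>v v) 2"
    unfolding HY[OF v] by (rule eq_vecI) (simp_all del: index_mult_mat_vec)
  then have "X *\<^sub>v (Y *\<^sub>v (H *\<^sub>v v)) = X *\<^sub>v (H *\<^sub>v (Y *\<^sub>v v)) + right_smult (X *\<^sub>v (Y *\<^sub>v v)) 2"
    using Yv HYv by (simp only: mat_lin_simps[OF X_carrier] right_smult_carrier)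
  also have "\<dots> = H *\<^sub>v (X *\<^sub>v (Y *\<^sub>v v))"
    by (rule HX[OF Yv, symmetric])
  finally show ?thesis
    unfolding 0 mat_vec_zero[OF H_carrier] .
qed

text \<open>Induction on the power of X that kills a. For b = (H + k) a this power drops by one,
  while Y b is Y a times m + 2 + k, because Y H = H Y + 2 Y. As the weight m is nonnegative, the
  factor is nonzero and Y b = 0 forces Y a = 0.\<close>

lemma im_Y_inter_ker_X_weight:
  assumes "a \<in> carrier_vec n" "X ^\<^sub>m k *\<^sub>v a = 0\<^sub>v n" "X *\<^sub>v (Y *\<^sub>v a) = 0\<^sub>v n"
    and "H *\<^sub>v (Y *\<^sub>v a) = right_smult (Y *\<^sub>v a) (of_nat m)"
  shows "Y *\<^sub>v a = 0\<^sub>v n"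
  using assms
proof (induction k arbitrary: a)
  case 0
  then have "a = 0\<^sub>v n" using pow_mat_0_vec[OF X_carrier] by simp
  then show ?case using mat_vec_zero[OF Y_carrier] by simp
next
  case (Suc k)
  note a = Suc.prems(1)
  have c: "H *\<^sub>v a \<in> carrier_vec n" "Y *\<^sub>v a \<in> carrier_vec n" "Y *\<^sub>v (H *\<^sub>v a) \<in> carrier_vec n"
    using a by simp_all
  let ?b = "H *\<^sub>v a + right_smult a (of_nat k)"
  have b: "?b \<in> carrier_vec n" using a by simp
  have "X ^\<^sub>m Suc k *\<^sub>v (Y *\<^sub>v a) = 0\<^sub>v n"
    unfolding pow_mat_Suc_vec(1)[OF X_carrier c(2)] Suc.prems(3)
    by (rule mat_vec_zero[OF pow_carrier_mat[OF X_carrier]])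
  then have 1: "X ^\<^sub>m k *\<^sub>v ?b = 0\<^sub>v n"
    by (intro Y_pow_X_ker a Suc.prems(2))
  have Yb: "Y *\<^sub>v ?b = Y *\<^sub>v (H *\<^sub>v a) + right_smult (Y *\<^sub>v a) (of_nat k)"
    using a c by (simp only: mat_lin_simps[OF Y_carrier] right_smult_carrier)
  have "X *\<^sub>v (Y *\<^sub>v ?b) = X *\<^sub>v (Y *\<^sub>v (H *\<^sub>v a)) + right_smult (X *\<^sub>v (Y *\<^sub>v a)) (of_nat k)"
    unfolding Yb using c by (simp only: mat_lin_simps[OF X_carrier] right_smult_carrier)
  then have 2: "X *\<^sub>v (Y *\<^sub>v ?b) = 0\<^sub>v n"
    unfolding XYH[OF a Suc.prems(3)] Suc.prems(3) by simp
  have YHa: "Y *\<^sub>v (H *\<^sub>v a) = right_smult (Y *\<^sub>v a) (of_nat (m + 2))"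
  proof -
    have "Y *\<^sub>v (H *\<^sub>v a) = H *\<^sub>v (Y *\<^sub>v a) + right_smult (Y *\<^sub>v a) 2"
      unfolding HY[OF a] by (rule eq_vecI) (simp_all del: index_mult_mat_vec)
    then show ?thesis
      unfolding Suc.prems(4)
      by (intro eq_vecI) (simp_all add: algebra_simps mult_2_right del: index_mult_mat_vec)
  qed
  have Yb': "Y *\<^sub>v ?b = right_smult (Y *\<^sub>v a) (of_nat (m + 2 + k))"
    unfolding Yb YHa by (intro eq_vecI) (simp_all add: algebra_simps del: index_mult_mat_vec)
  have "H *\<^sub>v (Y *\<^sub>v ?b) = right_smult (Y *\<^sub>v ?b) (of_nat m)"
    unfolding Yb' using c
    by (simp only: mat_lin_simps[OF H_carrier] Suc.prems(4) right_smult_simps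
        of_nat_mult[symmetric] mult.commute)
  from Suc.IH[OF b 1 2 this] have "right_smult (Y *\<^sub>v a) (of_nat (m + 2 + k)) = 0\<^sub>v n"
    unfolding Yb' .
  moreover have "of_nat (m + 2 + k) \<noteq> (0 :: quat)"
    unfolding of_nat_eq_0_iff by simp
  ultimately show ?case
    using right_smult_eq_0[OF _ c(2)] by blast
qed

text \<open>The intersection of im Y and ker X is closed under the operators -H + c. If it were
  nonzero, the opposite triple, for which ker X takes the role of ker Y, would produce in it a
  nonzero vector of H-weight j \<ge> 0, which \<open>im_Y_inter_ker_X_weight\<close>
  excludes.\<close>

lemma im_Y_inter_ker_X:
  assumes a: "a \<in> carrier_vec n" and 0: "X *\<^sub>v (Y *\<^sub>v a) = 0\<^sub>v n"
  shows "Y *\<^sub>v a = 0\<^sub>v n"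
proof (rule ccontr)
  assume nz: "Y *\<^sub>v a \<noteq> 0\<^sub>v n"
  interpret op: sl2_rep n Y "- H" X by (rule opposite)
  let ?U = "{Y *\<^sub>v b | b. b \<in> carrier_vec n \<and> X *\<^sub>v (Y *\<^sub>v b) = 0\<^sub>v n}"
  obtain k where "Y ^\<^sub>m k = 0\<^sub>m n n" using nilpotent_Y by blast
  then have k: "Y ^\<^sub>m k *\<^sub>v (Y *\<^sub>v a) = 0\<^sub>v n"
    using a by (simp add: zero_mat_vec)
  have U: "?U \<subseteq> carrier_vec n" by auto
  have closed: "- H *\<^sub>v w + right_smult w (of_nat c) \<in> ?U" if w: "w \<in> ?U" for w c
  proof -
    from w obtain b where b: "w = Y *\<^sub>v b" "b \<in> carrier_vec n" "X *\<^sub>v (Y *\<^sub>v b) = 0\<^sub>v n" by blast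
    \<comment> \<open>From -H Y = -Y H + 2 Y: this vector is a preimage under Y of (-H + c) Y
      b.\<close>
    let ?b = "right_smult b (of_nat c + 2) - H *\<^sub>v b"
    have c: "H *\<^sub>v b \<in> carrier_vec n" "Y *\<^sub>v b \<in> carrier_vec n" "Y *\<^sub>v (H *\<^sub>v b) \<in> carrier_vec n"
      using b by simp_all
    have Yb: "Y *\<^sub>v ?b = right_smult (Y *\<^sub>v b) (of_nat c + 2) - Y *\<^sub>v (H *\<^sub>v b)"
      using b c by (simp only: mat_lin_simps[OF Y_carrier] right_smult_carrier)
    have "- H *\<^sub>v w = - (H *\<^sub>v w)"
      using c(2) unfolding b(1) by (intro uminus_mult_mat_vec) simp
    then have "- H *\<^sub>v w + right_smult w (of_nat c) = Y *\<^sub>v ?b"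
      unfolding Yb b(1) HY[OF b(2)]
      by (intro eq_vecI) (simp_all add: algebra_simps del: index_mult_mat_vec)
    moreover have "X *\<^sub>v (Y *\<^sub>v ?b) =
        right_smult (X *\<^sub>v (Y *\<^sub>v b)) (of_nat c + 2) - X *\<^sub>v (Y *\<^sub>v (H *\<^sub>v b))"
      unfolding Yb using c by (simp only: mat_lin_simps[OF X_carrier] right_smult_carrier)
    then have "X *\<^sub>v (Y *\<^sub>v ?b) = 0\<^sub>v n"
      unfolding XYH[OF b(2,3)] b(3) by simp
    moreover have "?b \<in> carrier_vec n" using b c by simp
    ultimately show ?thesis by blast
  qed
  have Ya: "Y *\<^sub>v a \<in> ?U" using a 0 by blast
  obtain w j where w: "w \<in> ?U" "w \<noteq> 0\<^sub>v n" "- H *\<^sub>v w + right_smult w (of_nat j) = 0\<^sub>v n"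
    by (rule op.weight_vector_exists[OF U closed Ya nz 0 k])
  from w(1) obtain b where b: "w = Y *\<^sub>v b" "b \<in> carrier_vec n" "X *\<^sub>v (Y *\<^sub>v b) = 0\<^sub>v n" by blast
  have "H *\<^sub>v w = right_smult w (of_nat j)"
  proof (rule eq_vecI)
    fix i assume "i < dim_vec (right_smult w (of_nat j))"
    then have i: "i < n" using b by simp
    have "- H *\<^sub>v w = - (H *\<^sub>v w)"
      using b by (intro uminus_mult_mat_vec) simp
    with w(3) have "(- (H *\<^sub>v w) + right_smult w (of_nat j)) $ i = 0\<^sub>v n $ i" by simp
    with i b show "(H *\<^sub>v w) $ i = right_smult w (of_nat j) $ i"
      by (simp del: index_mult_mat_vec)
  qed (use b in simp)
  then have Hb: "H *\<^sub>v (Y *\<^sub>v b) = right_smult (Y *\<^sub>v b) (of_nat j)"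
    unfolding b(1) .
  obtain l where "X ^\<^sub>m l = 0\<^sub>m n n" using nilpotent_X by blast
  then have "X ^\<^sub>m l *\<^sub>v b = 0\<^sub>v n" using b(2) by (simp only: zero_mat_vec)
  from im_Y_inter_ker_X_weight[OF b(2) this b(3) Hb] w(2) show False
    unfolding b(1) by blast
qed

end

section \<open>Lowest weight spaces and the Casimir operator\<close>

context sl2_rep
begin

text \<open>For \<open>d \<ge> 1\<close> this is \<open>lowest n X H Y d\<close>, usually written \<open>L(d - 1)\<close>.\<close>

definition Ld :: "nat \<Rightarrow> quat vec set" where
  "Ld d = {v \<in> carrier_vec n. Y *\<^sub>v v = 0\<^sub>v n \<and> H *\<^sub>v v = right_smult v (of_int (1 - int d))}"

lemma LdD:
  assumes "v \<in> Ld d"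
  shows "v \<in> carrier_vec n" "Y *\<^sub>v v = 0\<^sub>v n" "H *\<^sub>v v = right_smult v (of_int (1 - int d))"
  using assms by (simp_all add: Ld_def)

lemma Ld_subspace: "is_subspace UNIV n (Ld d)"
  unfolding is_subspace_def
proof (intro conjI ballI)
  show "Ld d \<subseteq> carrier_vec n" using LdD(1) by blast
  show "0\<^sub>v n \<in> Ld d"
    by (simp add: Ld_def mat_vec_zero[OF Y_carrier] mat_vec_zero[OF H_carrier])
next
  fix v w assume v: "v \<in> Ld d" and w: "w \<in> Ld d"
  have "H *\<^sub>v (v + w) = right_smult (v + w) (of_int (1 - int d))"
    unfolding mat_lin_simps(1)[OF H_carrier LdD(1)[OF v] LdD(1)[OF w]] LdD(3)[OF v] LdD(3)[OF w]
    using LdD(1)[OF v] LdD(1)[OF w] by (intro eq_vecI) (simp_all add: distrib_right)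
  moreover have "Y *\<^sub>v (v + w) = 0\<^sub>v n"
    unfolding mat_lin_simps(1)[OF Y_carrier LdD(1)[OF v] LdD(1)[OF w]] LdD(2)[OF v] LdD(2)[OF w]
    by simp
  moreover have "v + w \<in> carrier_vec n" using LdD(1)[OF v] LdD(1)[OF w] by simp
  ultimately show "v + w \<in> Ld d" unfolding Ld_def by blast
next
  fix v and a :: quat assume v: "v \<in> Ld d"
  have "H *\<^sub>v right_smult v a = right_smult (right_smult v a) (of_int (1 - int d))"
    unfolding mat_lin_simps(3)[OF H_carrier LdD(1)[OF v] LdD(1)[OF v]] LdD(3)[OF v] right_smult_simps
    by (simp only: mult_of_int_commute)
  moreover have "Y *\<^sub>v right_smult v a = 0\<^sub>v n"
    unfolding mat_lin_simps(3)[OF Y_carrier LdD(1)[OF v] LdD(1)[OF v]] LdD(2)[OF v] by simp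
  moreover have "right_smult v a \<in> carrier_vec n" using LdD(1)[OF v] by simp
  ultimately show "right_smult v a \<in> Ld d" unfolding Ld_def by blast
qed

text \<open>On a lowest weight vector of weight z the operator Y steps back along the string with
  factor -(k+1)(z+k), which vanishes only at k = -z.\<close>

lemma Y_pow_X_weight:
  assumes v: "v \<in> carrier_vec n" and Yv: "Y *\<^sub>v v = 0\<^sub>v n" and Hv: "H *\<^sub>v v = right_smult v (of_int z)"
  shows "Y *\<^sub>v (X ^\<^sub>m Suc k *\<^sub>v v) =
    right_smult (X ^\<^sub>m k *\<^sub>v v) (of_int (- (int (Suc k) * (z + int k))))"
proof -
  have scalar: "of_int (- (int (Suc k) * (z + int k))) =
      - (of_int z * of_nat (Suc k)) - of_nat k * (of_nat (Suc k) :: quat)"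
  proof -
    have "- (int (Suc k) * (z + int k)) = - (z * int (Suc k)) - int k * int (Suc k)"
      by (simp add: algebra_simps)
    then show ?thesis
      by (simp only: of_int_diff of_int_minus of_int_mult of_int_of_nat_eq)
  qed
  have Xk: "X ^\<^sub>m k \<in> carrier_mat n n" and dXk: "dim_row (X ^\<^sub>m k) = n" by simp_all
  show ?thesis
    unfolding Y_pow_X[OF v] Yv mat_vec_zero[OF pow_carrier_mat[OF X_carrier]] Hv scalar
      mat_lin_simps(3)[OF Xk v v]
    by (intro eq_vecI)
       (simp_all add: dXk right_diff_distrib mult.assoc del: index_mult_mat_vec of_nat_Suc)
qed

text \<open>As long as z + k is nonzero, Y carries X^(k+1) v to a nonzero multiple of X^k v, so
  vanishing propagates downwards.\<close>

lemma pow_X_descent: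
  assumes v: "v \<in> carrier_vec n" and Yv: "Y *\<^sub>v v = 0\<^sub>v n" and Hv: "H *\<^sub>v v = right_smult v (of_int z)"
    and 0: "X ^\<^sub>m Suc k *\<^sub>v v = 0\<^sub>v n" and z: "z + int k \<noteq> 0"
  shows "X ^\<^sub>m k *\<^sub>v v = 0\<^sub>v n"
proof -
  have "right_smult (X ^\<^sub>m k *\<^sub>v v) (of_int (- (int (Suc k) * (z + int k)))) = 0\<^sub>v n"
    using Y_pow_X_weight[OF v Yv Hv, of k] unfolding 0 mat_vec_zero[OF Y_carrier] by simp
  moreover have "- (int (Suc k) * (z + int k)) \<noteq> 0"
    using z by simp
  then have "(of_int (- (int (Suc k) * (z + int k))) :: quat) \<noteq> 0"
    unfolding of_int_eq_0_iff .
  moreover have "X ^\<^sub>m k *\<^sub>v v \<in> carrier_vec n" using v by simp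
  ultimately show ?thesis using right_smult_eq_0 by blast
qed

lemma nilpotent_X_vec:
  assumes "v \<in> carrier_vec n"
  obtains k where "X ^\<^sub>m k *\<^sub>v v = 0\<^sub>v n"
proof -
  obtain k where "X ^\<^sub>m k = 0\<^sub>m n n" using nilpotent_X by blast
  with assms that[of k] show thesis by (simp only: zero_mat_vec)
qed

text \<open>For z > 0 no factor z + k vanishes, so the descent that starts at a vanishing power of X
  runs down to v itself.\<close>

lemma positive_weight_zero:
  assumes v: "v \<in> carrier_vec n" and Yv: "Y *\<^sub>v v = 0\<^sub>v n" and Hv: "H *\<^sub>v v = right_smult v (of_int z)"
    and z: "z > 0"
  shows "v = 0\<^sub>v n"
proof -
  have zero: "X ^\<^sub>m k *\<^sub>v v = 0\<^sub>v n \<Longrightarrow> v = 0\<^sub>v n" for k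
  proof (induction k)
    case 0
    with pow_mat_0_vec[OF X_carrier v] show ?case by simp
  next
    case (Suc k)
    have "z + int k \<noteq> 0" using z by simp
    from Suc.IH[OF pow_X_descent[OF v Yv Hv Suc.prems this]] show ?case .
  qed
  from nilpotent_X_vec[OF v] obtain k where "X ^\<^sub>m k *\<^sub>v v = 0\<^sub>v n" .
  from zero[OF this] show ?thesis .
qed

text \<open>For weight 1 - d the descent is blocked exactly at k = d - 1. A vanishing high power
  therefore descends to X^d and no further; below the barrier the descent continues to v, which is
  \<open>Ld_pow_X_inj\<close>.\<close>

lemma Ld_pow_X_zero:
  assumes v: "v \<in> Ld d" and dk: "d \<le> k"
  shows "X ^\<^sub>m k *\<^sub>v v = 0\<^sub>v n"
proof -
  note vD = LdD[OF v]
  have zero: "X ^\<^sub>m (d + k) *\<^sub>v v = 0\<^sub>v n \<Longrightarrow> X ^\<^sub>m d *\<^sub>v v = 0\<^sub>v n" for k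
  proof (induction k)
    case (Suc k)
    have 0: "X ^\<^sub>m Suc (d + k) *\<^sub>v v = 0\<^sub>v n" using Suc.prems unfolding add_Suc_right .
    have z: "1 - int d + int (d + k) \<noteq> 0" by simp
    show ?case by (rule Suc.IH[OF pow_X_descent[OF vD 0 z]])
  qed simp
  from nilpotent_X_vec[OF vD(1)] obtain l where l: "X ^\<^sub>m l *\<^sub>v v = 0\<^sub>v n" .
  have "X ^\<^sub>m (d + l) *\<^sub>v v = 0\<^sub>v n"
    by (rule pow_mat_vec_zero_mono[OF X_carrier vD(1) l]) simp
  from pow_mat_vec_zero_mono[OF X_carrier vD(1) zero[OF this] dk] show ?thesis .
qed

lemma Ld_pow_X_inj:
  assumes v: "v \<in> Ld d" and "X ^\<^sub>m k *\<^sub>v v = 0\<^sub>v n" "k < d"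
  shows "v = 0\<^sub>v n"
  using assms(2,3)
proof (induction k)
  case 0
  with pow_mat_0_vec[OF X_carrier LdD(1)[OF v]] show ?case by simp
next
  case (Suc k)
  have "1 - int d + int k \<noteq> 0" "k < d" using Suc.prems by simp_all
  from Suc.IH[OF pow_X_descent[OF LdD[OF v] Suc.prems(1) this(1)] this(2)] show ?case .
qed

lemma H_pow_X:
  assumes v: "v \<in> carrier_vec n" and Hv: "H *\<^sub>v v = right_smult v (of_int z)"
  shows "H *\<^sub>v (X ^\<^sub>m k *\<^sub>v v) = right_smult (X ^\<^sub>m k *\<^sub>v v) (of_int (z + 2 * int k))"
proof (induction k)
  case 0
  show ?case unfolding pow_mat_0_vec[OF X_carrier v] using Hv by simp
next
  case (Suc k)
  have c: "X ^\<^sub>m k *\<^sub>v v \<in> carrier_vec n" using v by simp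
  have "z + 2 * int (Suc k) = (z + 2 * int k) + 2" by simp
  then have scalar: "of_int (z + 2 * int (Suc k)) = of_int (z + 2 * int k) + (2 :: quat)"
    by (simp only: of_int_add of_int_numeral)
  show ?case
    unfolding pow_mat_Suc_vec(2)[OF X_carrier v] HX[OF c] Suc.IH mat_lin_simps(3)[OF X_carrier c c] scalar
    by (intro eq_vecI) (simp_all only: index_add_vec right_smult_dim right_smult_index dim_mult_mat_vec
        dims distrib_left)
qed

text \<open>The Casimir operator: it separates the isotypic components, and on the kernel of \<open>Y\<close> it
  determines the eigenvalue of \<open>H\<close> up to the sign excluded by \<open>positive_weight_zero\<close>.\<close>

definition casimir :: "quat vec \<Rightarrow> quat vec" where
  "casimir w = H *\<^sub>v (H *\<^sub>v w) - right_smult (H *\<^sub>v w) 2 + right_smult (X *\<^sub>v (Y *\<^sub>v w)) 4"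

text \<open>The eigenvalue d^2 - 1 is the value (1 - d)^2 - 2 (1 - d) of the Casimir operator on a
  lowest vector of weight 1 - d.\<close>

definition casimir_space :: "nat \<Rightarrow> quat vec set" where
  "casimir_space d = {w \<in> carrier_vec n. casimir w = right_smult w (of_int (int d * int d - 1))}"

lemma casimir_dim [simp]: "dim_vec (casimir w) = n"
  by (simp add: casimir_def)

lemma casimir_linear:
  assumes v: "v \<in> carrier_vec n" and w: "w \<in> carrier_vec n"
  shows "casimir (v + w) = casimir v + casimir w"
    "casimir (right_smult v (a :: quat)) = right_smult (casimir v) a"
proof -
  have c: "H *\<^sub>v v \<in> carrier_vec n" "H *\<^sub>v w \<in> carrier_vec n"
    "Y *\<^sub>v v \<in> carrier_vec n" "Y *\<^sub>v w \<in> carrier_vec n"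
    using v w by simp_all
  show "casimir (v + w) = casimir v + casimir w"
    unfolding casimir_def mat_lin_simps(1)[OF H_carrier v w] mat_lin_simps(1)[OF Y_carrier v w]
      mat_lin_simps(1)[OF H_carrier c(1,2)] mat_lin_simps(1)[OF X_carrier c(3,4)]
    by (intro eq_vecI) (simp_all add: algebra_simps del: index_mult_mat_vec)
  \<comment> \<open>Right linearity of the operator rests on 2 and 4 being central.\<close>
  have commute: "a * 2 = 2 * a" "a * 4 = 4 * a"
    by (simp_all add: mult_2 mult_2_right quat_mult_4 distrib_right[of 2 2 a, simplified] add.assoc)
  show "casimir (right_smult v a) = right_smult (casimir v) a"
    unfolding casimir_def mat_lin_simps(3)[OF H_carrier v v] mat_lin_simps(3)[OF Y_carrier v v]
      mat_lin_simps(3)[OF H_carrier c(1,1)] mat_lin_simps(3)[OF X_carrier c(3,3)]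
    by (intro eq_vecI) (simp_all add: algebra_simps commute del: index_mult_mat_vec)
qed

lemma casimir_space_subspace: "is_subspace UNIV n (casimir_space d)"
  unfolding is_subspace_def
proof (intro conjI ballI)
  show "casimir_space d \<subseteq> carrier_vec n" unfolding casimir_space_def by blast
  show "0\<^sub>v n \<in> casimir_space d"
    by (simp add: casimir_space_def casimir_def mat_vec_zero[OF H_carrier] mat_vec_zero[OF Y_carrier]
        mat_vec_zero[OF X_carrier])
next
  fix v w assume "v \<in> casimir_space d" "w \<in> casimir_space d"
  then have v: "v \<in> carrier_vec n" "casimir v = right_smult v (of_int (int d * int d - 1))"
    and w: "w \<in> carrier_vec n" "casimir w = right_smult w (of_int (int d * int d - 1))"
    unfolding casimir_space_def by blast+
  have "casimir (v + w) = right_smult (v + w) (of_int (int d * int d - 1))"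
    unfolding casimir_linear(1)[OF v(1) w(1)] v(2) w(2)
    using v(1) w(1) by (intro eq_vecI) (simp_all add: distrib_right)
  moreover have "v + w \<in> carrier_vec n" using v(1) w(1) by simp
  ultimately show "v + w \<in> casimir_space d" unfolding casimir_space_def by blast
next
  fix v and a :: quat assume "v \<in> casimir_space d"
  then have v: "v \<in> carrier_vec n" "casimir v = right_smult v (of_int (int d * int d - 1))"
    unfolding casimir_space_def by blast+
  have "casimir (right_smult v a) = right_smult (right_smult v a) (of_int (int d * int d - 1))"
    unfolding casimir_linear(2)[OF v(1) v(1)] v(2) right_smult_simps
    by (simp only: mult_of_int_commute)
  moreover have "right_smult v a \<in> carrier_vec n" using v(1) by simp
  ultimately show "right_smult v a \<in> casimir_space d" unfolding casimir_space_def by blast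
qed

text \<open>Commutation with X carries the eigenvalue from a lowest vector along its whole
  string.\<close>

lemma casimir_X:
  assumes w: "w \<in> carrier_vec n"
  shows "casimir (X *\<^sub>v w) = X *\<^sub>v casimir w"
proof -
  have c: "H *\<^sub>v w \<in> carrier_vec n" "X *\<^sub>v w \<in> carrier_vec n" "Y *\<^sub>v w \<in> carrier_vec n"
    "X *\<^sub>v (H *\<^sub>v w) \<in> carrier_vec n" "X *\<^sub>v (Y *\<^sub>v w) \<in> carrier_vec n"
    "H *\<^sub>v (H *\<^sub>v w) \<in> carrier_vec n"
    using w by simp_all
  have 1: "H *\<^sub>v (X *\<^sub>v (H *\<^sub>v w) + right_smult (X *\<^sub>v w) 2) = X *\<^sub>v (H *\<^sub>v (H *\<^sub>v w)) + right_smult (X *\<^sub>v (H *\<^sub>v w)) 2 +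
      right_smult (X *\<^sub>v (H *\<^sub>v w) + right_smult (X *\<^sub>v w) 2) 2"
    using c by (simp only: mat_lin_simps[OF H_carrier] right_smult_carrier HX[OF c(1)] HX[OF w])
  have 2: "X *\<^sub>v (Y *\<^sub>v (X *\<^sub>v w)) = X *\<^sub>v (X *\<^sub>v (Y *\<^sub>v w)) - X *\<^sub>v (H *\<^sub>v w)"
    unfolding YX[OF w] using c by (simp only: mat_lin_simps[OF X_carrier])
  have 3: "X *\<^sub>v casimir w = X *\<^sub>v (H *\<^sub>v (H *\<^sub>v w)) - right_smult (X *\<^sub>v (H *\<^sub>v w)) 2 +
      right_smult (X *\<^sub>v (X *\<^sub>v (Y *\<^sub>v w))) 4"
    unfolding casimir_def
    using c by (simp only: mat_lin_simps[OF X_carrier] right_smult_carrier minus_carrier_vec)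
  show ?thesis
    unfolding casimir_def[of "X *\<^sub>v w"] HX[OF w] 1 2 3
    by (intro eq_vecI)
       (simp_all add: algebra_simps mult_2_right quat_mult_4 del: index_mult_mat_vec)
qed

lemma Ld_casimir:
  assumes v: "v \<in> Ld d"
  shows "X ^\<^sub>m k *\<^sub>v v \<in> casimir_space d"
proof (induction k)
  case 0
  note vD = LdD[OF v]
  have "casimir v = right_smult v (of_int (1 - int d) * of_int (1 - int d) - of_int (1 - int d) * 2)"
    unfolding casimir_def vD mat_lin_simps(3)[OF H_carrier vD(1) vD(1)] mat_vec_zero[OF X_carrier]
    using vD(1) by (intro eq_vecI) (simp_all add: algebra_simps)
  also have "of_int (1 - int d) * of_int (1 - int d) - of_int (1 - int d) * 2 =
      (of_int ((1 - int d) * (1 - int d) - (1 - int d) * 2) :: quat)"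
    by (simp only: of_int_diff of_int_mult of_int_numeral)
  also have "(1 - int d) * (1 - int d) - (1 - int d) * 2 = int d * int d - 1"
    by (simp add: algebra_simps)
  finally show ?case
    unfolding pow_mat_0_vec[OF X_carrier vD(1)] casimir_space_def using vD(1) by blast
next
  case (Suc k)
  then have k: "X ^\<^sub>m k *\<^sub>v v \<in> carrier_vec n"
      "casimir (X ^\<^sub>m k *\<^sub>v v) = right_smult (X ^\<^sub>m k *\<^sub>v v) (of_int (int d * int d - 1))"
    unfolding casimir_space_def by blast+
  have "X *\<^sub>v (X ^\<^sub>m k *\<^sub>v v) \<in> casimir_space d"
    unfolding casimir_space_def mem_Collect_eq casimir_X[OF k(1)] k(2) mat_lin_simps(3)[OF X_carrier k(1) k(1)]
    using k(1) by simp
  then show ?case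
    unfolding pow_mat_Suc_vec(2)[OF X_carrier LdD(1)[OF v]] .
qed

text \<open>On ker Y the eigenvalue equation factors as (H - (d+1)) (H + (d-1)) w = 0. Hence (H +
  (d-1)) w lies in ker Y with positive weight d + 1 and is zero by
  \<open>positive_weight_zero\<close>.\<close>

lemma casimir_ker_Y:
  assumes w: "w \<in> casimir_space d" and Yw: "Y *\<^sub>v w = 0\<^sub>v n"
  shows "w \<in> Ld d"
proof -
  have wc: "w \<in> carrier_vec n" and cas: "casimir w = right_smult w (of_int (int d * int d - 1))"
    using w unfolding casimir_space_def by blast+
  let ?u = "H *\<^sub>v w + right_smult w (of_int (int d - 1))"
  have c: "H *\<^sub>v w \<in> carrier_vec n" "?u \<in> carrier_vec n" using wc by simp_all
  have "Y *\<^sub>v (H *\<^sub>v w) = H *\<^sub>v (Y *\<^sub>v w) + right_smult (Y *\<^sub>v w) 2"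
    unfolding HY[OF wc] by (rule eq_vecI) (simp_all del: index_mult_mat_vec)
  then have "Y *\<^sub>v (H *\<^sub>v w) = 0\<^sub>v n"
    unfolding Yw mat_vec_zero[OF H_carrier] by simp
  moreover have "Y *\<^sub>v ?u = Y *\<^sub>v (H *\<^sub>v w) + right_smult (Y *\<^sub>v w) (of_int (int d - 1))"
    using wc c by (simp only: mat_lin_simps[OF Y_carrier] right_smult_carrier)
  ultimately have Yu: "Y *\<^sub>v ?u = 0\<^sub>v n"
    unfolding Yw by simp
  have HHw: "H *\<^sub>v (H *\<^sub>v w) = right_smult w (of_int (int d * int d - 1)) + right_smult (H *\<^sub>v w) 2"
  proof (rule eq_vecI)
    fix i assume "i < dim_vec (right_smult w (of_int (int d * int d - 1)) + right_smult (H *\<^sub>v w) 2)"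
    then have i: "i < n" by simp
    have "casimir w $ i = (H *\<^sub>v (H *\<^sub>v w)) $ i - (H *\<^sub>v w) $ i * 2"
      unfolding casimir_def Yw mat_vec_zero[OF X_carrier]
      using i by (simp del: index_mult_mat_vec)
    then show "(H *\<^sub>v (H *\<^sub>v w)) $ i =
        (right_smult w (of_int (int d * int d - 1)) + right_smult (H *\<^sub>v w) 2) $ i"
      unfolding cas using i wc by (simp add: algebra_simps del: index_mult_mat_vec)
  qed (use wc in simp)
  have "H *\<^sub>v ?u = H *\<^sub>v (H *\<^sub>v w) + right_smult (H *\<^sub>v w) (of_int (int d - 1))"
    using wc c by (simp only: mat_lin_simps[OF H_carrier] right_smult_carrier)
  also have "\<dots> = right_smult ?u (of_int (int d + 1))"
    unfolding HHw
  proof (rule eq_vecI)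
    fix i assume "i < dim_vec (right_smult ?u (of_int (int d + 1)))"
    then have i: "i < n" using wc by simp
    have d2: "of_int (int d * int d - 1) = of_int (int d - 1) * (of_int (int d + 1) :: quat)"
      unfolding of_int_mult[symmetric] by (rule arg_cong[of _ _ of_int]) (simp add: algebra_simps)
    have d3: "of_int (int d + 1) = 2 + (of_int (int d - 1) :: quat)"
      by simp
    have "(right_smult w (of_int (int d * int d - 1)) + right_smult (H *\<^sub>v w) 2 +
        right_smult (H *\<^sub>v w) (of_int (int d - 1))) $ i =
        w $ i * of_int (int d * int d - 1) + (H *\<^sub>v w) $ i * 2 + (H *\<^sub>v w) $ i * of_int (int d - 1)"
      using i wc by (simp del: index_mult_mat_vec of_int_diff of_int_mult)
    also have "\<dots> = w $ i * (of_int (int d - 1) * of_int (int d + 1)) + (H *\<^sub>v w) $ i * of_int (int d + 1)"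
      unfolding d2 add.assoc distrib_left[symmetric] d3[symmetric] ..
    also have "\<dots> = right_smult ?u (of_int (int d + 1)) $ i"
      using i wc by (simp add: distrib_right mult.assoc add.commute
          del: index_mult_mat_vec of_int_diff of_int_mult of_int_add)
    finally show "(right_smult w (of_int (int d * int d - 1)) + right_smult (H *\<^sub>v w) 2 +
        right_smult (H *\<^sub>v w) (of_int (int d - 1))) $ i = right_smult ?u (of_int (int d + 1)) $ i" .
  qed (use c wc in simp)
  finally have Hu: "H *\<^sub>v ?u = right_smult ?u (of_int (int d + 1))" .
  have u0: "?u = 0\<^sub>v n"
    by (rule positive_weight_zero[OF c(2) Yu Hu]) simp
  have "H *\<^sub>v w = right_smult w (of_int (1 - int d))"
  proof (rule eq_vecI)
    fix i assume "i < dim_vec (right_smult w (of_int (1 - int d)))"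
    then have i: "i < n" using wc by simp
    have "?u $ i = 0" unfolding u0 using i by simp
    then have "(H *\<^sub>v w) $ i + w $ i * of_int (int d - 1) = 0"
      using i wc by (simp del: index_mult_mat_vec of_int_diff)
    then have "(H *\<^sub>v w) $ i = - (w $ i * of_int (int d - 1))"
      by (simp only: eq_neg_iff_add_eq_0)
    moreover have "of_int (1 - int d) = - (of_int (int d - 1) :: quat)" by simp
    then have "- (w $ i * of_int (int d - 1)) = w $ i * of_int (1 - int d)"
      by (simp only: mult_minus_right)
    ultimately show "(H *\<^sub>v w) $ i = right_smult w (of_int (1 - int d)) $ i"
      using i wc by (simp del: index_mult_mat_vec of_int_diff)
  qed (use wc in simp)
  with wc Yw show ?thesis unfolding Ld_def by blast
qed

text \<open>Nilpotency of Y gives a vector of ker Y inside \<open>W\<close>, and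
  \<open>weight_vector_exists\<close> improves it to a weight vector. It serves both the irreducible
  submodules and the orthogonal complement in \<open>lowest_strings_complete\<close>.\<close>

lemma stable_subspace_lowest:
  assumes W: "is_subspace \<real> n W" and nz: "W \<noteq> {0\<^sub>v n}"
    and stable: "\<And>w. w \<in> W \<Longrightarrow> H *\<^sub>v w \<in> W" "\<And>w. w \<in> W \<Longrightarrow> Y *\<^sub>v w \<in> W"
  obtains d v where "d \<ge> 1" "v \<in> W" "v \<in> Ld d" "v \<noteq> 0\<^sub>v n"
proof -
  note Wc = subspace_carrier[OF W]
  obtain w where w: "w \<in> W" "w \<noteq> 0\<^sub>v n"
    using nz subspace_zero[OF W] by blast
  then have wc: "w \<in> carrier_vec n" using Wc by blast
  obtain k where "Y ^\<^sub>m k = 0\<^sub>m n n" using nilpotent_Y by blast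
  then have "Y ^\<^sub>m k *\<^sub>v w = 0\<^sub>v n" using wc by (simp only: zero_mat_vec)
  from nilpotent_kernel[OF Y_carrier Wc stable(2) w this] obtain v
    where v: "v \<in> W" "v \<noteq> 0\<^sub>v n" "Y *\<^sub>v v = 0\<^sub>v n" .
  have vc: "v \<in> carrier_vec n" using v Wc by blast
  from nilpotent_X_vec[OF vc] obtain l where l: "X ^\<^sub>m l *\<^sub>v v = 0\<^sub>v n" .
  have closed: "H *\<^sub>v w + right_smult w (of_nat c) \<in> W" if "w \<in> W" for w c
    by (rule subspace_add[OF W stable(1)[OF that] subspace_smult[OF W that Reals_of_nat]])
  from weight_vector_exists[OF Wc closed v l] obtain u j
    where u: "u \<in> W" "u \<noteq> 0\<^sub>v n" "Y *\<^sub>v u = 0\<^sub>v n" "H *\<^sub>v u + right_smult u (of_nat j) = 0\<^sub>v n" .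
  have uc: "u \<in> carrier_vec n" using u Wc by blast
  \<comment> \<open>Weight -j is weight 1 - d for d = j + 1.\<close>
  have "H *\<^sub>v u = right_smult u (of_int (1 - int (Suc j)))"
  proof (rule eq_vecI)
    fix i assume "i < dim_vec (right_smult u (of_int (1 - int (Suc j))))"
    then have i: "i < n" using uc by simp
    have "(H *\<^sub>v u + right_smult u (of_nat j)) $ i = 0" unfolding u(4) using i by simp
    with i uc show "(H *\<^sub>v u) $ i = right_smult u (of_int (1 - int (Suc j))) $ i"
      by (simp add: eq_neg_iff_add_eq_0 del: index_mult_mat_vec)
  qed (use uc in simp)
  with u uc have "u \<in> Ld (Suc j)" unfolding Ld_def by blast
  with u that[of "Suc j" u] show thesis by simp
qed

section \<open>String modules, irreducible submodules and the identification of L(d - 1)\<close>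

definition string_list :: "nat \<Rightarrow> quat vec \<Rightarrow> quat vec list" where
  "string_list d v = map (\<lambda>l. X ^\<^sub>m l *\<^sub>v v) [0..<d]"

lemma string_list_simps [simp]:
  "length (string_list d v) = d" "l < d \<Longrightarrow> string_list d v ! l = X ^\<^sub>m l *\<^sub>v v"
  "set (string_list d v) = (\<lambda>l. X ^\<^sub>m l *\<^sub>v v) ` {..<d}"
  by (auto simp: string_list_def)

lemma string_list_carrier: "v \<in> carrier_vec n \<Longrightarrow> set (string_list d v) \<subseteq> carrier_vec n"
  by auto

text \<open>Extraction of the lowest coefficient: X^(d-1-l) moves the term with index l to the top
  of the string and pushes all later terms beyond it to zero.\<close>

lemma pow_X_string:
  assumes v: "v \<in> Ld d" and l: "l < d" and c: "\<And>i. i < l \<Longrightarrow> c i = 0"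
  shows "X ^\<^sub>m (d - 1 - l) *\<^sub>v lin_comb n (string_list d v) c = right_smult (X ^\<^sub>m (d - 1) *\<^sub>v v) (c l)"
proof -
  note vc = LdD(1)[OF v]
  let ?P = "X ^\<^sub>m (d - 1 - l)"
  have "?P *\<^sub>v lin_comb n (string_list d v) c = lin_comb n (map ((*\<^sub>v) ?P) (string_list d v)) c"
    by (rule mat_lin_comb[OF pow_carrier_mat[OF X_carrier] string_list_carrier[OF vc]])
  also have "\<dots> = right_smult (X ^\<^sub>m (d - 1) *\<^sub>v v) (c l)"
  proof (rule eq_vecI)
    fix k assume "k < dim_vec (right_smult (X ^\<^sub>m (d - 1) *\<^sub>v v) (c l))"
    then have k: "k < n" by simp
    have "lin_comb n (map ((*\<^sub>v) ?P) (string_list d v)) c $ k =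
        (\<Sum>i<d. (?P *\<^sub>v (X ^\<^sub>m i *\<^sub>v v)) $ k * c i)"
      using k by (simp del: index_mult_mat_vec)
    also have "\<dots> = (\<Sum>i<d. if i = l then (X ^\<^sub>m (d - 1) *\<^sub>v v) $ k * c l else 0)"
    proof (rule sum.cong)
      fix i assume "i \<in> {..<d}"
      then have i: "i < d" by simp
      have P: "?P *\<^sub>v (X ^\<^sub>m i *\<^sub>v v) = X ^\<^sub>m (d - 1 - l + i) *\<^sub>v v"
        by (rule pow_mat_add_vec[OF X_carrier vc, symmetric])
      consider "i < l" | "i = l" | "i > l" by linarith
      then show "(?P *\<^sub>v (X ^\<^sub>m i *\<^sub>v v)) $ k * c i = (if i = l then (X ^\<^sub>m (d - 1) *\<^sub>v v) $ k * c l else 0)"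
      proof cases
        case 1
        with c show ?thesis by simp
      next
        case 2
        then have "d - 1 - l + i = d - 1" using l by simp
        with 2 show ?thesis unfolding P by simp
      next
        case 3
        then have "d \<le> d - 1 - l + i" using i by simp
        from Ld_pow_X_zero[OF v this] 3 k show ?thesis unfolding P by simp
      qed
    qed simp
    also have "\<dots> = right_smult (X ^\<^sub>m (d - 1) *\<^sub>v v) (c l) $ k"
      using k l by (simp del: index_mult_mat_vec)
    finally show "lin_comb n (map ((*\<^sub>v) ?P) (string_list d v)) c $ k =
        right_smult (X ^\<^sub>m (d - 1) *\<^sub>v v) (c l) $ k" .
  qed simp
  finally show ?thesis .
qed

definition string_module :: "nat \<Rightarrow> quat vec \<Rightarrow> quat vec set" where
  "string_module d v = span_over \<real> n (set (string_list d v))"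

lemma string_module_subspace: "is_subspace \<real> n (string_module d v)"
  unfolding string_module_def by (rule span_subspace) simp

lemma string_module_mem:
  assumes "v \<in> carrier_vec n" "l < d"
  shows "X ^\<^sub>m l *\<^sub>v v \<in> string_module d v"
  using span_superset[OF scalar_field_simps(1) string_list_carrier[OF assms(1)]] assms(2)
  unfolding string_module_def by auto

lemma string_module_stable:
  assumes v: "v \<in> Ld d" and w: "w \<in> string_module d v"
  shows "X *\<^sub>v w \<in> string_module d v" "H *\<^sub>v w \<in> string_module d v" "Y *\<^sub>v w \<in> string_module d v"
proof -
  note vD = LdD[OF v]
  note mem = string_module_mem[OF vD(1), of _ d] and sub = string_module_subspace[of d v]
  note stable = span_mat_stable[OF scalar_field_simps(1) _ string_list_carrier[OF vD(1)],
      of _ d, folded string_module_def, OF _ _ w]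
  show "X *\<^sub>v w \<in> string_module d v"
  proof (rule stable[OF X_carrier])
    fix u assume "u \<in> set (string_list d v)"
    then obtain l where l: "l < d" "u = X ^\<^sub>m l *\<^sub>v v" unfolding string_list_simps by blast
    have "X *\<^sub>v u = X ^\<^sub>m Suc l *\<^sub>v v"
      unfolding l(2) by (rule pow_mat_Suc_vec(2)[OF X_carrier vD(1), symmetric])
    moreover have "X ^\<^sub>m Suc l *\<^sub>v v \<in> string_module d v"
    proof (cases "Suc l < d")
      case False
      then have "d \<le> Suc l" by simp
      from Ld_pow_X_zero[OF v this] subspace_zero[OF sub] show ?thesis by simp
    qed (rule mem)
    ultimately show "X *\<^sub>v u \<in> string_module d v" by simp
  qed
  show "H *\<^sub>v w \<in> string_module d v"
  proof (rule stable[OF H_carrier])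
    fix u assume "u \<in> set (string_list d v)"
    then obtain l where l: "l < d" "u = X ^\<^sub>m l *\<^sub>v v" unfolding string_list_simps by blast
    show "H *\<^sub>v u \<in> string_module d v"
      unfolding l(2) H_pow_X[OF vD(1,3)]
      by (rule subspace_smult[OF sub mem[OF l(1)] Reals_of_int])
  qed
  show "Y *\<^sub>v w \<in> string_module d v"
  proof (rule stable[OF Y_carrier])
    fix u assume "u \<in> set (string_list d v)"
    then obtain l where l: "l < d" "u = X ^\<^sub>m l *\<^sub>v v" unfolding string_list_simps by blast
    show "Y *\<^sub>v u \<in> string_module d v"
    proof (cases l)
      case 0
      with subspace_zero[OF sub] show ?thesis
        unfolding l(2) 0 pow_mat_0_vec[OF X_carrier vD(1)] vD(2) by simp
    next
      case (Suc k)
      then have "k < d" using l by simp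
      then show ?thesis
        unfolding l(2) Suc Y_pow_X_weight[OF vD]
        by (rule subspace_smult[OF sub mem Reals_of_int])
    qed
  qed
qed

lemma string_module_submodule:
  assumes "v \<in> Ld d"
  shows "sl2_submodule n X H Y (string_module d v)"
  unfolding sl2_submodule_def
  using string_module_subspace string_module_stable[OF assms] by blast

text \<open>In a vanishing combination the coefficients vanish one after the other from the bottom:
  each is the lowest one left, and X^(d-1) v is nonzero.\<close>

lemma string_list_basis:
  assumes v: "v \<in> Ld d" and nz: "v \<noteq> 0\<^sub>v n"
  shows "is_basis \<real> n (string_module d v) (string_list d v)"
  unfolding is_basis_def
proof (intro conjI allI impI)
  note vc = LdD(1)[OF v]
  show "set (string_list d v) \<subseteq> string_module d v"
    unfolding string_module_def by (rule span_superset[OF scalar_field_simps(1) string_list_carrier[OF vc]])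
  show "span_over \<real> n (set (string_list d v)) = string_module d v"
    unfolding string_module_def ..
  fix c l
  assume "range c \<subseteq> \<real> \<and> lin_comb n (string_list d v) c = 0\<^sub>v n" and "l < length (string_list d v)"
  then have zero: "lin_comb n (string_list d v) c = 0\<^sub>v n" and "l < d" by simp_all
  from \<open>l < d\<close> show "c l = 0"
  proof (induction l rule: less_induct)
    case (less l)
    have ci: "c i = 0" if "i < l" for i
      using less.IH[OF that] that less.prems by simp
    have "X ^\<^sub>m (d - 1 - l) *\<^sub>v lin_comb n (string_list d v) c = right_smult (X ^\<^sub>m (d - 1) *\<^sub>v v) (c l)"
      by (rule pow_X_string[OF v less.prems]) (rule ci)
    then have "right_smult (X ^\<^sub>m (d - 1) *\<^sub>v v) (c l) = 0\<^sub>v n"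
      unfolding zero mat_vec_zero[OF pow_carrier_mat[OF X_carrier]] by simp
    moreover have "X ^\<^sub>m (d - 1) *\<^sub>v v \<noteq> 0\<^sub>v n"
      using Ld_pow_X_inj[OF v _, of "d - 1"] nz less.prems by auto
    moreover have "X ^\<^sub>m (d - 1) *\<^sub>v v \<in> carrier_vec n" using vc by simp
    ultimately show ?case using right_smult_eq_0 by blast
  qed
qed

lemma string_module_dim:
  assumes v: "v \<in> Ld d" and nz: "v \<noteq> 0\<^sub>v n"
  shows "dim_over \<real> n (string_module d v) = d"
  using dim_over_eq[OF scalar_field_simps(1) subspace_carrier[OF string_module_subspace] string_list_basis[OF v nz]]
  by simp

lemma string_module_subset:
  assumes v: "v \<in> Ld d" and W: "is_subspace \<real> n W" "v \<in> W" "\<And>w. w \<in> W \<Longrightarrow> X *\<^sub>v w \<in> W"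
  shows "string_module d v \<subseteq> W"
proof -
  have "X ^\<^sub>m l *\<^sub>v v \<in> W" for l
  proof (induction l)
    case 0
    with W(2) show ?case unfolding pow_mat_0_vec[OF X_carrier LdD(1)[OF v]] by simp
  next
    case (Suc l)
    from W(3)[OF this] show ?case unfolding pow_mat_Suc_vec(2)[OF X_carrier LdD(1)[OF v]] .
  qed
  then show ?thesis
    unfolding string_module_def by (intro span_minimal[OF W(1)]) auto
qed

lemma string_module_casimir:
  assumes v: "v \<in> Ld d"
  shows "string_module d v \<subseteq> casimir_space d"
proof -
  have "is_subspace \<real> n (casimir_space d)"
    using casimir_space_subspace[of d] unfolding is_subspace_def by blast
  then show ?thesis
    unfolding string_module_def using Ld_casimir[OF v] by (intro span_minimal) auto
qed

text \<open>d^2 - 1 determines the natural number d, so the Casimir operator recovers the dimension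
  of a string module from any nonzero vector in it.\<close>

lemma casimir_space_unique:
  assumes w: "w \<in> casimir_space d" "w \<in> casimir_space e" and nz: "w \<noteq> 0\<^sub>v n"
  shows "d = e"
proof -
  have wc: "w \<in> carrier_vec n"
    and eq: "right_smult w (of_int (int d * int d - 1)) = right_smult w (of_int (int e * int e - 1))"
    using w unfolding casimir_space_def by simp_all
  obtain i where i: "i < n" "w $ i \<noteq> 0"
    using nz wc by (metis carrier_vecD eq_vecI index_zero_vec)
  have "w $ i * of_int (int d * int d - 1) = w $ i * of_int (int e * int e - 1)"
    using arg_cong[OF eq, of "\<lambda>u. u $ i"] i wc by (simp del: of_int_diff of_int_mult)
  with i(2) have "of_int (int d * int d - 1) = (of_int (int e * int e - 1) :: quat)"
    by simp
  then have "int d * int d = int e * int e"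
    unfolding of_int_eq_iff by simp
  then have "d * d = e * e" unfolding of_nat_mult[symmetric] of_nat_eq_iff .
  then show ?thesis
    unfolding power2_eq_square[symmetric] using power_eq_iff_eq_base[of 2 d e] by simp
qed

text \<open>A nonzero submodule contains a nonzero lowest vector w, and the Casimir eigenvalue
  forces w into \<open>Ld d\<close>. If c_0 is the bottom coefficient of w in the string, then w - v
  c_0 lies in \<open>Ld d\<close> and is killed by X^(d-1), hence is zero. So w is a multiple of v
  and the submodule contains the whole string.\<close>

lemma string_module_irreducible:
  assumes v: "v \<in> Ld d" and nz: "v \<noteq> 0\<^sub>v n" and d: "d \<ge> 1"
  shows "irreducible_submodule n X H Y (string_module d v)"
  unfolding irreducible_submodule_def
proof (intro conjI allI impI)
  note vD = LdD[OF v]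
  show "sl2_submodule n X H Y (string_module d v)"
    by (rule string_module_submodule[OF v])
  have "X ^\<^sub>m 0 *\<^sub>v v \<in> string_module d v"
    using d by (intro string_module_mem[OF vD(1)]) simp
  then have "v \<in> string_module d v"
    unfolding pow_mat_0_vec[OF X_carrier vD(1)] .
  with nz show "string_module d v \<noteq> {0\<^sub>v n}" by blast
  fix U assume "sl2_submodule n X H Y U \<and> U \<subseteq> string_module d v"
  then have U: "is_subspace \<real> n U" "U \<subseteq> string_module d v"
    and stable: "\<And>w. w \<in> U \<Longrightarrow> X *\<^sub>v w \<in> U" "\<And>w. w \<in> U \<Longrightarrow> H *\<^sub>v w \<in> U" "\<And>w. w \<in> U \<Longrightarrow> Y *\<^sub>v w \<in> U"
    unfolding sl2_submodule_def by blast+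
  show "U = {0\<^sub>v n} \<or> U = string_module d v"
  proof (cases "U = {0\<^sub>v n}")
    case False
    from stable_subspace_lowest[OF U(1) False stable(2,3)] obtain e w
      where w: "e \<ge> 1" "w \<in> U" "w \<in> Ld e" "w \<noteq> 0\<^sub>v n" .
    have wc: "w \<in> carrier_vec n" by (rule LdD(1)[OF w(3)])
    have "w \<in> casimir_space d" using string_module_casimir[OF v] U(2) w(2) by blast
    moreover have "w \<in> casimir_space e"
      using Ld_casimir[OF w(3), of 0] unfolding pow_mat_0_vec[OF X_carrier wc] .
    ultimately have "d = e" using w(4) by (rule casimir_space_unique)
    then have wd: "w \<in> Ld d" using w(3) by simp
    have "w \<in> string_module d v" using w(2) U(2) by blast
    from basis_expand[OF scalar_field_simps(1) string_list_basis[OF v nz]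
        subspace_carrier[OF string_module_subspace] this]
    obtain c where c: "range c \<subseteq> \<real>" "w = lin_comb n (string_list d v) c" .
    have d0: "0 < d" using d by simp
    have Xd: "X ^\<^sub>m (d - 1) *\<^sub>v w = right_smult (X ^\<^sub>m (d - 1) *\<^sub>v v) (c 0)"
      using pow_X_string[OF v d0, of c] c(2) by simp
    have u: "right_smult v (c 0) \<in> Ld d" "w - right_smult v (c 0) \<in> Ld d"
      using subspace_smult[OF Ld_subspace v, of "c 0"]
        subspace_diff[OF Ld_subspace scalar_field_simps(2) wd] by blast+
    have Xc: "X ^\<^sub>m (d - 1) \<in> carrier_mat n n" by simp
    have "X ^\<^sub>m (d - 1) *\<^sub>v (w - right_smult v (c 0)) = 0\<^sub>v n"
      unfolding mat_lin_simps(2)[OF Xc wc LdD(1)[OF u(1)]] mat_lin_simps(3)[OF Xc vD(1) vD(1)] Xd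
      by (rule eq_vecI) (simp_all del: index_mult_mat_vec)
    from Ld_pow_X_inj[OF u(2) this] d0 have "w - right_smult v (c 0) = 0\<^sub>v n" by simp
    then have weq: "w = right_smult v (c 0)"
      by (rule vec_minus_eq_0[OF _ wc LdD(1)[OF u(1)]])
    have c0: "c 0 \<noteq> 0"
    proof
      assume "c 0 = 0"
      with weq vD(1) w(4) show False by simp
    qed
    \<comment> \<open>\<open>U\<close> is only a real subspace; the coefficient is real because w
      was expanded over the reals.\<close>
    have "right_smult w (inverse (c 0)) \<in> U"
      using c(1) by (intro subspace_smult[OF U(1) w(2)] Reals_inverse) blast
    moreover have "right_smult w (inverse (c 0)) = v"
      unfolding weq using c0 by simp
    ultimately have "string_module d v \<subseteq> U"
      by (intro string_module_subset[OF v U(1) _ stable(1)]) simp_all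
    with U(2) show ?thesis by blast
  qed simp
qed

text \<open>A lowest vector of the module generates a nonzero submodule of it, which by
  irreducibility is everything.\<close>

lemma irreducible_string_module:
  assumes "irreducible_submodule n X H Y W"
  obtains d v where "d \<ge> 1" "v \<in> Ld d" "v \<noteq> 0\<^sub>v n" "W = string_module d v"
proof -
  have W: "is_subspace \<real> n W" "W \<noteq> {0\<^sub>v n}"
    and stable: "\<And>w. w \<in> W \<Longrightarrow> X *\<^sub>v w \<in> W" "\<And>w. w \<in> W \<Longrightarrow> H *\<^sub>v w \<in> W" "\<And>w. w \<in> W \<Longrightarrow> Y *\<^sub>v w \<in> W"
    and min: "\<And>U. sl2_submodule n X H Y U \<Longrightarrow> U \<subseteq> W \<Longrightarrow> U = {0\<^sub>v n} \<or> U = W"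
    using assms unfolding irreducible_submodule_def sl2_submodule_def by blast+
  from stable_subspace_lowest[OF W stable(2,3)] obtain d v
    where v: "d \<ge> 1" "v \<in> W" "v \<in> Ld d" "v \<noteq> 0\<^sub>v n" .
  have "string_module d v \<subseteq> W"
    by (rule string_module_subset[OF v(3) W(1) v(2) stable(1)])
  moreover have "string_module d v \<noteq> {0\<^sub>v n}"
    using string_module_irreducible[OF v(3,4,1)] unfolding irreducible_submodule_def by blast
  ultimately have "string_module d v = W"
    using min[OF string_module_submodule[OF v(3)]] by blast
  then show thesis using that[OF v(1,3,4)] by simp
qed

text \<open>The bridge from irreducible submodules to weights. Every irreducible submodule of
  dimension d is a string module and lies in the Casimir eigenspace for d, whose intersection with
  ker Y is \<open>Ld d\<close>. Conversely each nonzero vector of \<open>Ld d\<close> lies in the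
  irreducible module that it generates. It also shows that a space defined by a real span is
  quaternionic.\<close>

lemma lowest_eq_Ld:
  assumes d: "d \<ge> 1"
  shows "lowest n X H Y d = Ld d"
proof
  have iso: "isotypic n X H Y d \<subseteq> casimir_space d"
    unfolding isotypic_def
  proof (rule span_minimal)
    show "is_subspace \<real> n (casimir_space d)"
      using casimir_space_subspace[of d] unfolding is_subspace_def by blast
    show "\<Union> {W. irreducible_submodule n X H Y W \<and> dim_over \<real> n W = d} \<subseteq> casimir_space d"
    proof (rule Union_least)
      fix W assume "W \<in> {W. irreducible_submodule n X H Y W \<and> dim_over \<real> n W = d}"
      then have W: "irreducible_submodule n X H Y W" "dim_over \<real> n W = d" by simp_all
      from irreducible_string_module[OF W(1)] obtain e v
        where v: "v \<in> Ld e" "v \<noteq> 0\<^sub>v n" "W = string_module e v" .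
      with W(2) string_module_dim[OF v(1,2)] have "e = d" by simp
      with string_module_casimir[OF v(1)] v(3) show "W \<subseteq> casimir_space d" by simp
    qed
  qed
  show "lowest n X H Y d \<subseteq> Ld d"
  proof
    fix v assume "v \<in> lowest n X H Y d"
    then have "v \<in> isotypic n X H Y d" "Y *\<^sub>v v = 0\<^sub>v n"
      unfolding lowest_def by simp_all
    with iso show "v \<in> Ld d" by (intro casimir_ker_Y) (rule subsetD)
  qed
next
  let ?M = "\<Union> {W. irreducible_submodule n X H Y W \<and> dim_over \<real> n W = d}"
  have M: "?M \<subseteq> carrier_vec n"
  proof (rule Union_least)
    fix W assume "W \<in> {W. irreducible_submodule n X H Y W \<and> dim_over \<real> n W = d}"
    then have "is_subspace \<real> n W"
      unfolding irreducible_submodule_def sl2_submodule_def by simp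
    then show "W \<subseteq> carrier_vec n" by (rule subspace_carrier)
  qed
  show "Ld d \<subseteq> lowest n X H Y d"
  proof
    fix v assume v: "v \<in> Ld d"
    note vD = LdD[OF v]
    have "v \<in> isotypic n X H Y d"
    proof (cases "v = 0\<^sub>v n")
      case True
      then show ?thesis
        unfolding isotypic_def using subspace_zero[OF span_subspace[OF scalar_field_simps(1)]] by blast
    next
      case False
      have "X ^\<^sub>m 0 *\<^sub>v v \<in> string_module d v"
        using d by (intro string_module_mem[OF vD(1)]) simp
      then have "v \<in> string_module d v"
        unfolding pow_mat_0_vec[OF X_carrier vD(1)] .
      with string_module_irreducible[OF v False d] string_module_dim[OF v False]
      have "v \<in> ?M" by blast
      with span_superset[OF scalar_field_simps(1) M] show ?thesis
        unfolding isotypic_def by blast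
    qed
    with vD show "v \<in> lowest n X H Y d" unfolding lowest_def by blast
  qed
qed

text \<open>Treated apart because \<open>parts\<close> ranges over all natural numbers: no
  irreducible submodule has dimension 0, so the span is that of the empty set.\<close>

lemma lowest_0: "lowest n X H Y 0 = {0\<^sub>v n}"
proof -
  have "{W. irreducible_submodule n X H Y W \<and> dim_over \<real> n W = 0} = {}"
  proof (rule ccontr)
    assume "\<not> ?thesis"
    then obtain W where W: "irreducible_submodule n X H Y W" "dim_over \<real> n W = 0" by blast
    from irreducible_string_module[OF W(1)] obtain e v
      where v: "e \<ge> 1" "v \<in> Ld e" "v \<noteq> 0\<^sub>v n" "W = string_module e v" .
    with string_module_dim[OF v(2,3)] W(2) show False by simp
  qed
  then have "isotypic n X H Y 0 = span_over \<real> n {}"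
    unfolding isotypic_def by (simp only: Union_empty)
  also have "\<dots> = {0\<^sub>v n}"
  proof
    show "span_over \<real> n {} \<subseteq> {0\<^sub>v n}"
      unfolding span_over_def by auto
    show "{0\<^sub>v n} \<subseteq> span_over \<real> n {}"
      using subspace_zero[OF span_subspace[OF scalar_field_simps(1)]] by blast
  qed
  finally have iso: "isotypic n X H Y 0 = {0\<^sub>v n}" .
  show ?thesis
    unfolding lowest_def iso using mat_vec_zero[OF Y_carrier] by auto
qed

end

section \<open>Gram matrices and invariant forms\<close>

lemma std_inner_adjoint:
  assumes A: "A \<in> carrier_mat n m" and x: "x \<in> carrier_vec n" and y: "y \<in> carrier_vec m"
  shows "std_inner n x (A *\<^sub>v y) = std_inner m (adjoint_mat A *\<^sub>v x) y"
proof -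
  have "std_inner n x (A *\<^sub>v y) = (\<Sum>i<n. \<Sum>j<m. qcnj (x $ i) * (A $$ (i, j) * y $ j))"
    unfolding std_inner_def using A x y
    by (intro sum.cong) (simp_all add: scalar_prod_def lessThan_atLeast0 sum_distrib_left)
  also have "\<dots> = (\<Sum>j<m. \<Sum>i<n. qcnj (x $ i) * (A $$ (i, j) * y $ j))"
    by (rule sum.swap)
  also have "\<dots> = std_inner m (adjoint_mat A *\<^sub>v x) y"
    unfolding std_inner_def using A x y
    by (intro sum.cong)
       (simp_all add: scalar_prod_def lessThan_atLeast0 sum_distrib_right qcnj_sum qcnj_mult mult.assoc)
  finally show ?thesis .
qed

lemma std_inner_units:
  assumes "A \<in> carrier_mat n m" "i < n" "j < m"
  shows "std_inner n (unit_vec n i) (A *\<^sub>v unit_vec m j) = A $$ (i, j)"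
proof -
  have "std_inner n (unit_vec n i) (A *\<^sub>v unit_vec m j) = (\<Sum>k<n. if k = i then A $$ (i, j) else 0)"
    unfolding std_inner_def using assms by (intro sum.cong) auto
  with assms show ?thesis by simp
qed

lemma mat_eq_std_inner:
  assumes A: "A \<in> carrier_mat n m" and C: "C \<in> carrier_mat n m"
    and eq: "\<And>x y. x \<in> carrier_vec n \<Longrightarrow> y \<in> carrier_vec m \<Longrightarrow>
      std_inner n x (A *\<^sub>v y) = std_inner n x (C *\<^sub>v y)"
  shows "A = C"
proof (rule eq_matI)
  fix i j assume "i < dim_row C" "j < dim_col C"
  then have ij: "i < n" "j < m" using C by simp_all
  have "std_inner n (unit_vec n i) (A *\<^sub>v unit_vec m j) = std_inner n (unit_vec n i) (C *\<^sub>v unit_vec m j)"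
    by (rule eq) simp_all
  then show "A $$ (i, j) = C $$ (i, j)"
    unfolding std_inner_units[OF A ij] std_inner_units[OF C ij] .
qed (use A C in simp_all)

text \<open>Moving g to the other side turns preservation of the form into one matrix equation. It
  is applied to the ambient form as well as to the Gram matrices of the blocks.\<close>

lemma std_inner_isometry_iff:
  assumes J: "J \<in> carrier_mat n n" and g: "g \<in> carrier_mat n n"
  shows "(\<forall>x\<in>carrier_vec n. \<forall>y\<in>carrier_vec n.
      std_inner n (g *\<^sub>v x) (J *\<^sub>v (g *\<^sub>v y)) = std_inner n x (J *\<^sub>v y)) \<longleftrightarrow> adjoint_mat g * J * g = J"
proof -
  have ag: "adjoint_mat g \<in> carrier_mat n n" using g by simp
  then have gJ: "adjoint_mat g * J \<in> carrier_mat n n" using J by (rule mult_carrier_mat)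
  have eq: "std_inner n (g *\<^sub>v x) (J *\<^sub>v (g *\<^sub>v y)) = std_inner n x ((adjoint_mat g * J * g) *\<^sub>v y)"
    if x: "x \<in> carrier_vec n" and y: "y \<in> carrier_vec n" for x y
  proof -
    have gy: "g *\<^sub>v y \<in> carrier_vec n" and Jgy: "J *\<^sub>v (g *\<^sub>v y) \<in> carrier_vec n"
      using g J y by simp_all
    show ?thesis
      unfolding assoc_mult_mat_vec[OF gJ g y] assoc_mult_mat_vec[OF ag J gy]
        std_inner_adjoint[OF ag x Jgy] adjoint_mat_adjoint ..
  qed
  show ?thesis
  proof
    assume *: "\<forall>x\<in>carrier_vec n. \<forall>y\<in>carrier_vec n.
      std_inner n (g *\<^sub>v x) (J *\<^sub>v (g *\<^sub>v y)) = std_inner n x (J *\<^sub>v y)"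
    show "adjoint_mat g * J * g = J"
    proof (rule mat_eq_std_inner[OF mult_carrier_mat[OF gJ g] J])
      fix x y :: "quat vec" assume xy: "x \<in> carrier_vec n" "y \<in> carrier_vec n"
      show "std_inner n x ((adjoint_mat g * J * g) *\<^sub>v y) = std_inner n x (J *\<^sub>v y)"
        unfolding eq[OF xy, symmetric] using * xy by blast
    qed
  next
    assume *: "adjoint_mat g * J * g = J"
    show "\<forall>x\<in>carrier_vec n. \<forall>y\<in>carrier_vec n.
      std_inner n (g *\<^sub>v x) (J *\<^sub>v (g *\<^sub>v y)) = std_inner n x (J *\<^sub>v y)"
    proof (intro ballI)
      fix x y :: "quat vec" assume xy: "x \<in> carrier_vec n" "y \<in> carrier_vec n"
      show "std_inner n (g *\<^sub>v x) (J *\<^sub>v (g *\<^sub>v y)) = std_inner n x (J *\<^sub>v y)"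
        unfolding eq[OF xy] * ..
    qed
  qed
qed

definition gram_mat :: "nat \<Rightarrow> (quat vec \<Rightarrow> quat vec \<Rightarrow> quat) \<Rightarrow> quat mat" where
  "gram_mat n h = mat n n (\<lambda>(i, j). h (unit_vec n i) (unit_vec n j))"

lemma gram_mat_carrier [simp]: "gram_mat n h \<in> carrier_mat n n"
  by (simp add: gram_mat_def)

lemma sesquilinear_lin_comb_left:
  assumes h: "sesquilinear n h" and y: "y \<in> carrier_vec n" and "set vs \<subseteq> carrier_vec n"
  shows "h (lin_comb n vs c) y = (\<Sum>i<length vs. qcnj (c i) * h (vs ! i) y)"
  using assms(3)
  by (induction vs rule: rev_induct)
     (simp_all add: lin_comb_snoc nth_append sesquilinear_zero[OF h y] sesquilinearD(1)[OF h _ _ y]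
       sesquilinearD(3)[OF h _ y])

lemma lin_comb_units:
  "x \<in> carrier_vec n \<Longrightarrow> lin_comb n (map (unit_vec n) [0..<n]) (\<lambda>k. x $ k) = x"
  by (intro eq_vecI) (auto simp: unit_vec_def if_distrib[of "\<lambda>x. x * _"] cong: if_cong)

lemma sesquilinear_gram:
  assumes h: "sesquilinear n h" and x: "x \<in> carrier_vec n" and y: "y \<in> carrier_vec n"
  shows "h x y = std_inner n x (gram_mat n h *\<^sub>v y)"
proof -
  let ?u = "map (unit_vec n) [0..<n] :: quat vec list"
  have u: "set ?u \<subseteq> carrier_vec n" by auto
  have "h x y = h (lin_comb n ?u (\<lambda>k. x $ k)) y"
    unfolding lin_comb_units[OF x] ..
  also have "\<dots> = (\<Sum>i<n. qcnj (x $ i) * h (unit_vec n i) y)"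
    unfolding sesquilinear_lin_comb_left[OF h y u] by simp
  also have "\<dots> = (\<Sum>i<n. qcnj (x $ i) * (gram_mat n h *\<^sub>v y) $ i)"
  proof (intro sum.cong refl)
    fix i assume "i \<in> {..<n}"
    then have i: "i < n" by simp
    have e: "unit_vec n i \<in> carrier_vec n" by simp
    have "h (unit_vec n i) y = h (unit_vec n i) (lin_comb n ?u (\<lambda>k. y $ k))"
      unfolding lin_comb_units[OF y] ..
    also have "\<dots> = (\<Sum>j<n. h (unit_vec n i) (unit_vec n j) * y $ j)"
      unfolding sesquilinear_lin_comb[OF h e u] by simp
    also have "\<dots> = (gram_mat n h *\<^sub>v y) $ i"
      using i y by (simp add: scalar_prod_def gram_mat_def lessThan_atLeast0)
    finally show "qcnj (x $ i) * h (unit_vec n i) y = qcnj (x $ i) * (gram_mat n h *\<^sub>v y) $ i"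
      by simp
  qed
  finally show ?thesis unfolding std_inner_def .
qed

lemma adjoint_gram_mat:
  assumes "skew_hermitian n h"
  shows "adjoint_mat (gram_mat n h) = - gram_mat n h"
proof (rule eq_matI)
  fix i j assume "i < dim_row (- gram_mat n h)" "j < dim_col (- gram_mat n h)"
  then have ij: "i < n" "j < n" by (simp_all add: gram_mat_def)
  have "h (unit_vec n i) (unit_vec n j) = - qcnj (h (unit_vec n j) (unit_vec n i))"
    using assms unit_vec_carrier unfolding skew_hermitian_def by blast
  then have "qcnj (h (unit_vec n j) (unit_vec n i)) = - h (unit_vec n i) (unit_vec n j)"
    by simp
  with ij show "adjoint_mat (gram_mat n h) $$ (i, j) = (- gram_mat n h) $$ (i, j)"
    by (simp add: gram_mat_def)
qed (simp_all add: gram_mat_def)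

lemma range_subspace:
  fixes A :: "quat mat"
  assumes A: "A \<in> carrier_mat n n"
  shows "is_subspace UNIV n {A *\<^sub>v x | x. x \<in> carrier_vec n}"
  unfolding is_subspace_def
proof (intro conjI ballI)
  show "{A *\<^sub>v x | x. x \<in> carrier_vec n} \<subseteq> carrier_vec n" using A by auto
  show "0\<^sub>v n \<in> {A *\<^sub>v x | x. x \<in> carrier_vec n}"
    using mat_vec_zero[OF A] by (intro CollectI exI[of _ "0\<^sub>v n"]) simp
next
  fix v w assume "v \<in> {A *\<^sub>v x | x. x \<in> carrier_vec n}" "w \<in> {A *\<^sub>v x | x. x \<in> carrier_vec n}"
  then obtain x y where "v = A *\<^sub>v x" "w = A *\<^sub>v y" "x \<in> carrier_vec n" "y \<in> carrier_vec n" by blast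
  then show "v + w \<in> {A *\<^sub>v x | x. x \<in> carrier_vec n}"
    by (intro CollectI exI[of _ "x + y"]) (simp add: mult_add_distrib_mat_vec[OF A])
next
  fix v and a :: quat assume "v \<in> {A *\<^sub>v x | x. x \<in> carrier_vec n}"
  then obtain x where "v = A *\<^sub>v x" "x \<in> carrier_vec n" by blast
  then show "right_smult v a \<in> {A *\<^sub>v x | x. x \<in> carrier_vec n}"
    using A by (intro CollectI exI[of _ "right_smult x a"]) (simp add: mat_right_smult)
qed

lemma std_inner_commute_zero:
  "x \<in> carrier_vec n \<Longrightarrow> y \<in> carrier_vec n \<Longrightarrow> std_inner n y x = 0 \<longleftrightarrow> std_inner n x y = 0"
  by (rule eps_hermitianD(4)[OF std_inner_hermitian])

text \<open>A vector separating the range of the Gram matrix from a point outside it would lie in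
  the radical of the form; so the range is everything. Preimages of the unit vectors form the
  columns of a right inverse, which is two-sided.\<close>

lemma gram_mat_invertible:
  assumes skew: "skew_hermitian n h" and nondeg: "nondegenerate n h"
  obtains K where "K \<in> carrier_mat n n" "gram_mat n h * K = 1\<^sub>m n" "K * gram_mat n h = 1\<^sub>m n"
proof -
  let ?J = "gram_mat n h"
  have h: "sesquilinear n h" using skew by (simp add: skew_hermitian_def)
  have surj: "\<exists>x. x \<in> carrier_vec n \<and> ?J *\<^sub>v x = w" if w: "w \<in> carrier_vec n" for w
  proof (rule ccontr)
    assume "\<nexists>x. x \<in> carrier_vec n \<and> ?J *\<^sub>v x = w"
    then have "w \<notin> {?J *\<^sub>v x | x. x \<in> carrier_vec n}" by blast
    from subspace_separation[OF range_subspace[OF gram_mat_carrier] w this] obtain z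
      where z: "z \<in> carrier_vec n" "\<forall>v\<in>{?J *\<^sub>v x | x. x \<in> carrier_vec n}. std_inner n z v = 0"
        "std_inner n z w \<noteq> 0" .
    have "h z x = 0" if x: "x \<in> carrier_vec n" for x
      unfolding sesquilinear_gram[OF h z(1) x] using x z(2) by blast
    then have "z = 0\<^sub>v n" using nondeg z(1) unfolding nondegenerate_def by blast
    then have "std_inner n z w = 0"
      using sesquilinear_zero(2)[OF eps_hermitianD(1)[OF std_inner_hermitian] w] by simp
    with z(3) show False by blast
  qed
  then obtain f where f: "\<And>w. w \<in> carrier_vec n \<Longrightarrow> f w \<in> carrier_vec n \<and> ?J *\<^sub>v f w = w"
    by metis
  define K where "K = mat n n (\<lambda>(i, j). f (unit_vec n j) $ i)"
  have K: "K \<in> carrier_mat n n" by (simp add: K_def)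
  have JK: "?J * K = 1\<^sub>m n"
  proof (rule eq_matI)
    fix i j assume "i < dim_row (1\<^sub>m n :: quat mat)" "j < dim_col (1\<^sub>m n :: quat mat)"
    then have ij: "i < n" "j < n" by simp_all
    have fj: "f (unit_vec n j) \<in> carrier_vec n" "?J *\<^sub>v f (unit_vec n j) = unit_vec n j"
      using f[of "unit_vec n j"] by simp_all
    have "col K j = f (unit_vec n j)"
      using fj(1) ij by (intro eq_vecI) (simp_all add: K_def)
    then have "(?J * K) $$ (i, j) = (?J *\<^sub>v f (unit_vec n j)) $ i"
      using ij K by (simp add: gram_mat_def)
    with ij show "(?J * K) $$ (i, j) = 1\<^sub>m n $$ (i, j)"
      unfolding fj(2) by (simp add: unit_vec_def)
  qed (use K in \<open>simp_all add: gram_mat_def\<close>)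
  from that[OF K JK quat_mat_left_right_inverse[OF gram_mat_carrier K JK]] show thesis .
qed

lemma bounded_linear_qcnj: "bounded_linear qcnj"
proof (rule bounded_linear_intro[of _ 1])
  show "qcnj (r *\<^sub>R x) = r *\<^sub>R qcnj x" for r x
    by (simp add: qcnj_def scaleR_quat_def)
  show "norm (qcnj x) \<le> norm x * 1" for x
    by (simp add: qcnj_def norm_quat_def)
qed simp

lemma SO_star_form_iff:
  assumes h: "sesquilinear n h"
  shows "g \<in> carrier (SO_star_form n h) \<longleftrightarrow>
    g \<in> SL_H n \<and> adjoint_mat g * gram_mat n h * g = gram_mat n h"
proof -
  have iso: "(\<forall>x\<in>carrier_vec n. \<forall>y\<in>carrier_vec n. h (g *\<^sub>v x) (g *\<^sub>v y) = h x y) \<longleftrightarrow>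
      adjoint_mat g * gram_mat n h * g = gram_mat n h" if g: "g \<in> carrier_mat n n"
    unfolding std_inner_isometry_iff[OF gram_mat_carrier g, symmetric]
  proof (intro ball_cong refl)
    fix x y :: "quat vec" assume x: "x \<in> carrier_vec n" and y: "y \<in> carrier_vec n"
    have gx: "g *\<^sub>v x \<in> carrier_vec n" and gy: "g *\<^sub>v y \<in> carrier_vec n" using g x y by simp_all
    show "(h (g *\<^sub>v x) (g *\<^sub>v y) = h x y) =
        (std_inner n (g *\<^sub>v x) (gram_mat n h *\<^sub>v (g *\<^sub>v y)) = std_inner n x (gram_mat n h *\<^sub>v y))"
      unfolding sesquilinear_gram[OF h gx gy] sesquilinear_gram[OF h x y] ..
  qed
  have "g \<in> carrier (SO_star_form n h) \<longleftrightarrow>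
      g \<in> SL_H n \<and> (\<forall>x\<in>carrier_vec n. \<forall>y\<in>carrier_vec n. h (g *\<^sub>v x) (g *\<^sub>v y) = h x y)"
    by (simp only: SO_star_form_def mat_group_def partial_object.select_convs mem_Collect_eq)
  also have "\<dots> \<longleftrightarrow> g \<in> SL_H n \<and> adjoint_mat g * gram_mat n h * g = gram_mat n h"
  proof (rule conj_cong[OF refl])
    assume "g \<in> SL_H n"
    then have "g \<in> carrier_mat n n" by (simp add: SL_H_def)
    then show "(\<forall>x\<in>carrier_vec n. \<forall>y\<in>carrier_vec n. h (g *\<^sub>v x) (g *\<^sub>v y) = h x y) \<longleftrightarrow>
      adjoint_mat g * gram_mat n h * g = gram_mat n h" by (rule iso)
  qed
  finally show ?thesis .
qed

text \<open>The equation \<open>adjoint_mat (\<gamma> s) * J * \<gamma> s = J\<close>, with J the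
  Gram matrix, is differentiated at s = 0, where \<gamma> is the identity.\<close>

lemma lie_algebra_skew_adjoint:
  assumes h: "sesquilinear n h" and A: "A \<in> lie_algebra n (SO_star_form n h)"
  shows "adjoint_mat A * gram_mat n h = - (gram_mat n h * A)"
proof -
  let ?J = "gram_mat n h"
  have Ac: "A \<in> carrier_mat n n" using A by (simp add: lie_algebra_def)
  obtain \<gamma> where \<gamma>: "\<And>s. \<gamma> s \<in> carrier (SO_star_form n h)" "\<gamma> 0 = 1\<^sub>m n"
    "\<And>i j. i < n \<Longrightarrow> j < n \<Longrightarrow> ((\<lambda>s. \<gamma> s $$ (i, j)) has_vector_derivative A $$ (i, j)) (at 0)"
    using A unfolding lie_algebra_def by blast
  have \<gamma>c: "\<gamma> s \<in> carrier_mat n n" and \<gamma>J: "adjoint_mat (\<gamma> s) * ?J * \<gamma> s = ?J" for s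
    using \<gamma>(1)[of s] unfolding SO_star_form_iff[OF h] SL_H_def by blast+
  \<comment> \<open>Kept general in both outer factors: it describes the constant function to be
    differentiated and also the two summands of its derivative.\<close>
  have expand: "(adjoint_mat P * ?J * Q) $$ (i, j) =
      (\<Sum>l<n. \<Sum>k<n. qcnj (P $$ (k, i)) * ?J $$ (k, l) * Q $$ (l, j))"
    if "P \<in> carrier_mat n n" "Q \<in> carrier_mat n n" "i < n" "j < n" for P Q i j
  proof -
    have PJ: "(adjoint_mat P * ?J) $$ (i, l) = (\<Sum>k<n. qcnj (P $$ (k, i)) * ?J $$ (k, l))"
      if "l < n" for l
      using that \<open>P \<in> carrier_mat n n\<close> \<open>i < n\<close> by (subst mult_index_sum) (auto simp: gram_mat_def)
    have "(adjoint_mat P * ?J * Q) $$ (i, j) = (\<Sum>l<n. (adjoint_mat P * ?J) $$ (i, l) * Q $$ (l, j))"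
      using that by (subst mult_index_sum) (auto simp: gram_mat_def)
    also have "\<dots> = (\<Sum>l<n. \<Sum>k<n. qcnj (P $$ (k, i)) * ?J $$ (k, l) * Q $$ (l, j))"
      using PJ by (intro sum.cong) (simp_all add: sum_distrib_right)
    finally show ?thesis .
  qed
  show ?thesis
  proof (rule eq_matI)
    fix i j assume "i < dim_row (- (?J * A))" "j < dim_col (- (?J * A))"
    then have ij: "i < n" "j < n" using Ac by (simp_all add: gram_mat_def)
    let ?one = "1\<^sub>m n :: quat mat"
    have one: "?one \<in> carrier_mat n n" by simp
    have d1: "((\<lambda>s. qcnj (\<gamma> s $$ (k, i))) has_vector_derivative qcnj (A $$ (k, i))) (at 0)"
      if "k < n" for k
      by (rule bounded_linear.has_vector_derivative[OF bounded_linear_qcnj \<gamma>(3)[OF that ij(1)]])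
    have "((\<lambda>s. qcnj (\<gamma> s $$ (k, i)) * ?J $$ (k, l) * \<gamma> s $$ (l, j)) has_vector_derivative
        (qcnj (\<gamma> 0 $$ (k, i)) * ?J $$ (k, l) * A $$ (l, j) +
         qcnj (A $$ (k, i)) * ?J $$ (k, l) * \<gamma> 0 $$ (l, j))) (at 0)" if "k < n" "l < n" for k l
      by (rule has_vector_derivative_mult[OF has_vector_derivative_mult_left[OF d1[OF that(1)]] \<gamma>(3)[OF that(2) ij(2)]])
    then have "((\<lambda>s. \<Sum>l<n. \<Sum>k<n. qcnj (\<gamma> s $$ (k, i)) * ?J $$ (k, l) * \<gamma> s $$ (l, j))
        has_vector_derivative (\<Sum>l<n. \<Sum>k<n. qcnj (\<gamma> 0 $$ (k, i)) * ?J $$ (k, l) * A $$ (l, j) +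
         qcnj (A $$ (k, i)) * ?J $$ (k, l) * \<gamma> 0 $$ (l, j))) (at 0)"
      by (intro has_vector_derivative_sum) simp
    moreover have "(\<Sum>l<n. \<Sum>k<n. qcnj (\<gamma> 0 $$ (k, i)) * ?J $$ (k, l) * A $$ (l, j) +
         qcnj (A $$ (k, i)) * ?J $$ (k, l) * \<gamma> 0 $$ (l, j)) =
        (adjoint_mat ?one * ?J * A) $$ (i, j) + (adjoint_mat A * ?J * ?one) $$ (i, j)"
      unfolding sum.distrib expand[OF one Ac ij] expand[OF Ac one ij] \<gamma>(2) ..
    moreover have "(\<lambda>s. \<Sum>l<n. \<Sum>k<n. qcnj (\<gamma> s $$ (k, i)) * ?J $$ (k, l) * \<gamma> s $$ (l, j)) =
        (\<lambda>s. ?J $$ (i, j))"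
      unfolding expand[OF \<gamma>c \<gamma>c ij, symmetric] \<gamma>J ..
    ultimately have "((\<lambda>s. ?J $$ (i, j)) has_vector_derivative
        (adjoint_mat ?one * ?J * A) $$ (i, j) + (adjoint_mat A * ?J * ?one) $$ (i, j)) (at 0)"
      by simp
    then have "(\<lambda>r. r *\<^sub>R ((adjoint_mat ?one * ?J * A) $$ (i, j) + (adjoint_mat A * ?J * ?one) $$ (i, j))) =
        (\<lambda>r. r *\<^sub>R 0)"
      using has_vector_derivative_const[of "?J $$ (i, j)" "at 0"]
      unfolding has_vector_derivative_def by (rule has_derivative_unique)
    from fun_cong[OF this, of 1]
    have "(adjoint_mat ?one * ?J * A) $$ (i, j) + (adjoint_mat A * ?J * ?one) $$ (i, j) = 0"
      by (simp only: scaleR_one)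
    moreover have "adjoint_mat ?one * ?J * A = ?J * A"
      unfolding adjoint_mat_one left_mult_one_mat[OF gram_mat_carrier] ..
    moreover have "adjoint_mat A * ?J * ?one = adjoint_mat A * ?J"
      by (rule right_mult_one_mat) (rule mult_carrier_mat[OF adjoint_mat_carrier[OF Ac] gram_mat_carrier])
    ultimately have "(?J * A) $$ (i, j) + (adjoint_mat A * ?J) $$ (i, j) = 0"
      by simp
    then have "(adjoint_mat A * ?J) $$ (i, j) = - (?J * A) $$ (i, j)"
      by (simp only: eq_neg_iff_add_eq_0 add.commute)
    also have "\<dots> = (- (?J * A)) $$ (i, j)"
      using ij Ac by (simp add: gram_mat_def del: index_mult_mat(1))
    finally show "(adjoint_mat A * ?J) $$ (i, j) = (- (?J * A)) $$ (i, j)" .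
  qed (use Ac in \<open>simp_all add: gram_mat_def\<close>)
qed

section \<open>The invariant skew-Hermitian form and the forms induced on lowest weight
  spaces\<close>

locale skew_rep = sl2_rep +
  fixes J K :: "quat mat"
  assumes J_carrier [simp]: "J \<in> carrier_mat n n" and K_carrier [simp]: "K \<in> carrier_mat n n"
    and JK: "J * K = 1\<^sub>m n" and KJ: "K * J = 1\<^sub>m n" and adjoint_J: "adjoint_mat J = - J"
    and X_skew: "adjoint_mat X * J = - (J * X)"
    and H_skew: "adjoint_mat H * J = - (J * H)"
    and Y_skew: "adjoint_mat Y * J = - (J * Y)"
begin

definition frm :: "quat vec \<Rightarrow> quat vec \<Rightarrow> quat" where
  "frm x y = std_inner n x (J *\<^sub>v y)"

lemma std_sesquilinear: "sesquilinear n (std_inner n)"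
  by (rule eps_hermitianD(1)[OF std_inner_hermitian])

lemma frm_sesquilinear: "sesquilinear n frm"
  unfolding sesquilinear_def frm_def
proof (intro conjI ballI allI)
  fix x y z :: "quat vec" and a :: quat
  assume x: "x \<in> carrier_vec n" and y: "y \<in> carrier_vec n"
  have Jy: "J *\<^sub>v y \<in> carrier_vec n" using y by simp
  show "std_inner n (right_smult x a) (J *\<^sub>v y) = qcnj a * std_inner n x (J *\<^sub>v y)"
    by (rule sesquilinearD(3)[OF std_sesquilinear x Jy])
  show "std_inner n x (J *\<^sub>v right_smult y a) = std_inner n x (J *\<^sub>v y) * a"
    unfolding mat_lin_simps(3)[OF J_carrier y y] by (rule sesquilinearD(4)[OF std_sesquilinear x Jy])
  assume z: "z \<in> carrier_vec n"
  have Jz: "J *\<^sub>v z \<in> carrier_vec n" using z by simp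
  show "std_inner n (x + y) (J *\<^sub>v z) = std_inner n x (J *\<^sub>v z) + std_inner n y (J *\<^sub>v z)"
    by (rule sesquilinearD(1)[OF std_sesquilinear x y Jz])
  show "std_inner n x (J *\<^sub>v (y + z)) = std_inner n x (J *\<^sub>v y) + std_inner n x (J *\<^sub>v z)"
    unfolding mat_lin_simps(1)[OF J_carrier y z] by (rule sesquilinearD(2)[OF std_sesquilinear x Jy Jz])
qed

lemma uminus_mat_vec: "A \<in> carrier_mat n n \<Longrightarrow> v \<in> carrier_vec n \<Longrightarrow> - A *\<^sub>v v = - (A *\<^sub>v (v :: quat vec))"
  by (rule uminus_mult_mat_vec) auto

lemma sesquilinear_uminus:
  assumes h: "sesquilinear n h" and x: "x \<in> carrier_vec n" and y: "y \<in> carrier_vec n"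
  shows "h x (- y) = - h x y" "h (- x) y = - h x y"
proof -
  have u: "- z = right_smult z (- 1)" for z :: "quat vec"
    by (intro eq_vecI) auto
  show "h x (- y) = - h x y" "h (- x) y = - h x y"
    unfolding u sesquilinearD(3)[OF h x y] sesquilinearD(4)[OF h x y] by simp_all
qed

lemma frm_skew:
  assumes x: "x \<in> carrier_vec n" and y: "y \<in> carrier_vec n"
  shows "frm y x = - qcnj (frm x y)"
proof -
  have Jx: "J *\<^sub>v x \<in> carrier_vec n" and Jy: "J *\<^sub>v y \<in> carrier_vec n" using x y by simp_all
  have "frm y x = std_inner n (- (J *\<^sub>v y)) x"
    unfolding frm_def std_inner_adjoint[OF J_carrier y x] adjoint_J uminus_mat_vec[OF J_carrier y] ..
  also have "\<dots> = - std_inner n (J *\<^sub>v y) x"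
    by (rule sesquilinear_uminus(2)[OF std_sesquilinear Jy x])
  also have "std_inner n (J *\<^sub>v y) x = 1 * qcnj (std_inner n x (J *\<^sub>v y))"
    by (rule eps_hermitianD(3)[OF std_inner_hermitian x Jy])
  finally show ?thesis unfolding frm_def by simp
qed

lemma frm_zero_commute:
  assumes "x \<in> carrier_vec n" "y \<in> carrier_vec n"
  shows "frm y x = 0 \<longleftrightarrow> frm x y = 0"
proof -
  have "qcnj z = 0 \<longleftrightarrow> z = 0" for z
    by (metis qcnj_simps(1) qcnj_simps(3))
  with frm_skew[OF assms] show ?thesis by simp
qed

lemma frm_skew_adjoint:
  assumes A: "A \<in> carrier_mat n n" and skew: "adjoint_mat A * J = - (J * A)"
    and x: "x \<in> carrier_vec n" and y: "y \<in> carrier_vec n"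
  shows "frm (A *\<^sub>v x) y = - frm x (A *\<^sub>v y)"
proof -
  have c: "J *\<^sub>v y \<in> carrier_vec n" "A *\<^sub>v y \<in> carrier_vec n" "J *\<^sub>v (A *\<^sub>v y) \<in> carrier_vec n"
    using A x y by simp_all
  have aA: "adjoint_mat A \<in> carrier_mat n n" using A by simp
  have "frm (A *\<^sub>v x) y = std_inner n x (adjoint_mat A *\<^sub>v (J *\<^sub>v y))"
    unfolding frm_def std_inner_adjoint[OF aA x c(1)] adjoint_mat_adjoint ..
  also have "adjoint_mat A *\<^sub>v (J *\<^sub>v y) = - (J *\<^sub>v (A *\<^sub>v y))"
    unfolding assoc_mult_mat_vec[OF aA J_carrier y, symmetric] skew
      uminus_mat_vec[OF mult_carrier_mat[OF J_carrier A] y] assoc_mult_mat_vec[OF J_carrier A y] ..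
  also have "std_inner n x (- (J *\<^sub>v (A *\<^sub>v y))) = - frm x (A *\<^sub>v y)"
    unfolding frm_def by (rule sesquilinear_uminus(1)[OF std_sesquilinear x c(3)])
  finally show ?thesis .
qed

lemmas frm_X = frm_skew_adjoint[OF X_carrier X_skew]
  and frm_H = frm_skew_adjoint[OF H_carrier H_skew]
  and frm_Y = frm_skew_adjoint[OF Y_carrier Y_skew]

lemma frm_pow_X:
  assumes x: "x \<in> carrier_vec n" and y: "y \<in> carrier_vec n"
  shows "frm (X ^\<^sub>m k *\<^sub>v x) y = (- 1) ^ k * frm x (X ^\<^sub>m k *\<^sub>v y)"
  using y
proof (induction k arbitrary: y)
  case 0
  show ?case unfolding pow_mat_0_vec[OF X_carrier x] pow_mat_0_vec[OF X_carrier 0] by simp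
next
  case (Suc k)
  have c: "X ^\<^sub>m k *\<^sub>v x \<in> carrier_vec n" "X *\<^sub>v y \<in> carrier_vec n" using x Suc.prems by simp_all
  show ?case
    unfolding pow_mat_Suc_vec(2)[OF X_carrier x] frm_X[OF c(1) Suc.prems] Suc.IH[OF c(2)]
      pow_mat_Suc_vec(1)[OF X_carrier Suc.prems] by simp
qed

text \<open>Since K inverts J, every functional given by the auxiliary inner product is represented
  by the form itself; separating vectors thus become vectors for \<open>frm\<close>.\<close>

lemma frm_surj:
  assumes z: "z \<in> carrier_vec n"
  shows "K *\<^sub>v z \<in> carrier_vec n" "frm x (K *\<^sub>v z) = std_inner n x z"
proof -
  show "K *\<^sub>v z \<in> carrier_vec n" using z by simp
  have "J *\<^sub>v (K *\<^sub>v z) = z"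
    unfolding assoc_mult_mat_vec[OF J_carrier K_carrier z, symmetric] JK using z by simp
  then show "frm x (K *\<^sub>v z) = std_inner n x z" unfolding frm_def by simp
qed

lemma frm_nondegenerate:
  assumes x: "x \<in> carrier_vec n" and 0: "\<And>y. y \<in> carrier_vec n \<Longrightarrow> frm y x = 0"
  shows "x = 0\<^sub>v n"
proof (rule std_inner_self_eq_0[OF x])
  have "frm x (K *\<^sub>v x) = 0"
    using 0[OF frm_surj(1)[OF x]] frm_zero_commute[OF frm_surj(1)[OF x] x] by blast
  then show "std_inner n x x = 0" unfolding frm_surj(2)[OF x] .
qed

text \<open>Skewness of H multiplies the pairing by a + b and gives 0; the integer weights are
  central and fixed by conjugation.\<close>

lemma frm_weight:
  assumes x: "x \<in> carrier_vec n" "H *\<^sub>v x = right_smult x (of_int a)"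
    and y: "y \<in> carrier_vec n" "H *\<^sub>v y = right_smult y (of_int b)" and ab: "a + b \<noteq> 0"
  shows "frm x y = 0"
proof -
  have "frm (H *\<^sub>v x) y = - frm x (H *\<^sub>v y)"
    by (rule frm_H[OF x(1) y(1)])
  then have "qcnj (of_int a) * frm x y = - (frm x y * of_int b)"
    unfolding x(2) y(2) sesquilinearD(3,4)[OF frm_sesquilinear x(1) y(1)] .
  moreover have "qcnj (of_int a) = of_int a"
    using qcnj_of_real[of "of_int a"] by simp
  ultimately have "frm x y * of_int a + frm x y * of_int b = 0"
    by (simp add: mult_of_int_commute)
  then have "frm x y * of_int (a + b) = 0"
    by (simp add: distrib_left)
  moreover have "of_int (a + b) \<noteq> (0 :: quat)"
    using ab unfolding of_int_eq_0_iff .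
  ultimately show ?thesis unfolding mult_eq_0_iff by blast
qed

text \<open>Weights allow a nonzero pairing only for 2 m = d + e - 2. In that case, unless d = e and
  m = d - 1, the exponent m is at least d or at least e, and X^m, moved across the form if
  necessary, kills one of the two vectors.\<close>

lemma Ld_frm_orthogonal:
  assumes u: "u \<in> Ld d" and v: "v \<in> Ld e" and de: "d \<ge> 1" "e \<ge> 1" and m: "\<not> (d = e \<and> m = d - 1)"
  shows "frm u (X ^\<^sub>m m *\<^sub>v v) = 0"
proof (cases "2 * int m = int d + int e - 2")
  case False
  have c: "X ^\<^sub>m m *\<^sub>v v \<in> carrier_vec n" using LdD(1)[OF v] by simp
  show ?thesis
    by (rule frm_weight[OF LdD(1,3)[OF u] c H_pow_X[OF LdD(1,3)[OF v]]]) (use False in simp)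
next
  case True
  then consider "d \<le> m" | "e \<le> m"
    using de m by linarith
  then show ?thesis
  proof cases
    case 1
    have "frm (X ^\<^sub>m m *\<^sub>v u) v = 0"
      unfolding Ld_pow_X_zero[OF u 1] by (rule sesquilinear_zero(2)[OF frm_sesquilinear LdD(1)[OF v]])
    then show ?thesis
      unfolding frm_pow_X[OF LdD(1)[OF u] LdD(1)[OF v]] by simp
  next
    case 2
    show ?thesis
      unfolding Ld_pow_X_zero[OF v 2] by (rule sesquilinear_zero(1)[OF frm_sesquilinear LdD(1)[OF u]])
  qed
qed

definition block :: "nat \<Rightarrow> quat vec \<Rightarrow> quat vec \<Rightarrow> quat" where
  "block d u v = frm u (X ^\<^sub>m (d - 1) *\<^sub>v v)"

text \<open>One sign comes from skewness of the ambient form and d - 1 further signs from moving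
  X^(d-1) to the other argument.\<close>

lemma block_hermitian:
  assumes d: "d \<ge> 1"
  shows "eps_hermitian ((- 1) ^ d) n (block d)"
  unfolding eps_hermitian_def
proof (intro conjI ballI)
  show "(- 1 :: quat) ^ d = 1 \<or> (- 1 :: quat) ^ d = - 1"
    by (cases "even d") simp_all
  have P: "X ^\<^sub>m (d - 1) \<in> carrier_mat n n" by simp
  show "sesquilinear n (block d)"
    unfolding sesquilinear_def block_def
  proof (intro conjI ballI allI)
    fix x y z :: "quat vec" and a :: quat
    assume x: "x \<in> carrier_vec n" and y: "y \<in> carrier_vec n"
    let ?P = "\<lambda>v. X ^\<^sub>m (d - 1) *\<^sub>v v"
    have Py: "?P y \<in> carrier_vec n" using y by simp
    show "frm (right_smult x a) (?P y) = qcnj a * frm x (?P y)"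
      by (rule sesquilinearD(3)[OF frm_sesquilinear x Py])
    show "frm x (?P (right_smult y a)) = frm x (?P y) * a"
      unfolding mat_lin_simps(3)[OF P y y] by (rule sesquilinearD(4)[OF frm_sesquilinear x Py])
    assume z: "z \<in> carrier_vec n"
    have Pz: "?P z \<in> carrier_vec n" using z by simp
    show "frm (x + y) (?P z) = frm x (?P z) + frm y (?P z)"
      by (rule sesquilinearD(1)[OF frm_sesquilinear x y Pz])
    show "frm x (?P (y + z)) = frm x (?P y) + frm x (?P z)"
      unfolding mat_lin_simps(1)[OF P y z] by (rule sesquilinearD(2)[OF frm_sesquilinear x Py Pz])
  qed
  fix x y :: "quat vec" assume x: "x \<in> carrier_vec n" and y: "y \<in> carrier_vec n"
  have c: "X ^\<^sub>m (d - 1) *\<^sub>v x \<in> carrier_vec n" "X ^\<^sub>m (d - 1) *\<^sub>v y \<in> carrier_vec n" using x y by simp_all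
  have e: "- ((- 1) ^ (d - 1)) = (- 1 :: quat) ^ d"
    using d by (cases d) simp_all
  have ec: "qcnj ((- 1) ^ (d - 1)) = (- 1) ^ (d - 1)"
    by (cases "even (d - 1)") simp_all
  have central: "z * (- 1) ^ (d - 1) = (- 1) ^ (d - 1) * (z :: quat)" for z
    by (cases "even (d - 1)") simp_all
  have "block d y x = - qcnj (frm (X ^\<^sub>m (d - 1) *\<^sub>v x) y)"
    unfolding block_def by (rule frm_skew[OF c(1) y])
  also have "\<dots> = - (qcnj (block d x y) * (- 1) ^ (d - 1))"
    unfolding frm_pow_X[OF x y] block_def qcnj_mult ec ..
  also have "\<dots> = (- 1) ^ d * qcnj (block d x y)"
    unfolding central e[symmetric] by simp
  finally show "block d y x = (- 1) ^ d * qcnj (block d x y)" .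
qed

lemma Y_affine_H:
  assumes v: "v \<in> carrier_vec n" and Yv: "Y *\<^sub>v v = 0\<^sub>v n"
  shows "H *\<^sub>v v + right_smult v (of_nat c) \<in> carrier_vec n"
    "Y *\<^sub>v (H *\<^sub>v v + right_smult v (of_nat c)) = 0\<^sub>v n"
proof -
  have Hv: "H *\<^sub>v v \<in> carrier_vec n" using v by simp
  show "H *\<^sub>v v + right_smult v (of_nat c) \<in> carrier_vec n" using v Hv by simp
  have "Y *\<^sub>v (H *\<^sub>v v) = H *\<^sub>v (Y *\<^sub>v v) + right_smult (Y *\<^sub>v v) 2"
    unfolding HY[OF v] by (rule eq_vecI) (simp_all del: index_mult_mat_vec)
  then have "Y *\<^sub>v (H *\<^sub>v v) = 0\<^sub>v n"
    unfolding Yv mat_vec_zero[OF H_carrier] by simp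
  moreover have "Y *\<^sub>v (H *\<^sub>v v + right_smult v (of_nat c)) = Y *\<^sub>v (H *\<^sub>v v) + right_smult (Y *\<^sub>v v) (of_nat c)"
    using v Hv by (simp only: mat_lin_simps[OF Y_carrier] right_smult_carrier)
  ultimately show "Y *\<^sub>v (H *\<^sub>v v + right_smult v (of_nat c)) = 0\<^sub>v n"
    unfolding Yv by simp
qed

lemma pow_X_affine_H_zero:
  assumes v: "v \<in> carrier_vec n" and Yv: "Y *\<^sub>v v = 0\<^sub>v n" and 0: "X ^\<^sub>m Suc k *\<^sub>v v = 0\<^sub>v n"
  shows "X ^\<^sub>m k *\<^sub>v (H *\<^sub>v v + right_smult v (of_nat k)) = 0\<^sub>v n"
  by (rule Y_pow_X_ker[OF v 0]) (unfold Yv, rule mat_vec_zero[OF pow_carrier_mat[OF X_carrier]])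

text \<open>The factors \<open>H + k\<close>, which eventually kill a vector of \<open>ker Y\<close>, act under the form as
  the scalars \<open>k - (d - 1)\<close>; the factor with \<open>k = d - 1\<close> is taken last, on a vector of \<open>Ld d\<close>.\<close>

lemma frm_ker_Y:
  assumes w: "w \<in> carrier_vec n" "H *\<^sub>v w = right_smult w (of_int (int d - 1))" and d: "d \<ge> 1"
    and perp: "\<And>v. v \<in> Ld d \<Longrightarrow> frm w v = 0"
    and v: "v \<in> carrier_vec n" "Y *\<^sub>v v = 0\<^sub>v n"
  shows "frm w v = 0"
proof -
  have affine: "frm w (H *\<^sub>v v + right_smult v (of_nat c)) = frm w v * of_int (int c - (int d - 1))"
    if v: "v \<in> carrier_vec n" for v c
  proof -
    have Hv: "H *\<^sub>v v \<in> carrier_vec n" and vc: "right_smult v (of_nat c) \<in> carrier_vec n" using v by simp_all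
    have real: "qcnj (of_int (int d - 1)) = of_int (int d - 1)"
      using qcnj_of_real[of "of_int (int d - 1)"] by simp
    have "frm w (H *\<^sub>v v) = - frm (H *\<^sub>v w) v"
      using frm_H[OF w(1) v] by simp
    also have "\<dots> = - (of_int (int d - 1) * frm w v)"
      unfolding w(2) sesquilinearD(3)[OF frm_sesquilinear w(1) v] real ..
    also have "\<dots> = - (frm w v * of_int (int d - 1))"
      unfolding mult_of_int_commute ..
    finally have 1: "frm w (H *\<^sub>v v) = - (frm w v * of_int (int d - 1))" .
    have 2: "of_int (int c - (int d - 1)) = of_nat c - (of_int (int d - 1) :: quat)"
      by (simp only: of_int_diff of_int_of_nat_eq)
    show ?thesis
      unfolding sesquilinearD(2)[OF frm_sesquilinear w(1) Hv vc] sesquilinearD(4)[OF frm_sesquilinear w(1) v]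
        1 2 right_diff_distrib by simp
  qed
  have cancel: "frm w v = 0" if "v \<in> carrier_vec n" "frm w (H *\<^sub>v v + right_smult v (of_nat c)) = 0" "int c \<noteq> int d - 1"
    for v c
  proof -
    have "of_int (int c - (int d - 1)) \<noteq> (0 :: quat)"
      unfolding of_int_eq_0_iff using that(3) by simp
    with that(2) show ?thesis unfolding affine[OF that(1)] mult_eq_0_iff by blast
  qed
  \<comment> \<open>Here the factor H + (d - 1) is held in reserve: the remaining factors H + m with
    m < d - 1 act under the form as nonzero scalars and are removed one by one, until the vector
    itself is killed by H + (d - 1) and lies in \<open>Ld d\<close>.\<close>
  have low: "frm w v = 0"
    if "v \<in> carrier_vec n" "Y *\<^sub>v v = 0\<^sub>v n" "m \<le> d - 1"
      "X ^\<^sub>m m *\<^sub>v (H *\<^sub>v v + right_smult v (of_nat (d - 1))) = 0\<^sub>v n" for m v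
    using that
  proof (induction m arbitrary: v)
    case 0
    note v = 0(1,2)
    have 1: "H *\<^sub>v v + right_smult v (of_nat (d - 1)) = 0\<^sub>v n"
      using 0(4) unfolding pow_mat_0_vec[OF X_carrier Y_affine_H(1)[OF v]] .
    have "H *\<^sub>v v = right_smult v (of_int (1 - int d))"
    proof (rule eq_vecI)
      fix i assume "i < dim_vec (right_smult v (of_int (1 - int d)))"
      then have i: "i < n" using v by simp
      have "(H *\<^sub>v v + right_smult v (of_nat (d - 1))) $ i = 0" unfolding 1 using i by simp
      then have "(H *\<^sub>v v) $ i = - (v $ i * of_nat (d - 1))"
        using i v by (simp add: eq_neg_iff_add_eq_0 del: index_mult_mat_vec)
      moreover have "of_int (1 - int d) = - (of_nat (d - 1) :: quat)"
        using d by (simp add: of_nat_diff)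
      then have "- (v $ i * of_nat (d - 1)) = v $ i * of_int (1 - int d)"
        by (simp only: mult_minus_right)
      ultimately show "(H *\<^sub>v v) $ i = right_smult v (of_int (1 - int d)) $ i"
        using i v by (simp del: index_mult_mat_vec of_int_diff)
    qed (use v in simp)
    with v have "v \<in> Ld d" unfolding Ld_def by blast
    then show ?case by (rule perp)
  next
    case (Suc m)
    note v = Suc.prems(1,2)
    let ?y = "H *\<^sub>v v + right_smult v (of_nat (d - 1))" and ?u = "H *\<^sub>v v + right_smult v (of_nat m)"
    have Hv: "H *\<^sub>v v \<in> carrier_vec n" and HHv: "H *\<^sub>v (H *\<^sub>v v) \<in> carrier_vec n" using v by simp_all
    \<comment> \<open>H + m and H + (d - 1) commute, so the reserved factor can be kept outermost
      for the induction hypothesis.\<close>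
    have "H *\<^sub>v ?u + right_smult ?u (of_nat (d - 1)) = H *\<^sub>v ?y + right_smult ?y (of_nat m)"
    proof -
      have lin: "H *\<^sub>v (H *\<^sub>v v + right_smult v (of_nat c)) = H *\<^sub>v (H *\<^sub>v v) + right_smult (H *\<^sub>v v) (of_nat c)" for c
        using v Hv by (simp only: mat_lin_simps[OF H_carrier] right_smult_carrier)
      have commute: "a + b * x + (b + c * x) * y = a + b * y + (b + c * y) * x" if "x * y = y * x"
        for a b c x y :: quat
        by (simp add: distrib_right mult.assoc that add_ac)
      have "of_nat m * of_nat (d - 1) = of_nat (d - 1) * (of_nat m :: quat)"
        by (rule mult_of_nat_commute)
      note commute[OF this]
      then show ?thesis
        unfolding lin
        by (intro eq_vecI) (use v in \<open>simp_all del: index_mult_mat_vec of_nat_diff\<close>)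
    qed
    moreover have "X ^\<^sub>m m *\<^sub>v (H *\<^sub>v ?y + right_smult ?y (of_nat m)) = 0\<^sub>v n"
      by (rule pow_X_affine_H_zero[OF Y_affine_H[OF v] Suc.prems(4)])
    ultimately have "X ^\<^sub>m m *\<^sub>v (H *\<^sub>v ?u + right_smult ?u (of_nat (d - 1))) = 0\<^sub>v n"
      by simp
    from Suc.IH[OF Y_affine_H[OF v] _ this] Suc.prems(3) have "frm w ?u = 0" by simp
    moreover have "int m \<noteq> int d - 1" using Suc.prems(3) by linarith
    ultimately show ?case by (rule cancel[OF v(1)])
  qed
  \<comment> \<open>Factors H + k are cancelled as long as k differs from d - 1; when k = d - 1 is
    reached, that factor acts as the scalar 0 and \<open>low\<close> takes over.\<close>
  have all: "frm w v = 0" if "v \<in> carrier_vec n" "Y *\<^sub>v v = 0\<^sub>v n" "X ^\<^sub>m k *\<^sub>v v = 0\<^sub>v n" for k v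
    using that
  proof (induction k arbitrary: v)
    case 0
    then have "v = 0\<^sub>v n" unfolding pow_mat_0_vec[OF X_carrier 0(1)] by blast
    then show ?case using sesquilinear_zero(1)[OF frm_sesquilinear w(1)] by simp
  next
    case (Suc k)
    note v = Suc.prems(1,2)
    note zero = pow_X_affine_H_zero[OF v Suc.prems(3)]
    show ?case
    proof (cases "k = d - 1")
      case True
      show ?thesis by (rule low[OF v, of "d - 1"]) (use zero True in simp_all)
    next
      case False
      then have "int k \<noteq> int d - 1" using d by linarith
      with Suc.IH[OF Y_affine_H[OF v] zero] show ?thesis by (rule cancel[OF v(1)])
    qed
  qed
  from nilpotent_X_vec[OF v(1)] obtain k where "X ^\<^sub>m k *\<^sub>v v = 0\<^sub>v n" .
  from all[OF v this] show ?thesis .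
qed

text \<open>Finite-dimensional duality for the skew operator Y. If w were outside im Y, a separating
  vector would be represented as \<open>frm\<close> against some u; u is orthogonal to im Y, so Y u
  = 0, and yet w pairs nontrivially with u.\<close>

lemma perp_ker_Y_range_Y:
  assumes w: "w \<in> carrier_vec n" and perp: "\<And>v. v \<in> carrier_vec n \<Longrightarrow> Y *\<^sub>v v = 0\<^sub>v n \<Longrightarrow> frm w v = 0"
  obtains a where "a \<in> carrier_vec n" "w = Y *\<^sub>v a"
proof (rule ccontr)
  assume "\<not> thesis"
  then have "w \<notin> {Y *\<^sub>v x | x. x \<in> carrier_vec n}" using that by blast
  from subspace_separation[OF range_subspace[OF Y_carrier] w this] obtain z
    where z: "z \<in> carrier_vec n" "\<forall>v\<in>{Y *\<^sub>v x | x. x \<in> carrier_vec n}. std_inner n z v = 0"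
      "std_inner n z w \<noteq> 0" .
  let ?u = "K *\<^sub>v z"
  note u = frm_surj(1)[OF z(1)]
  have "frm x (Y *\<^sub>v ?u) = 0" if x: "x \<in> carrier_vec n" for x
  proof -
    have Yx: "Y *\<^sub>v x \<in> carrier_vec n" using x by simp
    have "std_inner n z (Y *\<^sub>v x) = 0" using z(2) x by blast
    then have "std_inner n (Y *\<^sub>v x) z = 0"
      using std_inner_commute_zero[OF Yx z(1)] by blast
    then have "frm (Y *\<^sub>v x) ?u = 0" unfolding frm_surj(2)[OF z(1)] .
    then show ?thesis unfolding frm_Y[OF x u] by simp
  qed
  moreover have "Y *\<^sub>v ?u \<in> carrier_vec n" using u by simp
  ultimately have "Y *\<^sub>v ?u = 0\<^sub>v n" by (intro frm_nondegenerate)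
  from perp[OF u this] have "std_inner n w z = 0" unfolding frm_surj(2)[OF z(1)] .
  then have "std_inner n z w = 0" using std_inner_commute_zero[OF w z(1)] by blast
  with z(3) show False by blast
qed

lemma block_nondegenerate:
  assumes u: "u \<in> Ld d" and d: "d \<ge> 1" and 0: "\<And>v. v \<in> Ld d \<Longrightarrow> block d u v = 0"
  shows "u = 0\<^sub>v n"
proof -
  note uD = LdD[OF u]
  let ?w = "X ^\<^sub>m (d - 1) *\<^sub>v u"
  have w: "?w \<in> carrier_vec n" using uD(1) by simp
  have "1 - int d + 2 * int (d - 1) = int d - 1" using d by (simp add: of_nat_diff)
  then have Hw: "H *\<^sub>v ?w = right_smult ?w (of_int (int d - 1))"
    using H_pow_X[OF uD(1,3), of "d - 1"] by (simp only:)
  have "frm ?w v = 0" if v: "v \<in> Ld d" for v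
    using 0[OF v] unfolding block_def frm_pow_X[OF uD(1) LdD(1)[OF v]] by simp
  from frm_ker_Y[OF w Hw d this] have "frm ?w v = 0" if "v \<in> carrier_vec n" "Y *\<^sub>v v = 0\<^sub>v n" for v
    using that by blast
  from perp_ker_Y_range_Y[OF w this] obtain a where a: "a \<in> carrier_vec n" "?w = Y *\<^sub>v a" by blast
  have "X *\<^sub>v ?w = X ^\<^sub>m Suc (d - 1) *\<^sub>v u"
    by (rule pow_mat_Suc_vec(2)[OF X_carrier uD(1), symmetric])
  also have "\<dots> = 0\<^sub>v n"
    by (rule Ld_pow_X_zero[OF u]) (use d in simp)
  finally have "Y *\<^sub>v a = 0\<^sub>v n"
    using a(2) by (intro im_Y_inter_ker_X[OF a(1)]) simp
  then have "?w = 0\<^sub>v n" using a(2) by simp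
  then show ?thesis
    by (rule Ld_pow_X_inj[OF u]) (use d in simp)
qed

lemma lowest_strings_complete:
  assumes v: "v \<in> carrier_vec n"
    and perp: "\<And>d u l. d \<ge> 1 \<Longrightarrow> u \<in> Ld d \<Longrightarrow> frm (X ^\<^sub>m l *\<^sub>v u) v = 0"
  shows "v = 0\<^sub>v n"
proof (rule ccontr)
  assume nz: "v \<noteq> 0\<^sub>v n"
  define W where "W = {v \<in> carrier_vec n. \<forall>d\<ge>1. \<forall>u\<in>Ld d. \<forall>l. frm (X ^\<^sub>m l *\<^sub>v u) v = 0}"
  have Xu: "X ^\<^sub>m l *\<^sub>v u \<in> carrier_vec n" if "u \<in> Ld d" for l u d using LdD(1)[OF that] by simp
  have WI: "x \<in> W" if "x \<in> carrier_vec n"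
    "\<And>d u l. d \<ge> 1 \<Longrightarrow> u \<in> Ld d \<Longrightarrow> frm (X ^\<^sub>m l *\<^sub>v u) x = 0" for x
    using that unfolding W_def by blast
  have WD: "x \<in> carrier_vec n" "\<And>d u l. d \<ge> 1 \<Longrightarrow> u \<in> Ld d \<Longrightarrow> frm (X ^\<^sub>m l *\<^sub>v u) x = 0" if "x \<in> W" for x
    using that unfolding W_def by blast+
  have W: "is_subspace \<real> n W"
    unfolding is_subspace_def
  proof (intro conjI ballI)
    show "W \<subseteq> carrier_vec n" using WD(1) by blast
    show "0\<^sub>v n \<in> W"
      by (rule WI) (simp, rule sesquilinear_zero(1)[OF frm_sesquilinear Xu])
  next
    fix x y assume x: "x \<in> W" and y: "y \<in> W"
    show "x + y \<in> W"
    proof (rule WI)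
      show "x + y \<in> carrier_vec n" using WD(1)[OF x] WD(1)[OF y] by simp
      fix d u l assume d: "d \<ge> 1" and u: "u \<in> Ld d"
      show "frm (X ^\<^sub>m l *\<^sub>v u) (x + y) = 0"
        unfolding sesquilinearD(2)[OF frm_sesquilinear Xu[OF u] WD(1)[OF x] WD(1)[OF y]]
          WD(2)[OF x d u] WD(2)[OF y d u] by simp
    qed
  next
    fix x and a :: quat assume x: "x \<in> W"
    show "right_smult x a \<in> W"
    proof (rule WI)
      show "right_smult x a \<in> carrier_vec n" using WD(1)[OF x] by simp
      fix d u l assume d: "d \<ge> 1" and u: "u \<in> Ld d"
      show "frm (X ^\<^sub>m l *\<^sub>v u) (right_smult x a) = 0"
        unfolding sesquilinearD(4)[OF frm_sesquilinear Xu[OF u] WD(1)[OF x]] WD(2)[OF x d u] by simp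
    qed
  qed
  have "v \<in> W" using v perp by (rule WI)
  with nz have W0: "W \<noteq> {0\<^sub>v n}" by blast
  have WH: "H *\<^sub>v x \<in> W" if x: "x \<in> W" for x
  proof (rule WI)
    show "H *\<^sub>v x \<in> carrier_vec n" using WD(1)[OF x] by simp
    fix d u l assume d: "d \<ge> 1" and u: "u \<in> Ld d"
    have "frm (H *\<^sub>v (X ^\<^sub>m l *\<^sub>v u)) x = 0"
      unfolding H_pow_X[OF LdD(1,3)[OF u]] sesquilinearD(3)[OF frm_sesquilinear Xu[OF u] WD(1)[OF x]]
        WD(2)[OF x d u] by simp
    then show "frm (X ^\<^sub>m l *\<^sub>v u) (H *\<^sub>v x) = 0"
      unfolding frm_H[OF Xu[OF u] WD(1)[OF x]] by simp
  qed
  have WY: "Y *\<^sub>v x \<in> W" if x: "x \<in> W" for x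
  proof (rule WI)
    show "Y *\<^sub>v x \<in> carrier_vec n" using WD(1)[OF x] by simp
    fix d u l assume d: "d \<ge> 1" and u: "u \<in> Ld d"
    have "frm (Y *\<^sub>v (X ^\<^sub>m l *\<^sub>v u)) x = 0"
    proof (cases l)
      case 0
      show ?thesis
        unfolding 0 pow_mat_0_vec[OF X_carrier LdD(1)[OF u]] LdD(2)[OF u]
        by (rule sesquilinear_zero(2)[OF frm_sesquilinear WD(1)[OF x]])
    next
      case (Suc k)
      show ?thesis
        unfolding Suc Y_pow_X_weight[OF LdD[OF u]] sesquilinearD(3)[OF frm_sesquilinear Xu[OF u] WD(1)[OF x]]
          WD(2)[OF x d u] by simp
    qed
    then show "frm (X ^\<^sub>m l *\<^sub>v u) (Y *\<^sub>v x) = 0"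
      unfolding frm_Y[OF Xu[OF u] WD(1)[OF x]] by simp
  qed
  \<comment> \<open>Such an x is orthogonal to X^(d-1) u for every u in \<open>Ld d\<close>, so it
    lies in the radical of \<open>block d\<close>.\<close>
  from stable_subspace_lowest[OF W W0 WH WY] obtain d x
    where x: "d \<ge> 1" "x \<in> W" "x \<in> Ld d" "x \<noteq> 0\<^sub>v n" .
  have "block d x u = 0" if u: "u \<in> Ld d" for u
  proof -
    have "frm (X ^\<^sub>m (d - 1) *\<^sub>v u) x = 0" by (rule WD(2)[OF x(2,1) u])
    then have "block d u x = 0"
      unfolding frm_pow_X[OF LdD(1)[OF u] LdD(1)[OF x(3)]] block_def by simp
    with eps_hermitianD(4)[OF block_hermitian[OF x(1)] LdD(1)[OF u] LdD(1)[OF x(3)]] show ?thesis by blast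
  qed
  from block_nondegenerate[OF x(3,1) this] x(4) show False by blast
qed

end

section \<open>Coordinates adapted to the triple\<close>

lemma mult_mat_vec_assoc:
  fixes A C :: "quat mat"
  assumes "dim_col A = dim_row C" "dim_vec v = dim_col C"
  shows "(A * C) *\<^sub>v v = A *\<^sub>v (C *\<^sub>v v)"
  by (rule assoc_mult_mat_vec[of _ "dim_row A" "dim_row C" _ "dim_col C"])
     (use assms in \<open>auto intro!: carrier_matI carrier_vecI\<close>)

lemma mat_eq_vec:
  fixes A C :: "quat mat"
  assumes A: "A \<in> carrier_mat n m" and C: "C \<in> carrier_mat n m"
    and eq: "\<And>v. v \<in> carrier_vec m \<Longrightarrow> A *\<^sub>v v = C *\<^sub>v v"
  shows "A = C"
proof (rule mat_eq_std_inner[OF A C])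
  fix x y :: "quat vec" assume "x \<in> carrier_vec n" "y \<in> carrier_vec m"
  then show "std_inner n x (A *\<^sub>v y) = std_inner n x (C *\<^sub>v y)"
    by (simp only: eq)
qed

text \<open>The sum is formed entrywise in a stated dimension, because vectors of varying dimension
  have no common zero.\<close>

definition vec_sum :: "nat \<Rightarrow> 'i set \<Rightarrow> ('i \<Rightarrow> quat vec) \<Rightarrow> quat vec" where
  "vec_sum n I f = vec n (\<lambda>i. \<Sum>k\<in>I. f k $ i)"

lemma vec_sum_carrier [simp]: "vec_sum n I f \<in> carrier_vec n"
  and vec_sum_dim [simp]: "dim_vec (vec_sum n I f) = n"
  by (simp_all add: vec_sum_def)

lemma mat_vec_sum:
  fixes A :: "quat mat"
  assumes A: "A \<in> carrier_mat m n" and f: "\<forall>k\<in>I. f k \<in> carrier_vec n"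
  shows "A *\<^sub>v vec_sum n I f = vec_sum m I (\<lambda>k. A *\<^sub>v f k)"
proof (rule eq_vecI)
  fix i assume "i < dim_vec (vec_sum m I (\<lambda>k. A *\<^sub>v f k))"
  then have i: "i < m" by simp
  have "(A *\<^sub>v vec_sum n I f) $ i = (\<Sum>j<n. \<Sum>k\<in>I. A $$ (i, j) * f k $ j)"
    using i A by (simp add: scalar_prod_def vec_sum_def lessThan_atLeast0 sum_distrib_left)
  also have "\<dots> = (\<Sum>k\<in>I. \<Sum>j<n. A $$ (i, j) * f k $ j)"
    by (rule sum.swap)
  also have "\<dots> = (\<Sum>k\<in>I. (A *\<^sub>v f k) $ i)"
  proof (rule sum.cong)
    fix k assume "k \<in> I"
    from carrier_vecD[OF bspec[OF f this]] i A show "(\<Sum>j<n. A $$ (i, j) * f k $ j) = (A *\<^sub>v f k) $ i"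
      by (simp add: scalar_prod_def lessThan_atLeast0)
  qed simp
  finally show "(A *\<^sub>v vec_sum n I f) $ i = vec_sum m I (\<lambda>k. A *\<^sub>v f k) $ i"
    using i by (simp add: vec_sum_def)
qed (use A in simp)

lemma vec_sum_cong:
  "(\<And>k. k \<in> I \<Longrightarrow> f k = g k) \<Longrightarrow> vec_sum n I f = vec_sum n I g"
  by (simp add: vec_sum_def)

lemma vec_sum_single:
  assumes "finite I" "k \<in> I" "f k \<in> carrier_vec n" "\<And>j. j \<in> I \<Longrightarrow> j \<noteq> k \<Longrightarrow> f j = 0\<^sub>v n"
  shows "vec_sum n I f = f k"
proof (rule eq_vecI)
  fix i assume "i < dim_vec (f k)"
  then have i: "i < n" using assms(3) by simp
  have "(\<Sum>j\<in>I. f j $ i) = (\<Sum>j\<in>I. if j = k then f k $ i else 0)"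
    using assms(4) i by (intro sum.cong) auto
  then show "vec_sum n I f $ i = f k $ i"
    using i assms(1,2) by (simp add: vec_sum_def)
qed (use assms(3) in simp)

text \<open>The columns of \<open>E d\<close> are a basis of \<open>L(d - 1)\<close> with Gram matrix \<open>S d\<close>, for \<open>d\<close> in
  the set \<open>D\<close> of parts; \<open>R d\<close> is the inverse of \<open>S d\<close>.\<close>

locale skew_frame = skew_rep +
  fixes D :: "nat set" and T :: "nat \<Rightarrow> nat" and E S R :: "nat \<Rightarrow> quat mat"
  assumes finite_D: "finite D" and D_pos: "d \<in> D \<Longrightarrow> d \<ge> 1"
    and E_carrier [simp]: "d \<in> D \<Longrightarrow> E d \<in> carrier_mat n (T d)"
    and S_carrier [simp]: "d \<in> D \<Longrightarrow> S d \<in> carrier_mat (T d) (T d)"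
    and R_carrier [simp]: "d \<in> D \<Longrightarrow> R d \<in> carrier_mat (T d) (T d)"
    and SR: "d \<in> D \<Longrightarrow> S d * R d = 1\<^sub>m (T d)" and RS: "d \<in> D \<Longrightarrow> R d * S d = 1\<^sub>m (T d)"
    and E_Ld: "d \<in> D \<Longrightarrow> c \<in> carrier_vec (T d) \<Longrightarrow> E d *\<^sub>v c \<in> Ld d"
    and E_span: "d \<in> D \<Longrightarrow> v \<in> Ld d \<Longrightarrow> \<exists>c\<in>carrier_vec (T d). v = E d *\<^sub>v c"
    and Ld_outside: "d \<ge> 1 \<Longrightarrow> d \<notin> D \<Longrightarrow> Ld d = {0\<^sub>v n}"
    and E_gram: "d \<in> D \<Longrightarrow> x \<in> carrier_vec (T d) \<Longrightarrow> y \<in> carrier_vec (T d) \<Longrightarrow>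
      block d (E d *\<^sub>v x) (E d *\<^sub>v y) = std_inner (T d) x (S d *\<^sub>v y)"
begin

lemma frame_dims [simp]:
  assumes "d \<in> D"
  shows "dim_row (E d) = n" "dim_col (E d) = T d" "dim_row (S d) = T d" "dim_col (S d) = T d"
    "dim_row (R d) = T d" "dim_col (R d) = T d"
  using carrier_matD[OF E_carrier[OF assms]] carrier_matD[OF S_carrier[OF assms]]
    carrier_matD[OF R_carrier[OF assms]] by blast+

lemma JK_dims [simp]: "dim_row J = n" "dim_col J = n" "dim_row K = n" "dim_col K = n"
  using carrier_matD[OF J_carrier] carrier_matD[OF K_carrier] by blast+

text \<open>Coordinate columns of length \<open>T d\<close> are mapped onto X^l L(d - 1); for
  \<open>l < d\<close> these are the summands of the space.\<close>

definition Pm :: "nat \<Rightarrow> nat \<Rightarrow> quat mat" where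
  "Pm d l = X ^\<^sub>m l * E d"

text \<open>The form pairs \<open>X\<^sup>k L(d - 1)\<close> only with \<open>X\<^bsup>d - 1 - k\<^esup> L(d - 1)\<close>, so dividing
  by the Gram matrix \<open>S d\<close> yields the coordinates dual to \<open>Pm d l\<close>.\<close>

definition Fm :: "nat \<Rightarrow> nat \<Rightarrow> quat mat" where
  "Fm d l = R d * (adjoint_mat (E d) * (J * X ^\<^sub>m (d - 1 - l)))"

lemma Pm_carrier [simp]: "d \<in> D \<Longrightarrow> Pm d l \<in> carrier_mat n (T d)"
  unfolding Pm_def by (intro carrier_matI) simp_all

lemma Fm_carrier [simp]: "d \<in> D \<Longrightarrow> Fm d l \<in> carrier_mat (T d) n"
  unfolding Fm_def by (intro carrier_matI) simp_all

lemma Pm_vec: "d \<in> D \<Longrightarrow> c \<in> carrier_vec (T d) \<Longrightarrow> Pm d l *\<^sub>v c = X ^\<^sub>m l *\<^sub>v (E d *\<^sub>v c)"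
  unfolding Pm_def by (rule mult_mat_vec_assoc) simp_all

lemma Fm_vec: "d \<in> D \<Longrightarrow> v \<in> carrier_vec n \<Longrightarrow>
    Fm d l *\<^sub>v v = R d *\<^sub>v (adjoint_mat (E d) *\<^sub>v (J *\<^sub>v (X ^\<^sub>m (d - 1 - l) *\<^sub>v v)))"
  unfolding Fm_def by (simp add: mult_mat_vec_assoc)

lemma Pm_vec_carrier: "d \<in> D \<Longrightarrow> c \<in> carrier_vec (T d) \<Longrightarrow> Pm d l *\<^sub>v c \<in> carrier_vec n"
  by (rule mult_mat_vec_carrier[OF Pm_carrier])

lemma Fm_vec_carrier: "d \<in> D \<Longrightarrow> v \<in> carrier_vec n \<Longrightarrow> Fm d l *\<^sub>v v \<in> carrier_vec (T d)"
  by (rule mult_mat_vec_carrier[OF Fm_carrier])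

lemma E_adjoint_frm:
  assumes d: "d \<in> D" and x: "x \<in> carrier_vec (T d)" and v: "v \<in> carrier_vec n"
  shows "std_inner (T d) x (adjoint_mat (E d) *\<^sub>v (J *\<^sub>v v)) = frm (E d *\<^sub>v x) v"
proof -
  have Jv: "J *\<^sub>v v \<in> carrier_vec n" using v by simp
  show ?thesis
    unfolding frm_def std_inner_adjoint[OF adjoint_mat_carrier[OF E_carrier[OF d]] x Jv]
      adjoint_mat_adjoint ..
qed

lemma S_cancel:
  assumes d: "d \<in> D" and c: "c \<in> carrier_vec (T d)"
  shows "S d *\<^sub>v (R d *\<^sub>v c) = c" "R d *\<^sub>v (S d *\<^sub>v c) = c"
proof -
  show "S d *\<^sub>v (R d *\<^sub>v c) = c"
    unfolding assoc_mult_mat_vec[OF S_carrier[OF d] R_carrier[OF d] c, symmetric] SR[OF d]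
    using c by simp
  show "R d *\<^sub>v (S d *\<^sub>v c) = c"
    unfolding assoc_mult_mat_vec[OF R_carrier[OF d] S_carrier[OF d] c, symmetric] RS[OF d]
    using c by simp
qed

text \<open>Both powers of X combine to X^(d-1-l+k) between vectors of L(d - 1) and L(e - 1).
  \<open>Ld_frm_orthogonal\<close> leaves only d = e and l = k, where the pairing is the Gram matrix
  \<open>S d\<close>, cancelled by \<open>R d\<close>.\<close>

lemma Fm_Pm_vec:
  assumes d: "d \<in> D" and e: "e \<in> D" and l: "l < d" and k: "k < e" and c: "c \<in> carrier_vec (T e)"
  shows "Fm d l *\<^sub>v (Pm e k *\<^sub>v c) = (if d = e \<and> l = k then c else 0\<^sub>v (T d))"
proof -
  let ?m = "d - 1 - l + k" and ?u = "E e *\<^sub>v c"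
  have u: "?u \<in> Ld e" by (rule E_Ld[OF e c])
  note uc = LdD(1)[OF u]
  have Pc: "Pm e k *\<^sub>v c \<in> carrier_vec n" by (rule Pm_vec_carrier[OF e c])
  have Xu: "X ^\<^sub>m ?m *\<^sub>v ?u \<in> carrier_vec n" using uc by simp
  let ?g = "adjoint_mat (E d) *\<^sub>v (J *\<^sub>v (X ^\<^sub>m ?m *\<^sub>v ?u))"
  have Fc: "Fm d l *\<^sub>v (Pm e k *\<^sub>v c) = R d *\<^sub>v ?g"
    unfolding Fm_vec[OF d Pc] unfolding Pm_vec[OF e c] pow_mat_add_vec[OF X_carrier uc] ..
  have JXu: "J *\<^sub>v (X ^\<^sub>m ?m *\<^sub>v ?u) \<in> carrier_vec n" using Xu by simp
  have gc: "?g \<in> carrier_vec (T d)"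
    by (rule mult_mat_vec_carrier[OF adjoint_mat_carrier[OF E_carrier[OF d]] JXu])
  show ?thesis
  proof (cases "d = e \<and> ?m = d - 1")
    case True
    then have "l = k" using l by linarith
    have Sc: "S d *\<^sub>v c \<in> carrier_vec (T d)"
      using c True by (intro mult_mat_vec_carrier[OF S_carrier[OF d]]) simp
    have "?g = S d *\<^sub>v c"
    proof (rule std_inner_ext[OF gc Sc])
      fix x :: "quat vec" assume x: "x \<in> carrier_vec (T d)"
      have "std_inner (T d) x ?g = block d (E d *\<^sub>v x) (E d *\<^sub>v c)"
        unfolding E_adjoint_frm[OF d x Xu] unfolding block_def conjunct2[OF True]
        unfolding conjunct1[OF True] ..
      also have "\<dots> = std_inner (T d) x (S d *\<^sub>v c)"
        by (rule E_gram[OF d x]) (use c True in simp)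
      finally show "std_inner (T d) x ?g = std_inner (T d) x (S d *\<^sub>v c)" .
    qed
    moreover have "R d *\<^sub>v (S d *\<^sub>v c) = c"
      by (rule S_cancel(2)[OF d]) (use c True in simp)
    ultimately show ?thesis
      unfolding Fc using True \<open>l = k\<close> by simp
  next
    case False
    have "?g = 0\<^sub>v (T d)"
    proof (rule std_inner_ext[OF gc zero_carrier_vec])
      fix x :: "quat vec" assume x: "x \<in> carrier_vec (T d)"
      have "std_inner (T d) x ?g = 0"
        unfolding E_adjoint_frm[OF d x Xu]
        by (rule Ld_frm_orthogonal[OF E_Ld[OF d x] u D_pos[OF d] D_pos[OF e] False])
      also have "0 = std_inner (T d) x (0\<^sub>v (T d))"
        by (rule sesquilinear_zero(1)[OF eps_hermitianD(1)[OF std_inner_hermitian] x, symmetric])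
      finally show "std_inner (T d) x ?g = std_inner (T d) x (0\<^sub>v (T d))" .
    qed
    moreover have "\<not> (d = e \<and> l = k)" using False l by auto
    ultimately show ?thesis
      unfolding Fc using mat_vec_zero[OF R_carrier[OF d]] by (simp only: if_False)
  qed
qed

text \<open>\<open>lowest_strings_complete\<close> asks for all d \<ge> 1 and all exponents; outside
  \<open>D\<close> the space L(d - 1) is zero, and for l \<ge> d the power X^l kills it.\<close>

lemma strings_perp_zero:
  assumes w: "w \<in> carrier_vec n"
    and perp: "\<And>d l c. d \<in> D \<Longrightarrow> l < d \<Longrightarrow> c \<in> carrier_vec (T d) \<Longrightarrow> frm (Pm d l *\<^sub>v c) w = 0"
  shows "w = 0\<^sub>v n"
proof (rule lowest_strings_complete[OF w])
  fix d u l assume d: "d \<ge> 1" and u: "u \<in> Ld d"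
  note z = sesquilinear_zero(2)[OF frm_sesquilinear w]
  have Xl: "X ^\<^sub>m l \<in> carrier_mat n n" by simp
  show "frm (X ^\<^sub>m l *\<^sub>v u) w = 0"
  proof (cases "d \<in> D \<and> l < d")
    case True
    then obtain c where c: "c \<in> carrier_vec (T d)" "u = E d *\<^sub>v c"
      using E_span u by blast
    show ?thesis
      using perp[of d l c] True c(1) unfolding c(2) by (simp only: Pm_vec)
  next
    case False
    have "X ^\<^sub>m l *\<^sub>v u = 0\<^sub>v n"
    proof (cases "d \<in> D")
      case True
      with False show ?thesis by (intro Ld_pow_X_zero[OF u]) simp
    next
      case False
      with Ld_outside[OF d] u have "u = 0\<^sub>v n" by simp
      then show ?thesis using mat_vec_zero[OF Xl] by simp
    qed
    then show ?thesis using z by simp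
  qed
qed

lemma coordinates_zero:
  assumes w: "w \<in> carrier_vec n"
    and zero: "\<And>d l. d \<in> D \<Longrightarrow> l < d \<Longrightarrow> Fm d l *\<^sub>v w = 0\<^sub>v (T d)"
  shows "w = 0\<^sub>v n"
proof (rule strings_perp_zero[OF w])
  fix d l and c :: "quat vec" assume d: "d \<in> D" and l: "l < d" and c: "c \<in> carrier_vec (T d)"
  have uc: "E d *\<^sub>v c \<in> carrier_vec n" by (rule LdD(1)[OF E_Ld[OF d c]])
  let ?g = "adjoint_mat (E d) *\<^sub>v (J *\<^sub>v (X ^\<^sub>m l *\<^sub>v w))"
  have Xw: "X ^\<^sub>m l *\<^sub>v w \<in> carrier_vec n" using w by simp
  have JXw: "J *\<^sub>v (X ^\<^sub>m l *\<^sub>v w) \<in> carrier_vec n" using Xw by simp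
  have gc: "?g \<in> carrier_vec (T d)"
    by (rule mult_mat_vec_carrier[OF adjoint_mat_carrier[OF E_carrier[OF d]] JXw])
  \<comment> \<open>\<open>Fm d l\<close> contains the complementary power X^(d-1-l), so pairing
    with X^l requires the coordinate of index d - 1 - l.\<close>
  have "d - 1 - (d - 1 - l) = l" "d - 1 - l < d" using l by linarith+
  then have "R d *\<^sub>v ?g = 0\<^sub>v (T d)"
    using zero[OF d, of "d - 1 - l"] unfolding Fm_vec[OF d w] by simp
  then have "?g = 0\<^sub>v (T d)"
    using S_cancel(1)[OF d gc] mat_vec_zero[OF S_carrier[OF d]] by simp
  then have "frm (E d *\<^sub>v c) (X ^\<^sub>m l *\<^sub>v w) = 0"
    using E_adjoint_frm[OF d c Xw] sesquilinear_zero(1)[OF eps_hermitianD(1)[OF std_inner_hermitian] c]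
    by simp
  then show "frm (Pm d l *\<^sub>v c) w = 0"
    unfolding Pm_vec[OF d c] frm_pow_X[OF uc w] by simp
qed

definition index_set :: "(nat \<times> nat) set" where
  "index_set = Sigma D (\<lambda>d. {..<d})"

lemma index_set_iff: "(d, l) \<in> index_set \<longleftrightarrow> d \<in> D \<and> l < d"
  by (simp add: index_set_def)

lemma finite_index_set: "finite index_set"
  unfolding index_set_def using finite_D by simp

text \<open>By the duality \<open>Fm_Pm_vec\<close> both sides have the same coordinates, and a
  vector with zero coordinates is zero. This is the direct sum decomposition in coordinates.\<close>

lemma vec_expand:
  assumes v: "v \<in> carrier_vec n"
  shows "vec_sum n index_set (\<lambda>(d, l). Pm d l *\<^sub>v (Fm d l *\<^sub>v v)) = v" (is "?s = v")
proof (rule vec_minus_eq_0[OF _ vec_sum_carrier v], rule coordinates_zero)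
  show "?s - v \<in> carrier_vec n" using v by simp
  fix e k assume e: "e \<in> D" and k: "k < e"
  have Fv: "Fm e k *\<^sub>v v \<in> carrier_vec (T e)" by (rule Fm_vec_carrier[OF e v])
  have "Fm e k *\<^sub>v ?s = vec_sum (T e) index_set (\<lambda>i. Fm e k *\<^sub>v (case i of (d, l) \<Rightarrow> Pm d l *\<^sub>v (Fm d l *\<^sub>v v)))"
    by (rule mat_vec_sum[OF Fm_carrier[OF e]])
       (auto simp: index_set_iff intro!: Pm_vec_carrier Fm_vec_carrier v)
  also have "\<dots> = vec_sum (T e) index_set (\<lambda>i. if i = (e, k) then Fm e k *\<^sub>v v else 0\<^sub>v (T e))"
  proof (rule vec_sum_cong)
    fix i assume i: "i \<in> index_set"
    obtain d l where dl: "i = (d, l)" by (cases i)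
    with i have d: "d \<in> D" and l: "l < d" by (simp_all add: index_set_iff)
    show "Fm e k *\<^sub>v (case i of (d, l) \<Rightarrow> Pm d l *\<^sub>v (Fm d l *\<^sub>v v)) =
        (if i = (e, k) then Fm e k *\<^sub>v v else 0\<^sub>v (T e))"
      unfolding dl prod.case Fm_Pm_vec[OF e d k l Fm_vec_carrier[OF d v]] by auto
  qed
  also have "\<dots> = Fm e k *\<^sub>v v"
    using e k Fv by (subst vec_sum_single[OF finite_index_set, of "(e, k)"]) (simp_all add: index_set_iff)
  finally have eq: "Fm e k *\<^sub>v ?s = Fm e k *\<^sub>v v" .
  show "Fm e k *\<^sub>v (?s - v) = 0\<^sub>v (T e)"
    unfolding mult_minus_distrib_mat_vec[OF Fm_carrier[OF e] vec_sum_carrier v] eq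
    by (rule minus_cancel_vec[OF Fv])
qed

text \<open>The strings span by \<open>vec_expand\<close>. Matrix identities for the glued operators
  are checked this way.\<close>

lemma mat_eq_on_strings:
  assumes A: "A \<in> carrier_mat n n" and C: "C \<in> carrier_mat n n"
    and eq: "\<And>d l c. d \<in> D \<Longrightarrow> l < d \<Longrightarrow> c \<in> carrier_vec (T d) \<Longrightarrow>
      A *\<^sub>v (Pm d l *\<^sub>v c) = C *\<^sub>v (Pm d l *\<^sub>v c)"
  shows "A = C"
proof (rule mat_eq_vec[OF A C])
  fix v :: "quat vec" assume v: "v \<in> carrier_vec n"
  let ?f = "\<lambda>(d, l). Pm d l *\<^sub>v (Fm d l *\<^sub>v v)"
  have f: "\<forall>i\<in>index_set. ?f i \<in> carrier_vec n"
    by (auto simp: index_set_iff intro!: Pm_vec_carrier Fm_vec_carrier v)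
  have "A *\<^sub>v vec_sum n index_set ?f = C *\<^sub>v vec_sum n index_set ?f"
    unfolding mat_vec_sum[OF A f] mat_vec_sum[OF C f]
    by (rule vec_sum_cong) (auto simp: index_set_iff intro!: eq Fm_vec_carrier v)
  then show "A *\<^sub>v v = C *\<^sub>v v" unfolding vec_expand[OF v] .
qed

section \<open>Restriction to and extension from the lowest weight spaces\<close>

definition centralizer :: "quat mat set" where
  "centralizer = {g \<in> carrier_mat n n. adjoint_mat g * J * g = J \<and>
     g * X = X * g \<and> g * H = H * g \<and> g * Y = Y * g}"

definition block_group :: "nat \<Rightarrow> quat mat set" where
  "block_group d = {h \<in> carrier_mat (T d) (T d). adjoint_mat h * S d * h = S d}"

text \<open>The matrix of g restricted to L(d - 1) in the basis \<open>E d\<close>, with coordinates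
  read off by \<open>Fm d 0\<close>.\<close>

definition phi :: "nat \<Rightarrow> quat mat \<Rightarrow> quat mat" where
  "phi d g = Fm d 0 * (g * E d)"

text \<open>The operator acting as \<open>h d\<close> on each X^l L(d - 1). It is written by
  entries, the form in which its continuity in \<open>h\<close> is checked later.\<close>

definition psi :: "(nat \<Rightarrow> quat mat) \<Rightarrow> quat mat" where
  "psi h = mat n n (\<lambda>(i, j). \<Sum>(d, l)\<in>index_set. (Pm d l * (h d * Fm d l)) $$ (i, j))"

lemma commute_vec:
  assumes "g \<in> carrier_mat n n" "A \<in> carrier_mat n n" "g * A = A * g" "v \<in> carrier_vec n"
  shows "g *\<^sub>v (A *\<^sub>v v) = A *\<^sub>v (g *\<^sub>v (v :: quat vec))"
  unfolding assoc_mult_mat_vec[OF assms(1,2,4), symmetric] assoc_mult_mat_vec[OF assms(2,1,4), symmetric]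
    assms(3) ..

lemma centralizerD:
  assumes "g \<in> centralizer"
  shows "g \<in> carrier_mat n n" "adjoint_mat g * J * g = J"
    "v \<in> carrier_vec n \<Longrightarrow> g *\<^sub>v (X *\<^sub>v v) = X *\<^sub>v (g *\<^sub>v v)"
    "v \<in> carrier_vec n \<Longrightarrow> g *\<^sub>v (H *\<^sub>v v) = H *\<^sub>v (g *\<^sub>v v)"
    "v \<in> carrier_vec n \<Longrightarrow> g *\<^sub>v (Y *\<^sub>v v) = Y *\<^sub>v (g *\<^sub>v v)"
  using assms unfolding centralizer_def by (simp_all add: commute_vec)

lemma centralizer_pow_X:
  assumes g: "g \<in> centralizer" and v: "v \<in> carrier_vec n"
  shows "g *\<^sub>v (X ^\<^sub>m k *\<^sub>v v) = X ^\<^sub>m k *\<^sub>v (g *\<^sub>v v)"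
proof (induction k)
  case 0
  have "g *\<^sub>v v \<in> carrier_vec n" using centralizerD(1)[OF g] v by simp
  with v show ?case by (simp only: pow_mat_0_vec[OF X_carrier])
next
  case (Suc k)
  have c: "g *\<^sub>v v \<in> carrier_vec n" "X ^\<^sub>m k *\<^sub>v v \<in> carrier_vec n" using centralizerD(1)[OF g] v by simp_all
  show ?case
    unfolding pow_mat_Suc_vec(2)[OF X_carrier v] pow_mat_Suc_vec(2)[OF X_carrier c(1)]
      centralizerD(3)[OF g c(2)] Suc ..
qed

lemma centralizer_Ld:
  assumes g: "g \<in> centralizer" and u: "u \<in> Ld d"
  shows "g *\<^sub>v u \<in> Ld d"
proof -
  note uD = LdD[OF u] and gD = centralizerD[OF g]
  have "Y *\<^sub>v (g *\<^sub>v u) = 0\<^sub>v n"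
    unfolding gD(5)[OF uD(1), symmetric] uD(2) by (rule mat_vec_zero[OF gD(1)])
  moreover have "H *\<^sub>v (g *\<^sub>v u) = right_smult (g *\<^sub>v u) (of_int (1 - int d))"
    unfolding gD(4)[OF uD(1), symmetric] uD(3) by (rule mat_lin_simps(3)[OF gD(1) uD(1) uD(1)])
  moreover have "g *\<^sub>v u \<in> carrier_vec n" using gD(1) uD(1) by simp
  ultimately show ?thesis unfolding Ld_def by blast
qed

lemma phi_carrier [simp]: "d \<in> D \<Longrightarrow> g \<in> carrier_mat n n \<Longrightarrow> phi d g \<in> carrier_mat (T d) (T d)"
  unfolding phi_def by (rule mult_carrier_mat[OF Fm_carrier mult_carrier_mat[OF _ E_carrier]])

lemma Pm_0_vec: "d \<in> D \<Longrightarrow> c \<in> carrier_vec (T d) \<Longrightarrow> Pm d 0 *\<^sub>v c = E d *\<^sub>v c"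
  using pow_mat_0_vec[OF X_carrier LdD(1)[OF E_Ld]] by (simp only: Pm_vec)

lemma Fm_E_vec: "d \<in> D \<Longrightarrow> c \<in> carrier_vec (T d) \<Longrightarrow> Fm d 0 *\<^sub>v (E d *\<^sub>v c) = c"
  using Fm_Pm_vec[of d d 0 0 c] D_pos[of d] by (simp add: Pm_0_vec)

lemma phi_vec:
  assumes d: "d \<in> D" and g: "g \<in> carrier_mat n n" and c: "c \<in> carrier_vec (T d)"
  shows "phi d g *\<^sub>v c = Fm d 0 *\<^sub>v (g *\<^sub>v (E d *\<^sub>v c))"
proof -
  have "phi d g *\<^sub>v c = Fm d 0 *\<^sub>v ((g * E d) *\<^sub>v c)"
    unfolding phi_def
    by (rule assoc_mult_mat_vec[OF Fm_carrier[OF d] mult_carrier_mat[OF g E_carrier[OF d]] c])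
  then show ?thesis unfolding assoc_mult_mat_vec[OF g E_carrier[OF d] c] .
qed

text \<open>g keeps L(d - 1) invariant, so reading off coordinates with \<open>Fm d 0\<close> and
  reassembling with \<open>E d\<close> loses nothing.\<close>

lemma E_phi:
  assumes d: "d \<in> D" and g: "g \<in> centralizer" and c: "c \<in> carrier_vec (T d)"
  shows "E d *\<^sub>v (phi d g *\<^sub>v c) = g *\<^sub>v (E d *\<^sub>v c)"
proof -
  obtain c' where c': "c' \<in> carrier_vec (T d)" "g *\<^sub>v (E d *\<^sub>v c) = E d *\<^sub>v c'"
    using E_span[OF d centralizer_Ld[OF g E_Ld[OF d c]]] by blast
  show ?thesis
    unfolding phi_vec[OF d centralizerD(1)[OF g] c] c'(2) Fm_E_vec[OF d c'(1)] ..
qed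

lemma phi_mult:
  assumes d: "d \<in> D" and g: "g \<in> carrier_mat n n" and h: "h \<in> centralizer"
  shows "phi d (g * h) = phi d g * phi d h"
proof (rule mat_eq_vec)
  note hc = centralizerD(1)[OF h]
  show "phi d (g * h) \<in> carrier_mat (T d) (T d)" using d g hc by simp
  show "phi d g * phi d h \<in> carrier_mat (T d) (T d)"
    by (rule mult_carrier_mat[OF phi_carrier[OF d g] phi_carrier[OF d hc]])
  fix c :: "quat vec" assume c: "c \<in> carrier_vec (T d)"
  have pc: "phi d h *\<^sub>v c \<in> carrier_vec (T d)"
    by (rule mult_mat_vec_carrier[OF phi_carrier[OF d hc] c])
  have Ec: "E d *\<^sub>v c \<in> carrier_vec n" by (rule LdD(1)[OF E_Ld[OF d c]])
  show "phi d (g * h) *\<^sub>v c = (phi d g * phi d h) *\<^sub>v c"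
    unfolding phi_vec[OF d mult_carrier_mat[OF g hc] c] assoc_mult_mat_vec[OF g hc Ec]
      assoc_mult_mat_vec[OF phi_carrier[OF d g] phi_carrier[OF d hc] c] phi_vec[OF d g pc] E_phi[OF d h c] ..
qed

lemma phi_block_group:
  assumes d: "d \<in> D" and g: "g \<in> centralizer"
  shows "phi d g \<in> block_group d"
proof -
  note gD = centralizerD[OF g]
  note pc = phi_carrier[OF d gD(1)]
  have iso: "\<forall>x\<in>carrier_vec n. \<forall>y\<in>carrier_vec n. frm (g *\<^sub>v x) (g *\<^sub>v y) = frm x y"
    using std_inner_isometry_iff[OF J_carrier gD(1)] gD(2) unfolding frm_def by blast
  have "\<forall>x\<in>carrier_vec (T d). \<forall>y\<in>carrier_vec (T d).
      std_inner (T d) (phi d g *\<^sub>v x) (S d *\<^sub>v (phi d g *\<^sub>v y)) = std_inner (T d) x (S d *\<^sub>v y)"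
  proof (intro ballI)
    fix x y :: "quat vec" assume x: "x \<in> carrier_vec (T d)" and y: "y \<in> carrier_vec (T d)"
    have px: "phi d g *\<^sub>v x \<in> carrier_vec (T d)" and py: "phi d g *\<^sub>v y \<in> carrier_vec (T d)"
      by (rule mult_mat_vec_carrier[OF pc x], rule mult_mat_vec_carrier[OF pc y])
    have Ex: "E d *\<^sub>v x \<in> carrier_vec n" and Ey: "E d *\<^sub>v y \<in> carrier_vec n"
      by (rule LdD(1)[OF E_Ld[OF d x]], rule LdD(1)[OF E_Ld[OF d y]])
    have XEy: "X ^\<^sub>m (d - 1) *\<^sub>v (E d *\<^sub>v y) \<in> carrier_vec n" using Ey by simp
    have "std_inner (T d) (phi d g *\<^sub>v x) (S d *\<^sub>v (phi d g *\<^sub>v y)) =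
        frm (g *\<^sub>v (E d *\<^sub>v x)) (g *\<^sub>v (X ^\<^sub>m (d - 1) *\<^sub>v (E d *\<^sub>v y)))"
      unfolding E_gram[OF d px py, symmetric] E_phi[OF d g x] E_phi[OF d g y] block_def
        centralizer_pow_X[OF g Ey] ..
    also have "\<dots> = block d (E d *\<^sub>v x) (E d *\<^sub>v y)"
      using iso Ex XEy unfolding block_def by blast
    finally show "std_inner (T d) (phi d g *\<^sub>v x) (S d *\<^sub>v (phi d g *\<^sub>v y)) = std_inner (T d) x (S d *\<^sub>v y)"
      unfolding E_gram[OF d x y] .
  qed
  then have "adjoint_mat (phi d g) * S d * phi d g = S d"
    using std_inner_isometry_iff[OF S_carrier[OF d] pc] by blast
  with pc show ?thesis unfolding block_group_def by blast
qed

lemma psi_carrier [simp]: "psi h \<in> carrier_mat n n"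
  by (simp add: psi_def)

lemma psi_vec:
  assumes h0: "\<forall>d\<in>D. h d \<in> carrier_mat (T d) (T d)" and v: "v \<in> carrier_vec n"
  shows "psi h *\<^sub>v v = vec_sum n index_set (\<lambda>(d, l). Pm d l *\<^sub>v (h d *\<^sub>v (Fm d l *\<^sub>v v)))"
proof (rule eq_vecI)
  note h = bspec[OF h0]
  fix i assume "i < dim_vec (vec_sum n index_set (\<lambda>(d, l). Pm d l *\<^sub>v (h d *\<^sub>v (Fm d l *\<^sub>v v))))"
  then have i: "i < n" by simp
  have "(psi h *\<^sub>v v) $ i =
      (\<Sum>j<n. \<Sum>k\<in>index_set. (case k of (d, l) \<Rightarrow> (Pm d l * (h d * Fm d l)) $$ (i, j)) * v $ j)"
    using i v by (simp add: scalar_prod_def psi_def lessThan_atLeast0 sum_distrib_right)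
  also have "\<dots> = (\<Sum>k\<in>index_set. \<Sum>j<n. (case k of (d, l) \<Rightarrow> (Pm d l * (h d * Fm d l)) $$ (i, j)) * v $ j)"
    by (rule sum.swap)
  also have "\<dots> = (\<Sum>k\<in>index_set. (case k of (d, l) \<Rightarrow> Pm d l *\<^sub>v (h d *\<^sub>v (Fm d l *\<^sub>v v))) $ i)"
  proof (rule sum.cong)
    fix k assume k: "k \<in> index_set"
    obtain d l where dl: "k = (d, l)" by (cases k)
    with k have d: "d \<in> D" by (simp add: index_set_iff)
    let ?M = "Pm d l * (h d * Fm d l)"
    note hF = mult_carrier_mat[OF h[OF d] Fm_carrier[OF d, of l]]
    note M = mult_carrier_mat[OF Pm_carrier[OF d, of l] hF]
    have "?M *\<^sub>v v = Pm d l *\<^sub>v (h d *\<^sub>v (Fm d l *\<^sub>v v))"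
      unfolding assoc_mult_mat_vec[OF Pm_carrier[OF d] hF v]
        assoc_mult_mat_vec[OF h[OF d] Fm_carrier[OF d] v] ..
    moreover have "(?M *\<^sub>v v) $ i = (\<Sum>j<n. ?M $$ (i, j) * v $ j)"
      using carrier_matD[OF M] i v
      by (simp add: scalar_prod_def lessThan_atLeast0 del: index_mult_mat(1))
    ultimately show "(\<Sum>j<n. (case k of (d, l) \<Rightarrow> (Pm d l * (h d * Fm d l)) $$ (i, j)) * v $ j) =
        (case k of (d, l) \<Rightarrow> Pm d l *\<^sub>v (h d *\<^sub>v (Fm d l *\<^sub>v v))) $ i"
      unfolding dl prod.case by simp
  qed simp
  finally show "(psi h *\<^sub>v v) $ i =
      vec_sum n index_set (\<lambda>(d, l). Pm d l *\<^sub>v (h d *\<^sub>v (Fm d l *\<^sub>v v))) $ i"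
    using i by (simp add: vec_sum_def)
qed (simp add: psi_def)

lemma psi_Pm:
  assumes h0: "\<forall>d\<in>D. h d \<in> carrier_mat (T d) (T d)"
    and d: "d \<in> D" and l: "l < d" and c: "c \<in> carrier_vec (T d)"
  shows "psi h *\<^sub>v (Pm d l *\<^sub>v c) = Pm d l *\<^sub>v (h d *\<^sub>v c)"
proof -
  note h = bspec[OF h0]
  have hc: "h d *\<^sub>v c \<in> carrier_vec (T d)" by (rule mult_mat_vec_carrier[OF h[OF d] c])
  have "psi h *\<^sub>v (Pm d l *\<^sub>v c) =
      vec_sum n index_set (\<lambda>i. if i = (d, l) then Pm d l *\<^sub>v (h d *\<^sub>v c) else 0\<^sub>v n)"
    unfolding psi_vec[OF h0 Pm_vec_carrier[OF d c]]
  proof (rule vec_sum_cong)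
    fix i assume i: "i \<in> index_set"
    obtain e k where ek: "i = (e, k)" by (cases i)
    with i have e: "e \<in> D" and k: "k < e" by (simp_all add: index_set_iff)
    have z: "Pm e k *\<^sub>v (h e *\<^sub>v 0\<^sub>v (T e)) = 0\<^sub>v n"
      unfolding mat_vec_zero[OF h[OF e]] by (rule mat_vec_zero[OF Pm_carrier[OF e]])
    show "(case i of (e, k) \<Rightarrow> Pm e k *\<^sub>v (h e *\<^sub>v (Fm e k *\<^sub>v (Pm d l *\<^sub>v c)))) =
        (if i = (d, l) then Pm d l *\<^sub>v (h d *\<^sub>v c) else 0\<^sub>v n)"
      unfolding ek prod.case Fm_Pm_vec[OF e d k l c] using z by auto
  qed
  also have "\<dots> = Pm d l *\<^sub>v (h d *\<^sub>v c)"
    using d l Pm_vec_carrier[OF d hc]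
    by (subst vec_sum_single[OF finite_index_set, of "(d, l)"]) (simp_all add: index_set_iff)
  finally show ?thesis .
qed

lemma phi_psi:
  assumes h0: "\<forall>d\<in>D. h d \<in> carrier_mat (T d) (T d)" and d: "d \<in> D"
  shows "phi d (psi h) = h d"
proof (rule mat_eq_vec[OF phi_carrier[OF d psi_carrier] bspec[OF h0 d]])
  note h = bspec[OF h0]
  fix c :: "quat vec" assume c: "c \<in> carrier_vec (T d)"
  have d0: "0 < d" using D_pos[OF d] by simp
  have hc: "h d *\<^sub>v c \<in> carrier_vec (T d)" by (rule mult_mat_vec_carrier[OF h[OF d] c])
  show "phi d (psi h) *\<^sub>v c = h d *\<^sub>v c"
    unfolding phi_vec[OF d psi_carrier c] Pm_0_vec[OF d c, symmetric] psi_Pm[OF h0 d d0 c]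
      Pm_0_vec[OF d hc] by (rule Fm_E_vec[OF d hc])
qed

lemma psi_phi:
  assumes g: "g \<in> centralizer" and h: "\<forall>d\<in>D. h d = phi d g"
  shows "psi h = g"
proof (rule mat_eq_on_strings[OF psi_carrier centralizerD(1)[OF g]])
  have hc: "\<forall>d\<in>D. h d \<in> carrier_mat (T d) (T d)"
    using h phi_carrier[OF _ centralizerD(1)[OF g]] by simp
  fix d l and c :: "quat vec" assume d: "d \<in> D" and l: "l < d" and c: "c \<in> carrier_vec (T d)"
  have pc: "phi d g *\<^sub>v c \<in> carrier_vec (T d)"
    by (rule mult_mat_vec_carrier[OF phi_carrier[OF d centralizerD(1)[OF g]] c])
  show "psi h *\<^sub>v (Pm d l *\<^sub>v c) = g *\<^sub>v (Pm d l *\<^sub>v c)"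
    unfolding psi_Pm[OF hc d l c] bspec[OF h d] unfolding Pm_vec[OF d pc] Pm_vec[OF d c] E_phi[OF d g c]
      centralizer_pow_X[OF g LdD(1)[OF E_Ld[OF d c]]] ..
qed

lemma block_group_carrier: "h \<in> block_group d \<Longrightarrow> h \<in> carrier_mat (T d) (T d)"
  by (simp add: block_group_def)

text \<open>X, H and Y only shift the exponent l and multiply by central integers, with no
  dependence on the coordinate column; \<open>psi h\<close> acts only on that column.\<close>

lemma psi_commute:
  assumes h0: "\<forall>d\<in>D. h d \<in> carrier_mat (T d) (T d)"
  shows "psi h * X = X * psi h" "psi h * H = H * psi h" "psi h * Y = Y * psi h"
proof -
  note h = bspec[OF h0]
  have eq: "psi h * A = A * psi h"
    if A: "A \<in> carrier_mat n n"
      and AP: "\<And>d l c. d \<in> D \<Longrightarrow> l < d \<Longrightarrow> c \<in> carrier_vec (T d) \<Longrightarrow>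
        psi h *\<^sub>v (A *\<^sub>v (Pm d l *\<^sub>v c)) = A *\<^sub>v (Pm d l *\<^sub>v (h d *\<^sub>v c))" for A
  proof (rule mat_eq_on_strings)
    show "psi h * A \<in> carrier_mat n n" "A * psi h \<in> carrier_mat n n"
      by (rule mult_carrier_mat[OF psi_carrier A], rule mult_carrier_mat[OF A psi_carrier])
    fix d l and c :: "quat vec" assume d: "d \<in> D" and l: "l < d" and c: "c \<in> carrier_vec (T d)"
    note P = Pm_vec_carrier[OF d c, of l]
    show "(psi h * A) *\<^sub>v (Pm d l *\<^sub>v c) = (A * psi h) *\<^sub>v (Pm d l *\<^sub>v c)"
      unfolding assoc_mult_mat_vec[OF psi_carrier A P] assoc_mult_mat_vec[OF A psi_carrier P]
        AP[OF d l c] psi_Pm[OF h0 d l c] ..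
  qed
  have hc: "h d *\<^sub>v c \<in> carrier_vec (T d)" if "d \<in> D" "c \<in> carrier_vec (T d)" for d c
    by (rule mult_mat_vec_carrier[OF h[OF that(1)] that(2)])
  show "psi h * X = X * psi h"
  proof (rule eq[OF X_carrier])
    fix d l and c :: "quat vec" assume d: "d \<in> D" and l: "l < d" and c: "c \<in> carrier_vec (T d)"
    have XP: "X *\<^sub>v (Pm d l *\<^sub>v c) = (if Suc l < d then Pm d (Suc l) *\<^sub>v c else 0\<^sub>v n)"
      if c: "c \<in> carrier_vec (T d)" for c
    proof -
      note u = E_Ld[OF d c]
      have "X *\<^sub>v (Pm d l *\<^sub>v c) = X ^\<^sub>m Suc l *\<^sub>v (E d *\<^sub>v c)"
        unfolding Pm_vec[OF d c] by (rule pow_mat_Suc_vec(2)[OF X_carrier LdD(1)[OF u], symmetric])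
      then show ?thesis
        unfolding Pm_vec[OF d c] using Ld_pow_X_zero[OF u, of "Suc l"] by (auto simp del: pow_mat.simps)
    qed
    show "psi h *\<^sub>v (X *\<^sub>v (Pm d l *\<^sub>v c)) = X *\<^sub>v (Pm d l *\<^sub>v (h d *\<^sub>v c))"
      unfolding XP[OF c] XP[OF hc[OF d c]] using psi_Pm[OF h0 d _ c] mat_vec_zero[OF psi_carrier] by simp
  qed
  show "psi h * H = H * psi h"
  proof (rule eq[OF H_carrier])
    fix d l and c :: "quat vec" assume d: "d \<in> D" and l: "l < d" and c: "c \<in> carrier_vec (T d)"
    have HP: "H *\<^sub>v (Pm d l *\<^sub>v c) = right_smult (Pm d l *\<^sub>v c) (of_int (1 - int d + 2 * int l))"
      if c: "c \<in> carrier_vec (T d)" for c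
      unfolding Pm_vec[OF d c] using E_Ld[OF d c] by (intro H_pow_X LdD)
    show "psi h *\<^sub>v (H *\<^sub>v (Pm d l *\<^sub>v c)) = H *\<^sub>v (Pm d l *\<^sub>v (h d *\<^sub>v c))"
      unfolding HP[OF c] HP[OF hc[OF d c]] unfolding psi_Pm[OF h0 d l c, symmetric]
      by (rule mat_lin_simps(3)[OF psi_carrier Pm_vec_carrier[OF d c] Pm_vec_carrier[OF d c]])
  qed
  show "psi h * Y = Y * psi h"
  proof (rule eq[OF Y_carrier])
    fix d l and c :: "quat vec" assume d: "d \<in> D" and l: "l < d" and c: "c \<in> carrier_vec (T d)"
    show "psi h *\<^sub>v (Y *\<^sub>v (Pm d l *\<^sub>v c)) = Y *\<^sub>v (Pm d l *\<^sub>v (h d *\<^sub>v c))"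
    proof (cases l)
      case 0
      have YP: "Y *\<^sub>v (Pm d l *\<^sub>v c) = 0\<^sub>v n" if c: "c \<in> carrier_vec (T d)" for c
        unfolding 0 Pm_0_vec[OF d c] by (rule LdD(2)[OF E_Ld[OF d c]])
      show ?thesis
        unfolding YP[OF c] YP[OF hc[OF d c]] by (rule mat_vec_zero[OF psi_carrier])
    next
      case (Suc k)
      have kd: "k < d" using Suc l by simp
      have YP: "Y *\<^sub>v (Pm d l *\<^sub>v c) =
          right_smult (Pm d k *\<^sub>v c) (of_int (- (int (Suc k) * (1 - int d + int k))))"
        if c: "c \<in> carrier_vec (T d)" for c
        unfolding Suc Pm_vec[OF d c] using E_Ld[OF d c] by (intro Y_pow_X_weight LdD)
      show ?thesis
        unfolding YP[OF c] YP[OF hc[OF d c]] unfolding psi_Pm[OF h0 d kd c, symmetric]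
        by (rule mat_lin_simps(3)[OF psi_carrier Pm_vec_carrier[OF d c] Pm_vec_carrier[OF d c]])
    qed
  qed
qed

lemma frm_Pm:
  assumes d: "d \<in> D" and e: "e \<in> D" and x: "x \<in> carrier_vec (T d)" and y: "y \<in> carrier_vec (T e)"
  shows "frm (Pm d l *\<^sub>v x) (Pm e k *\<^sub>v y) =
    (if d = e \<and> l + k = d - 1 then (- 1) ^ l * std_inner (T d) x (S d *\<^sub>v y) else 0)"
proof -
  note u = E_Ld[OF d x] and v = E_Ld[OF e y]
  have Xv: "X ^\<^sub>m k *\<^sub>v (E e *\<^sub>v y) \<in> carrier_vec n" using LdD(1)[OF v] by simp
  have eq: "frm (Pm d l *\<^sub>v x) (Pm e k *\<^sub>v y) = (- 1) ^ l * frm (E d *\<^sub>v x) (X ^\<^sub>m (l + k) *\<^sub>v (E e *\<^sub>v y))"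
    unfolding Pm_vec[OF d x] Pm_vec[OF e y] frm_pow_X[OF LdD(1)[OF u] Xv]
      pow_mat_add_vec[OF X_carrier LdD(1)[OF v]] ..
  show ?thesis
  proof (cases "d = e \<and> l + k = d - 1")
    case True
    then have y': "y \<in> carrier_vec (T d)" using y by simp
    show ?thesis
      unfolding eq using True E_gram[OF d x y'] unfolding block_def by simp
  next
    case False
    show ?thesis
      unfolding eq Ld_frm_orthogonal[OF u v D_pos[OF d] D_pos[OF e] False] if_not_P[OF False] by simp
  qed
qed

text \<open>On a string vector the two sides of the equation are vectors a and b with the same inner
  products against all strings. Passing to K (a - b) turns these inner products into values of
  \<open>frm\<close>, so that \<open>strings_perp_zero\<close> applies; J then returns a =
  b.\<close>

lemma psi_isometry:
  assumes h0: "\<forall>d\<in>D. h d \<in> block_group d"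
  shows "adjoint_mat (psi h) * J * psi h = J"
proof (rule mat_eq_on_strings)
  note h = bspec[OF h0]
  have hc0: "\<forall>d\<in>D. h d \<in> carrier_mat (T d) (T d)"
    using h block_group_carrier by blast
  note hc = bspec[OF hc0]
  let ?g = "psi h"
  have ag: "adjoint_mat ?g \<in> carrier_mat n n" by simp
  have agJ: "adjoint_mat ?g * J \<in> carrier_mat n n" by (rule mult_carrier_mat[OF ag J_carrier])
  show M: "adjoint_mat ?g * J * ?g \<in> carrier_mat n n" by (rule mult_carrier_mat[OF agJ psi_carrier])
  show "J \<in> carrier_mat n n" by simp
  fix e k and y :: "quat vec" assume e: "e \<in> D" and k: "k < e" and y: "y \<in> carrier_vec (T e)"
  let ?p = "Pm e k *\<^sub>v y"
  have p: "?p \<in> carrier_vec n" by (rule Pm_vec_carrier[OF e y])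
  have hy: "h e *\<^sub>v y \<in> carrier_vec (T e)" by (rule mult_mat_vec_carrier[OF hc[OF e] y])
  have Mp: "(adjoint_mat ?g * J * ?g) *\<^sub>v ?p = adjoint_mat ?g *\<^sub>v (J *\<^sub>v (Pm e k *\<^sub>v (h e *\<^sub>v y)))"
    unfolding assoc_mult_mat_vec[OF agJ psi_carrier p] psi_Pm[OF hc0 e k y]
    by (rule assoc_mult_mat_vec[OF ag J_carrier Pm_vec_carrier[OF e hy]])
  let ?a = "adjoint_mat ?g *\<^sub>v (J *\<^sub>v (Pm e k *\<^sub>v (h e *\<^sub>v y)))" and ?b = "J *\<^sub>v ?p"
  have Jph: "J *\<^sub>v (Pm e k *\<^sub>v (h e *\<^sub>v y)) \<in> carrier_vec n"
    by (rule mult_mat_vec_carrier[OF J_carrier Pm_vec_carrier[OF e hy]])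
  have a: "?a \<in> carrier_vec n" by (rule mult_mat_vec_carrier[OF ag Jph])
  have b: "?b \<in> carrier_vec n" by (rule mult_mat_vec_carrier[OF J_carrier p])
  have ab: "?a - ?b \<in> carrier_vec n" using a b by simp
  have "K *\<^sub>v (?a - ?b) = 0\<^sub>v n"
  proof (rule strings_perp_zero[OF frm_surj(1)[OF ab]])
    fix d l and x :: "quat vec" assume d: "d \<in> D" and l: "l < d" and x: "x \<in> carrier_vec (T d)"
    have q: "Pm d l *\<^sub>v x \<in> carrier_vec n" by (rule Pm_vec_carrier[OF d x])
    have hx: "h d *\<^sub>v x \<in> carrier_vec (T d)" by (rule mult_mat_vec_carrier[OF hc[OF d] x])
    have iso: "std_inner (T d) (h d *\<^sub>v x) (S d *\<^sub>v (h d *\<^sub>v y)) = std_inner (T d) x (S d *\<^sub>v y)"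
      if "y \<in> carrier_vec (T d)" for y
      using std_inner_isometry_iff[OF S_carrier[OF d] hc[OF d]] h[OF d] x that
      unfolding block_group_def by blast
    have "std_inner n (Pm d l *\<^sub>v x) ?a = std_inner n (?g *\<^sub>v (Pm d l *\<^sub>v x)) (J *\<^sub>v (Pm e k *\<^sub>v (h e *\<^sub>v y)))"
      unfolding std_inner_adjoint[OF ag q Jph] adjoint_mat_adjoint ..
    also have "\<dots> = frm (Pm d l *\<^sub>v (h d *\<^sub>v x)) (Pm e k *\<^sub>v (h e *\<^sub>v y))"
      unfolding psi_Pm[OF hc0 d l x] frm_def ..
    also have "\<dots> = frm (Pm d l *\<^sub>v x) ?p"
      unfolding frm_Pm[OF d e hx hy] frm_Pm[OF d e x y]
    proof (rule if_cong)
      assume "d = e \<and> l + k = d - 1"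
      then show "(- 1) ^ l * std_inner (T d) (h d *\<^sub>v x) (S d *\<^sub>v (h e *\<^sub>v y)) =
          (- 1) ^ l * std_inner (T d) x (S d *\<^sub>v y)"
        using iso[of y] y by simp
    qed simp_all
    also have "\<dots> = std_inner n (Pm d l *\<^sub>v x) ?b"
      unfolding frm_def ..
    finally show "frm (Pm d l *\<^sub>v x) (K *\<^sub>v (?a - ?b)) = 0"
      unfolding frm_surj(2)[OF ab] sesquilinear_diff[OF eps_hermitianD(1)[OF std_inner_hermitian] q a b]
      by simp
  qed
  then have "J *\<^sub>v (K *\<^sub>v (?a - ?b)) = 0\<^sub>v n" using mat_vec_zero[OF J_carrier] by simp
  moreover have "J *\<^sub>v (K *\<^sub>v (?a - ?b)) = ?a - ?b"
    unfolding assoc_mult_mat_vec[OF J_carrier K_carrier ab, symmetric] JK using ab by simp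
  ultimately have "?a - ?b = 0\<^sub>v n" by simp
  then show "(adjoint_mat ?g * J * ?g) *\<^sub>v ?p = J *\<^sub>v ?p"
    unfolding Mp by (rule vec_minus_eq_0[OF _ a b])
qed

lemma psi_centralizer:
  assumes h0: "\<forall>d\<in>D. h d \<in> block_group d"
  shows "psi h \<in> centralizer"
proof -
  have hc: "\<forall>d\<in>D. h d \<in> carrier_mat (T d) (T d)"
    using h0 block_group_carrier by blast
  from psi_isometry[OF h0] psi_commute[OF hc] psi_carrier show ?thesis
    unfolding centralizer_def by blast
qed

end

section \<open>Normalised bases of the lowest weight spaces\<close>

definition cols_mat :: "nat \<Rightarrow> quat vec list \<Rightarrow> quat mat" where
  "cols_mat n vs = mat n (length vs) (\<lambda>(k, i). vs ! i $ k)"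

lemma cols_mat_carrier [simp]: "cols_mat n vs \<in> carrier_mat n (length vs)"
  by (simp add: cols_mat_def)

lemma cols_mat_vec:
  "c \<in> carrier_vec (length vs) \<Longrightarrow> cols_mat n vs *\<^sub>v c = lin_comb n vs (\<lambda>i. c $ i)"
  by (intro eq_vecI) (simp_all add: cols_mat_def scalar_prod_def lessThan_atLeast0)

text \<open>Restates orthogonality by elements instead of positions, which permits reordering the
  list.\<close>

lemma anisotropic_list_distinct:
  assumes "anisotropic_list h bs"
  shows "distinct bs" "b \<in> set bs \<Longrightarrow> h b b \<noteq> 0"
    "b \<in> set bs \<Longrightarrow> b' \<in> set bs \<Longrightarrow> b \<noteq> b' \<Longrightarrow> h b b' = 0"
proof -
  show "distinct bs"
    unfolding distinct_conv_nth
  proof (intro allI impI notI)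
    fix i j assume "i < length bs" "j < length bs" "i \<noteq> j" "bs ! i = bs ! j"
    with assms show False unfolding anisotropic_list_def by metis
  qed
  show "b \<in> set bs \<Longrightarrow> h b b \<noteq> 0"
    using assms unfolding anisotropic_list_def in_set_conv_nth by blast
  show "b \<in> set bs \<Longrightarrow> b' \<in> set bs \<Longrightarrow> b \<noteq> b' \<Longrightarrow> h b b' = 0"
    using assms unfolding anisotropic_list_def in_set_conv_nth by metis
qed

text \<open>Each basis vector b is rescaled by \<alpha> b on the right, which changes its diagonal
  value s to cnj(\<alpha> b) s (\<alpha> b). The rearranged list \<open>cs\<close> makes room for a
  prescribed order of the signs.\<close>

lemma normalised_basis:
  assumes h: "sesquilinear n h" and W: "is_subspace UNIV n W"
    and basis: "is_basis UNIV n W bs" and aniso: "anisotropic_list h bs"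
    and cs: "distinct cs" "set cs = set bs"
    and \<alpha>: "\<And>b. b \<in> set bs \<Longrightarrow> \<alpha> b \<noteq> 0"
    and S: "S \<in> carrier_mat (length cs) (length cs)"
    and diag: "\<And>i. i < length cs \<Longrightarrow> qcnj (\<alpha> (cs ! i)) * h (cs ! i) (cs ! i) * \<alpha> (cs ! i) = S $$ (i, i)"
    and off: "\<And>i j. i < length cs \<Longrightarrow> j < length cs \<Longrightarrow> i \<noteq> j \<Longrightarrow> S $$ (i, j) = 0"
  obtains E where "E \<in> carrier_mat n (length cs)"
    "\<forall>c\<in>carrier_vec (length cs). E *\<^sub>v c \<in> W"
    "\<forall>v\<in>W. \<exists>c\<in>carrier_vec (length cs). v = E *\<^sub>v c"
    "\<forall>x\<in>carrier_vec (length cs). \<forall>y\<in>carrier_vec (length cs).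
      h (E *\<^sub>v x) (E *\<^sub>v y) = std_inner (length cs) x (S *\<^sub>v y)"
proof -
  note Wc = subspace_carrier[OF W] and ad = anisotropic_list_distinct[OF aniso]
  let ?m = "length cs"
  define us where "us = map (\<lambda>b. right_smult b (\<alpha> b)) cs"
  have len: "length us = ?m" by (simp add: us_def)
  have bsW: "set bs \<subseteq> W" using basis by (simp add: is_basis_def)
  have csW: "cs ! i \<in> W" "cs ! i \<in> set bs" if "i < ?m" for i
    using that cs(2) bsW nth_mem[OF that] by blast+
  have csc: "cs ! i \<in> carrier_vec n" if "i < ?m" for i using csW(1)[OF that] Wc by blast
  have us_nth: "us ! i = right_smult (cs ! i) (\<alpha> (cs ! i))" if "i < ?m" for i
    using that by (simp add: us_def)
  have usW: "set us \<subseteq> W"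
    using cs(2) bsW unfolding us_def by (auto intro!: subspace_smult[OF W])
  have usc: "set us \<subseteq> carrier_vec n" using usW Wc by blast
  have gram: "h (us ! i) (us ! j) = S $$ (i, j)" if i: "i < ?m" and j: "j < ?m" for i j
  proof -
    have eq: "h (us ! i) (us ! j) = qcnj (\<alpha> (cs ! i)) * h (cs ! i) (cs ! j) * \<alpha> (cs ! j)"
      unfolding us_nth[OF i] us_nth[OF j]
      using sesquilinearD(3)[OF h csc[OF i], of "right_smult (cs ! j) (\<alpha> (cs ! j))"]
        sesquilinearD(4)[OF h csc[OF i] csc[OF j]] csc[OF j] by (simp add: mult.assoc)
    show ?thesis
    proof (cases "i = j")
      case True
      with eq diag[OF i] show ?thesis by simp
    next
      case False
      then have "cs ! i \<noteq> cs ! j" using nth_eq_iff_index_eq[OF cs(1) i j] by simp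
      with ad(3)[OF csW(2)[OF i] csW(2)[OF j]] eq off[OF i j False] show ?thesis by simp
    qed
  qed
  let ?E = "cols_mat n us"
  have Ec: "?E \<in> carrier_mat n ?m" using cols_mat_carrier[of n us] unfolding len .
  have Evec: "?E *\<^sub>v c = lin_comb n us (\<lambda>i. c $ i)" if "c \<in> carrier_vec ?m" for c
    using that by (intro cols_mat_vec) (simp add: len)
  have 1: "\<forall>c\<in>carrier_vec ?m. ?E *\<^sub>v c \<in> W"
    using Evec subspace_lin_comb[OF W usW] by simp
  have 2: "\<forall>v\<in>W. \<exists>c\<in>carrier_vec ?m. v = ?E *\<^sub>v c"
  proof
    fix v assume v: "v \<in> W"
    have "set bs \<subseteq> {lin_comb n us c | c. range c \<subseteq> UNIV}"
    proof
      fix b assume b: "b \<in> set bs"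
      then obtain i where i: "i < ?m" "b = cs ! i" using cs(2) by (metis in_set_conv_nth)
      have ui: "us ! i \<in> carrier_vec n" using usc i by (simp add: len subset_iff)
      have "lin_comb n us (\<lambda>k. if k = i then inverse (\<alpha> b) else 0) = right_smult (us ! i) (inverse (\<alpha> b))"
        using i ui by (intro lin_comb_unit) (simp_all add: len)
      also have "\<dots> = b"
        unfolding us_nth[OF i(1)] i(2)[symmetric] using \<alpha>[OF b] by simp
      finally have "b = lin_comb n us (\<lambda>k. if k = i then inverse (\<alpha> b) else 0)" ..
      then show "b \<in> {lin_comb n us c | c. range c \<subseteq> UNIV}"
        by (intro CollectI exI conjI) (assumption, rule subset_UNIV)
    qed
    from span_minimal[OF lin_comb_subspace[OF scalar_field_simps(2)] this] v basis
    have "v \<in> {lin_comb n us c | c. range c \<subseteq> UNIV}"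
      unfolding is_basis_def by blast
    then obtain c where c: "v = lin_comb n us c" by blast
    have "lin_comb n us c = lin_comb n us (\<lambda>i. vec ?m c $ i)"
      by (intro lin_comb_cong) (simp add: len)
    with c have "v = ?E *\<^sub>v vec ?m c" by (simp add: Evec)
    then show "\<exists>c\<in>carrier_vec ?m. v = ?E *\<^sub>v c" by (intro bexI[of _ "vec ?m c"]) simp_all
  qed
  have 3: "\<forall>x\<in>carrier_vec ?m. \<forall>y\<in>carrier_vec ?m. h (?E *\<^sub>v x) (?E *\<^sub>v y) = std_inner ?m x (S *\<^sub>v y)"
  proof (intro ballI)
    fix x y :: "quat vec" assume x: "x \<in> carrier_vec ?m" and y: "y \<in> carrier_vec ?m"
    have "h (?E *\<^sub>v x) (?E *\<^sub>v y) = (\<Sum>i<?m. qcnj (x $ i) * h (us ! i) (lin_comb n us (\<lambda>i. y $ i)))"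
      unfolding Evec[OF x] Evec[OF y] sesquilinear_lin_comb_left[OF h lin_comb_carrier usc] len ..
    also have "\<dots> = (\<Sum>i<?m. qcnj (x $ i) * (S *\<^sub>v y) $ i)"
    proof (intro sum.cong refl)
      fix i assume "i \<in> {..<?m}"
      then have i: "i < ?m" by simp
      have ui: "us ! i \<in> carrier_vec n" using usc i by (simp add: len subset_iff)
      have "h (us ! i) (lin_comb n us (\<lambda>i. y $ i)) = (\<Sum>j<?m. h (us ! i) (us ! j) * y $ j)"
        unfolding sesquilinear_lin_comb[OF h ui usc] len ..
      also have "\<dots> = (\<Sum>j<?m. S $$ (i, j) * y $ j)"
        using gram[OF i] by (intro sum.cong) simp_all
      also have "\<dots> = (S *\<^sub>v y) $ i"
        using i S y by (simp add: scalar_prod_def lessThan_atLeast0)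
      finally show "qcnj (x $ i) * h (us ! i) (lin_comb n us (\<lambda>i. y $ i)) = qcnj (x $ i) * (S *\<^sub>v y) $ i"
        by simp
    qed
    finally show "h (?E *\<^sub>v x) (?E *\<^sub>v y) = std_inner ?m x (S *\<^sub>v y)"
      unfolding std_inner_def .
  qed
  from that[OF Ec 1 2 3] show thesis .
qed

lemma of_real_quat: "(of_real r :: quat) = Quat r 0 0 0"
  by (simp add: of_real_def scaleR_quat_def one_quat_def)

text \<open>A self-conjugate quaternion is real, and scaling by the inverse square root of its
  absolute value leaves only the sign.\<close>

lemma real_normalise:
  fixes s :: quat
  assumes "s = qcnj s" "s \<noteq> 0"
  obtains a where "a \<noteq> 0" "qcnj a * s * a = (if QRe s > 0 then 1 else - 1)" "QRe s \<noteq> 0"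
proof -
  define r where "r = QRe s"
  have s: "s = of_real r"
    using assms(1) by (simp add: of_real_quat r_def qcnj_def quat_eq_iff)
  with assms(2) have r: "r \<noteq> 0" by auto
  let ?a = "of_real (inverse (sqrt \<bar>r\<bar>)) :: quat"
  have sq: "inverse (sqrt \<bar>r\<bar>) * inverse (sqrt \<bar>r\<bar>) = inverse \<bar>r\<bar>"
    unfolding inverse_mult_distrib[symmetric] by simp
  have "inverse (sqrt \<bar>r\<bar>) * r * inverse (sqrt \<bar>r\<bar>) =
      r * (inverse (sqrt \<bar>r\<bar>) * inverse (sqrt \<bar>r\<bar>))"
    by (simp only: mult_ac)
  also have "\<dots> = r * inverse \<bar>r\<bar>" unfolding sq ..
  also have "\<dots> = (if r > 0 then 1 else - 1)" using r by (simp add: abs_if field_simps)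
  finally have *: "inverse (sqrt \<bar>r\<bar>) * r * inverse (sqrt \<bar>r\<bar>) = (if r > 0 then 1 else - 1)" .
  have "qcnj ?a * s * ?a = of_real (inverse (sqrt \<bar>r\<bar>) * r * inverse (sqrt \<bar>r\<bar>))"
    unfolding s qcnj_of_real of_real_mult ..
  also have "\<dots> = (if QRe s > 0 then 1 else - 1)"
    unfolding * by (simp add: r_def)
  finally have eq: "qcnj ?a * s * ?a = (if QRe s > 0 then 1 else - 1)" .
  have a0: "?a \<noteq> 0" unfolding of_real_eq_0_iff using r by simp
  show thesis by (rule that[OF a0 eq]) (use r in \<open>simp add: r_def\<close>)
qed

text \<open>For a unit imaginary \<open>u\<close>, every \<open>a = x j + u x\<close> satisfies \<open>u a = a j\<close>; one of \<open>x = 1\<close>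
  and \<open>x = i\<close> gives \<open>a \<noteq> 0\<close>.\<close>

lemma imaginary_normalise:
  fixes s :: quat
  assumes s: "s = - qcnj s" "s \<noteq> 0"
  obtains a where "a \<noteq> 0" "qcnj a * s * a = qj"
proof -
  define r where "r = norm s"
  have r: "r > 0" using s(2) by (simp add: r_def)
  define u where "u = inverse r *\<^sub>R s"
  have su: "s = r *\<^sub>R u"
    using r by (simp add: u_def)
  have "s * s = - (qcnj s * s)" using s(1) by (metis minus_mult_left)
  then have ss: "s * s = - ((r * r) *\<^sub>R 1)"
    by (simp add: qcnj_mult_self r_def power2_eq_square of_real_def)
  have uu: "u * u = - 1"
  proof -
    have "u * u = (inverse r * inverse r) *\<^sub>R (s * s)"
      by (simp add: u_def)
    also have "\<dots> = - ((inverse r * inverse r * (r * r)) *\<^sub>R 1)" unfolding ss by simp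
    also have "inverse r * inverse r * (r * r) = 1" using r by (simp add: field_simps)
    finally show ?thesis by simp
  qed
  have jj: "qj * qj = - 1" by (rule quat_units)
  have solution: "u * (x * qj + u * x) = (x * qj + u * x) * qj" for x
    unfolding distrib_left distrib_right mult.assoc jj
    unfolding mult.assoc[symmetric] uu by (simp add: mult.assoc)
  obtain b where b: "b \<noteq> 0" "u * b = b * qj"
  proof (cases "qj + u = 0")
    case False
    with solution[of 1] that[of "qj + u"] show thesis by simp
  next
    case True
    then have "u = - qj" by (simp add: eq_neg_iff_add_eq_0 add.commute)
    then have "qi * qj + u * qi \<noteq> 0"
      by (simp add: quat_units) (simp add: qk_def quat_ring_defs)
    with solution[of qi] that show thesis by blast
  qed
  \<comment> \<open>With \<open>u * b = b * qj\<close> one gets cnj(b) s b = r (norm b)^2 j; this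
    factor, used on both sides, normalises the multiple to 1.\<close>
  let ?c = "inverse (norm b * sqrt r)"
  have c0: "?c \<noteq> 0" using b(1) r by simp
  define a where "a = ?c *\<^sub>R b"
  have a0: "a \<noteq> 0" unfolding a_def using c0 b(1) by (simp only: scaleR_eq_0_iff) simp
  have cnj: "qcnj a = ?c *\<^sub>R qcnj b" unfolding a_def by (simp add: qcnj_def scaleR_quat_def)
  have "qcnj b * u * b = (norm b ^ 2) *\<^sub>R qj"
    unfolding mult.assoc b(2) unfolding mult.assoc[symmetric] qcnj_mult_self of_real_def by simp
  then have "qcnj a * s * a = (?c * ?c * (r * norm b ^ 2)) *\<^sub>R qj"
    unfolding cnj su unfolding a_def by (simp add: mult.assoc mult.left_commute)
  also have "?c * ?c * (r * norm b ^ 2) = 1"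
    using b(1) r by (simp add: field_simps power2_eq_square)
  finally have "qcnj a * s * a = qj" by simp
  with a0 that show thesis by blast
qed

lemma std_skew_form_sesquilinear: "sesquilinear m (std_skew_form m)"
  unfolding sesquilinear_def std_skew_form_def
proof (intro conjI ballI allI)
  fix x y z :: "quat vec" and a :: quat
  assume "x \<in> carrier_vec m" "y \<in> carrier_vec m"
  then have [simp]: "dim_vec x = m" "dim_vec y = m" by auto
  show "(\<Sum>i<m. qcnj (right_smult x a $ i) * qj * y $ i) = qcnj a * (\<Sum>i<m. qcnj (x $ i) * qj * y $ i)"
    "(\<Sum>i<m. qcnj (x $ i) * qj * right_smult y a $ i) = (\<Sum>i<m. qcnj (x $ i) * qj * y $ i) * a"
    unfolding sum_distrib_left sum_distrib_right
    by (auto intro!: sum.cong simp: qcnj_mult mult.assoc)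
  assume "z \<in> carrier_vec m"
  then have [simp]: "dim_vec z = m" by auto
  show "(\<Sum>i<m. qcnj ((x + y) $ i) * qj * z $ i) =
      (\<Sum>i<m. qcnj (x $ i) * qj * z $ i) + (\<Sum>i<m. qcnj (y $ i) * qj * z $ i)"
    "(\<Sum>i<m. qcnj (x $ i) * qj * (y + z) $ i) =
      (\<Sum>i<m. qcnj (x $ i) * qj * y $ i) + (\<Sum>i<m. qcnj (x $ i) * qj * z $ i)"
    unfolding sum.distrib[symmetric]
    by (auto intro!: sum.cong simp: distrib_left distrib_right)
qed

lemma gram_std_skew_index:
  assumes ij: "i < m" "j < m"
  shows "gram_mat m (std_skew_form m) $$ (i, j) = (if i = j then qj else 0)"
proof -
  have "gram_mat m (std_skew_form m) $$ (i, j) =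
      (\<Sum>k<m. qcnj (unit_vec m i $ k) * qj * unit_vec m j $ k)"
    using ij by (simp add: gram_mat_def std_skew_form_def del: index_unit_vec)
  also have "\<dots> = (\<Sum>k<m. if k = i then (if i = j then qj else 0) else 0)"
    by (rule sum.cong) (use ij in auto)
  finally have "gram_mat m (std_skew_form m) $$ (i, j) =
      (\<Sum>k<m. if k = i then (if i = j then qj else 0) else 0)" .
  with ij show ?thesis by simp
qed

lemma gram_std_skew_inverse:
  "gram_mat m (std_skew_form m) * (- gram_mat m (std_skew_form m)) = 1\<^sub>m m" (is "?S * - ?S = _")
proof (rule eq_matI)
  fix i j assume "i < dim_row (1\<^sub>m m :: quat mat)" "j < dim_col (1\<^sub>m m :: quat mat)"
  then have ij: "i < m" "j < m" by simp_all
  have d: "dim_row ?S = m" "dim_col ?S = m" by (simp_all add: gram_mat_def)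
  have "(?S * - ?S) $$ (i, j) = (\<Sum>k<m. ?S $$ (i, k) * (- ?S) $$ (k, j))"
    using ij d by (subst mult_index_sum) simp_all
  also have "\<dots> = (\<Sum>k<m. if k = i then (if i = j then 1 else 0) else 0)"
    by (rule sum.cong) (use ij d in \<open>auto simp: gram_std_skew_index quat_units\<close>)
  finally have "(?S * - ?S) $$ (i, j) = (\<Sum>k<m. if k = i then (if i = j then 1 else 0) else 0)" .
  with ij show "(?S * - ?S) $$ (i, j) = 1\<^sub>m m $$ (i, j)" by simp
qed (simp_all add: gram_mat_def)

lemma I_mat_carrier [simp]: "I_mat p q \<in> carrier_mat (p + q) (p + q)"
  by (simp add: I_mat_def)

lemma I_mat_index:
  "i < p + q \<Longrightarrow> j < p + q \<Longrightarrow> I_mat p q $$ (i, j) = (if i = j then (if i < p then 1 else - 1) else 0)"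
  by (auto simp: I_mat_def)

lemma I_mat_inverse: "I_mat p q * I_mat p q = 1\<^sub>m (p + q)"
proof (rule eq_matI)
  fix i j assume "i < dim_row (1\<^sub>m (p + q) :: quat mat)" "j < dim_col (1\<^sub>m (p + q) :: quat mat)"
  then have ij: "i < p + q" "j < p + q" by simp_all
  have d: "dim_row (I_mat p q) = p + q" "dim_col (I_mat p q) = p + q"
    using carrier_matD[OF I_mat_carrier] by blast+
  have "(I_mat p q * I_mat p q) $$ (i, j) = (\<Sum>k<p + q. I_mat p q $$ (i, k) * I_mat p q $$ (k, j))"
    using ij d by (subst mult_index_sum) simp_all
  also have "\<dots> = (\<Sum>k<p + q. if k = i then (if i = j then 1 else 0) else 0)"
    by (rule sum.cong) (use ij in \<open>auto simp: I_mat_index\<close>)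
  finally have "(I_mat p q * I_mat p q) $$ (i, j) =
      (\<Sum>k<p + q. if k = i then (if i = j then 1 else 0) else 0)" .
  with ij show "(I_mat p q * I_mat p q) $$ (i, j) = 1\<^sub>m (p + q) $$ (i, j)" by simp
qed (simp_all add: I_mat_def)

section \<open>Parts, multiplicities and normalised frames\<close>

context skew_rep
begin

lemma block_form_eq_block:
  assumes B: "\<And>x y. x \<in> carrier_vec n \<Longrightarrow> y \<in> carrier_vec n \<Longrightarrow> B x y = frm x y"
    and x: "x \<in> carrier_vec n" and y: "y \<in> carrier_vec n"
  shows "block_form B X d x y = block d x y"
  unfolding block_form_def block_def using x y by (intro B) simp_all

lemma Ld_basis:
  assumes d: "d \<ge> 1"
  obtains bs where "is_orthogonal_basis n (Ld d) (block d) bs" "anisotropic_list (block d) bs"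
  by (rule orthogonal_basis_exists[OF block_hermitian[OF d] Ld_subspace])
     (rule block_nondegenerate[OF _ d])

lemma Ld_multiplicity:
  assumes d: "d \<ge> 1" and bs: "is_basis UNIV n (Ld d) bs"
  shows "multiplicity_of n X H Y d = length bs"
  unfolding multiplicity_of_def lowest_eq_Ld[OF d]
  by (rule dim_over_eq[OF scalar_field_simps(2) subspace_carrier[OF Ld_subspace] bs])

lemma Ld_multiplicity_0:
  assumes d: "d \<ge> 1" and 0: "multiplicity_of n X H Y d = 0"
  shows "Ld d = {0\<^sub>v n}"
proof -
  obtain bs where "is_orthogonal_basis n (Ld d) (block d) bs" "anisotropic_list (block d) bs"
    by (rule Ld_basis[OF d])
  then have bs: "is_basis UNIV n (Ld d) bs" by (simp add: is_orthogonal_basis_def)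
  with Ld_multiplicity[OF d bs] 0 have "bs = []" by simp
  with bs have "span_over UNIV n {} = Ld d" by (simp add: is_basis_def)
  moreover have "span_over UNIV n {} \<subseteq> {0\<^sub>v n}" unfolding span_over_def by auto
  ultimately show ?thesis using subspace_zero[OF Ld_subspace] by blast
qed

lemma multiplicity_0: "multiplicity_of n X H Y 0 = 0"
proof -
  have "is_basis UNIV n {0\<^sub>v n} []"
  proof (rule is_basisI[OF scalar_field_simps(2)])
    show "is_subspace UNIV n {0\<^sub>v n}" by (simp add: is_subspace_def)
  qed auto
  from dim_over_eq[OF scalar_field_simps(2) _ this] show ?thesis
    unfolding multiplicity_of_def lowest_0 by simp
qed

lemma parts_pos: "d \<in> parts n X H Y \<Longrightarrow> d \<ge> 1"
  using multiplicity_0 unfolding parts_def by (cases d) simp_all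

text \<open>If X^k = 0, then L(d - 1) vanishes for d > k, because X^k is injective on it.\<close>

lemma finite_parts: "finite (parts n X H Y)"
proof -
  obtain k where k: "X ^\<^sub>m k = 0\<^sub>m n n" using nilpotent_X by blast
  have "d \<le> k" if d: "d \<in> parts n X H Y" for d
  proof (rule ccontr)
    assume "\<not> d \<le> k"
    then have kd: "k < d" by simp
    note d1 = parts_pos[OF d]
    have "v = 0\<^sub>v n" if v: "v \<in> Ld d" for v
      using Ld_pow_X_inj[OF v _ kd] zero_mat_vec[OF LdD(1)[OF v], of n] unfolding k by blast
    then have "Ld d \<subseteq> {0\<^sub>v n}" by blast
    moreover obtain bs where "is_orthogonal_basis n (Ld d) (block d) bs" "anisotropic_list (block d) bs"
      by (rule Ld_basis[OF d1])
    then have bs: "is_basis UNIV n (Ld d) bs" "anisotropic_list (block d) bs"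
      by (simp_all add: is_orthogonal_basis_def)
    moreover have "bs = []"
    proof (rule ccontr)
      assume "bs \<noteq> []"
      then have mem: "hd bs \<in> set bs" by simp
      with bs(1) \<open>Ld d \<subseteq> {0\<^sub>v n}\<close> have "hd bs = 0\<^sub>v n" by (auto simp: is_basis_def)
      with anisotropic_list_distinct(2)[OF bs(2) mem]
        sesquilinear_zero(1)[OF eps_hermitianD(1)[OF block_hermitian[OF d1]] zero_carrier_vec]
      show False by simp
    qed
    with Ld_multiplicity[OF d1 bs(1)] d show False by (simp add: parts_def)
  qed
  then show ?thesis by (intro finite_subset[OF _ finite_atMost[of k]]) auto
qed

text \<open>For odd d the diagonal values are purely imaginary and nonzero, so
  \<open>imaginary_normalise\<close> brings each of them to j; the Gram matrix becomes that of the
  standard skew form.\<close>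

lemma odd_frame:
  assumes d: "odd d" "d \<ge> 1" and m: "m = multiplicity_of n X H Y d"
  shows "\<exists>E. E \<in> carrier_mat n m \<and> (\<forall>c\<in>carrier_vec m. E *\<^sub>v c \<in> Ld d) \<and>
    (\<forall>v\<in>Ld d. \<exists>c\<in>carrier_vec m. v = E *\<^sub>v c) \<and>
    (\<forall>x\<in>carrier_vec m. \<forall>y\<in>carrier_vec m.
      block d (E *\<^sub>v x) (E *\<^sub>v y) = std_inner m x (gram_mat m (std_skew_form m) *\<^sub>v y))"
proof -
  note herm = block_hermitian[OF d(2)]
  obtain bs where bs: "is_orthogonal_basis n (Ld d) (block d) bs" "anisotropic_list (block d) bs"
    by (rule Ld_basis[OF d(2)])
  then have basis: "is_basis UNIV n (Ld d) bs" by (simp add: is_orthogonal_basis_def)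
  have len: "m = length bs" using Ld_multiplicity[OF d(2) basis] m by simp
  have bsc: "b \<in> carrier_vec n" if "b \<in> set bs" for b
    using basis that subspace_carrier[OF Ld_subspace] by (auto simp: is_basis_def)
  have "\<exists>a. a \<noteq> 0 \<and> qcnj a * block d b b * a = qj" if b: "b \<in> set bs" for b
  proof -
    have "block d b b = (- 1) ^ d * qcnj (block d b b)"
      by (rule eps_hermitianD(3)[OF herm bsc[OF b] bsc[OF b]])
    then have "block d b b = - qcnj (block d b b)" using d(1) by simp
    from imaginary_normalise[OF this anisotropic_list_distinct(2)[OF bs(2) b]] show ?thesis by blast
  qed
  then obtain \<alpha> where \<alpha>: "\<And>b. b \<in> set bs \<Longrightarrow> \<alpha> b \<noteq> 0"
    "\<And>b. b \<in> set bs \<Longrightarrow> qcnj (\<alpha> b) * block d b b * \<alpha> b = qj"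
    by metis
  let ?S = "gram_mat (length bs) (std_skew_form (length bs))"
  have Sc: "?S \<in> carrier_mat (length bs) (length bs)" by simp
  have diag: "qcnj (\<alpha> (bs ! i)) * block d (bs ! i) (bs ! i) * \<alpha> (bs ! i) = ?S $$ (i, i)"
    if i: "i < length bs" for i
    using \<alpha>(2)[OF nth_mem[OF i]] i by (simp add: gram_std_skew_index)
  have off: "?S $$ (i, j) = 0" if "i < length bs" "j < length bs" "i \<noteq> j" for i j
    using that by (simp add: gram_std_skew_index)
  obtain E where "E \<in> carrier_mat n (length bs)"
    "\<forall>c\<in>carrier_vec (length bs). E *\<^sub>v c \<in> Ld d"
    "\<forall>v\<in>Ld d. \<exists>c\<in>carrier_vec (length bs). v = E *\<^sub>v c"
    "\<forall>x\<in>carrier_vec (length bs). \<forall>y\<in>carrier_vec (length bs).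
      block d (E *\<^sub>v x) (E *\<^sub>v y) = std_inner (length bs) x (?S *\<^sub>v y)"
    by (rule normalised_basis[OF eps_hermitianD(1)[OF herm] Ld_subspace basis bs(2)
          anisotropic_list_distinct(1)[OF bs(2)] refl \<alpha>(1) Sc diag off])
  then show ?thesis
    unfolding len by (intro exI conjI)
qed

text \<open>The diagonal values are real and nonzero, so p and q exhaust the basis. An arbitrary
  orthogonal basis is allowed, so that the one chosen inside \<open>signature\<close> can be
  inserted.\<close>

lemma even_frame:
  assumes d: "even d" "d \<ge> 1" and bs: "is_orthogonal_basis n (Ld d) (block d) bs"
    and p: "p = card {i. i < length bs \<and> QRe (block d (bs ! i) (bs ! i)) > 0}"
    and q: "q = card {i. i < length bs \<and> QRe (block d (bs ! i) (bs ! i)) < 0}"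
  shows "\<exists>E. E \<in> carrier_mat n (p + q) \<and> (\<forall>c\<in>carrier_vec (p + q). E *\<^sub>v c \<in> Ld d) \<and>
    (\<forall>v\<in>Ld d. \<exists>c\<in>carrier_vec (p + q). v = E *\<^sub>v c) \<and>
    (\<forall>x\<in>carrier_vec (p + q). \<forall>y\<in>carrier_vec (p + q).
      block d (E *\<^sub>v x) (E *\<^sub>v y) = std_inner (p + q) x (I_mat p q *\<^sub>v y))"
proof -
  note herm = block_hermitian[OF d(2)]
  have aniso: "anisotropic_list (block d) bs"
    by (rule orthogonal_basis_anisotropic[OF herm Ld_subspace _ bs]) (rule block_nondegenerate[OF _ d(2)])
  note ad = anisotropic_list_distinct[OF aniso]
  have basis: "is_basis UNIV n (Ld d) bs" using bs by (simp add: is_orthogonal_basis_def)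
  have bsc: "b \<in> carrier_vec n" if "b \<in> set bs" for b
    using basis that subspace_carrier[OF Ld_subspace] by (auto simp: is_basis_def)
  have "\<exists>a. a \<noteq> 0 \<and> qcnj a * block d b b * a = (if QRe (block d b b) > 0 then 1 else - 1) \<and> QRe (block d b b) \<noteq> 0"
    if b: "b \<in> set bs" for b
  proof -
    have "block d b b = (- 1) ^ d * qcnj (block d b b)"
      by (rule eps_hermitianD(3)[OF herm bsc[OF b] bsc[OF b]])
    then have "block d b b = qcnj (block d b b)" using d(1) by simp
    from real_normalise[OF this ad(2)[OF b]] show ?thesis by blast
  qed
  then obtain \<alpha> where \<alpha>: "\<And>b. b \<in> set bs \<Longrightarrow> \<alpha> b \<noteq> 0"
    "\<And>b. b \<in> set bs \<Longrightarrow> qcnj (\<alpha> b) * block d b b * \<alpha> b = (if QRe (block d b b) > 0 then 1 else - 1)"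
    "\<And>b. b \<in> set bs \<Longrightarrow> QRe (block d b b) \<noteq> 0"
    by metis
  let ?pos = "\<lambda>b. QRe (block d b b) > 0" and ?neg = "\<lambda>b. QRe (block d b b) < 0"
  \<comment> \<open>Positive vectors come first, matching the order of the diagonal of
    \<open>I_mat p q\<close>.\<close>
  define cs where "cs = filter ?pos bs @ filter ?neg bs"
  have lp: "length (filter ?pos bs) = p" and lq: "length (filter ?neg bs) = q"
    unfolding p q by (rule length_filter_conv_card)+
  have len: "length cs = p + q" by (simp add: cs_def lp lq)
  have set: "set cs = set bs" using \<alpha>(3) by (auto simp: cs_def neq_iff)
  have dist: "distinct cs" using ad(1) by (auto simp: cs_def)
  have sign: "?pos (cs ! i) \<longleftrightarrow> i < p" if i: "i < p + q" for i
  proof (cases "i < p")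
    case True
    then have "cs ! i \<in> set (filter ?pos bs)"
      unfolding cs_def nth_append lp using nth_mem[of i "filter ?pos bs"] lp by simp
    with True show ?thesis by simp
  next
    case False
    then have "cs ! i \<in> set (filter ?neg bs)"
      unfolding cs_def nth_append lp using nth_mem[of "i - p" "filter ?neg bs"] lq i by simp
    with False show ?thesis by simp
  qed
  have diag: "qcnj (\<alpha> (cs ! i)) * block d (cs ! i) (cs ! i) * \<alpha> (cs ! i) = I_mat p q $$ (i, i)"
    if i: "i < length cs" for i
  proof -
    have "cs ! i \<in> set bs" using nth_mem[OF i] set by blast
    from \<alpha>(2)[OF this] sign[of i] i show ?thesis by (simp add: len I_mat_index)
  qed
  have Sc: "I_mat p q \<in> carrier_mat (length cs) (length cs)" unfolding len by (rule I_mat_carrier)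
  have off: "I_mat p q $$ (i, j) = 0" if "i < length cs" "j < length cs" "i \<noteq> j" for i j
    using that unfolding len by (simp add: I_mat_index)
  obtain E where "E \<in> carrier_mat n (length cs)"
    "\<forall>c\<in>carrier_vec (length cs). E *\<^sub>v c \<in> Ld d"
    "\<forall>v\<in>Ld d. \<exists>c\<in>carrier_vec (length cs). v = E *\<^sub>v c"
    "\<forall>x\<in>carrier_vec (length cs). \<forall>y\<in>carrier_vec (length cs).
      block d (E *\<^sub>v x) (E *\<^sub>v y) = std_inner (length cs) x (I_mat p q *\<^sub>v y)"
    by (rule normalised_basis[OF eps_hermitianD(1)[OF herm] Ld_subspace basis aniso dist set \<alpha>(1) Sc diag off])
  then show ?thesis
    unfolding len by (intro exI conjI)
qed

end

section \<open>Topology of matrix groups\<close>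

lemma topspace_mat_topology: "topspace (mat_topology m) = carrier_mat m m"
  unfolding mat_topology_def topspace_pullback_topology by auto

lemma topspace_group_topology:
  "carrier G \<subseteq> carrier_mat m m \<Longrightarrow> topspace (group_topology m G) = carrier G"
  unfolding group_topology_def topspace_subtopology topspace_mat_topology by blast

lemma continuous_map_entry:
  assumes ij: "i < m" "j < m"
  shows "continuous_map (group_topology m G) euclidean (\<lambda>A. A $$ (i, j))"
proof -
  let ?I = "{..<m} \<times> {..<m}"
  have "(i, j) \<in> ?I" using ij by simp
  from continuous_map_pullback[OF continuous_map_product_projection[OF this, of "\<lambda>_. euclidean"],
      of "carrier_mat m m" "\<lambda>A. restrict (\<lambda>ij. A $$ ij) ?I"]
  have "continuous_map (mat_topology m) euclidean ((\<lambda>x. x (i, j)) \<circ> (\<lambda>A. restrict (\<lambda>ij. A $$ ij) ?I))"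
    unfolding mat_topology_def .
  moreover have "(\<lambda>x. x (i, j)) \<circ> (\<lambda>A. restrict (\<lambda>ij. A $$ ij) ?I) = (\<lambda>A :: quat mat. A $$ (i, j))"
    using ij by (simp add: fun_eq_iff)
  ultimately show ?thesis
    unfolding group_topology_def by (intro continuous_map_from_subtopology) simp
qed

lemma continuous_map_into_group:
  assumes G: "carrier G \<subseteq> carrier_mat m m" and f: "f \<in> topspace U \<rightarrow> carrier G"
    and entry: "\<And>i j. i < m \<Longrightarrow> j < m \<Longrightarrow> continuous_map U euclidean (\<lambda>x. f x $$ (i, j))"
  shows "continuous_map U (group_topology m G) f"
  unfolding group_topology_def
proof (rule continuous_map_into_subtopology[OF _ f])
  let ?I = "{..<m} \<times> {..<m}"
  show "continuous_map U (mat_topology m) f"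
    unfolding mat_topology_def
  proof (rule continuous_map_pullback')
    show "continuous_map U (product_topology (\<lambda>_. euclidean) ?I) ((\<lambda>A. restrict (\<lambda>ij. A $$ ij) ?I) \<circ> f)"
      unfolding continuous_map_componentwise
    proof (intro conjI ballI)
      fix k assume "k \<in> ?I"
      then obtain i j where k: "k = (i, j)" "i < m" "j < m" by auto
      then have "(\<lambda>x. ((\<lambda>A. restrict (\<lambda>ij. A $$ ij) ?I) \<circ> f) x k) = (\<lambda>x. f x $$ (i, j))"
        by (simp add: fun_eq_iff)
      with entry[OF k(2,3)] show "continuous_map U euclidean (\<lambda>x. ((\<lambda>A. restrict (\<lambda>ij. A $$ ij) ?I) \<circ> f) x k)"
        by simp
    qed auto
    show "topspace U \<subseteq> f -` carrier_mat m m" using f G by blast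
  qed
qed

text \<open>Each entry of the product is a finite sum of entries of M multiplied by constants from
  the left and the right. Both restriction and extension have this shape.\<close>

lemma continuous_map_sandwich:
  fixes A C :: "quat mat"
  assumes A: "A \<in> carrier_mat a b" and C: "C \<in> carrier_mat c e"
    and M: "\<And>x. x \<in> topspace U \<Longrightarrow> M x \<in> carrier_mat b c"
    and entry: "\<And>k l. k < b \<Longrightarrow> l < c \<Longrightarrow> continuous_map U euclidean (\<lambda>x. M x $$ (k, l))"
    and ij: "i < a" "j < e"
  shows "continuous_map U euclidean (\<lambda>x. (A * (M x * C)) $$ (i, j))"
proof (rule continuous_map_eq)
  show "continuous_map U euclidean (\<lambda>x. \<Sum>k<b. \<Sum>l<c. A $$ (i, k) * (M x $$ (k, l) * C $$ (l, j)))"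
  proof (intro continuous_map_sum finite_lessThan)
    fix k l assume "k \<in> {..<b}" "l \<in> {..<c}"
    then have "continuous_map U euclidean (\<lambda>x. M x $$ (k, l))" by (intro entry) simp_all
    moreover have "continuous_map euclidean euclidean (\<lambda>z. A $$ (i, k) * (z * C $$ (l, j)))"
      by (simp add: continuous_intros)
    ultimately have "continuous_map U euclidean ((\<lambda>z. A $$ (i, k) * (z * C $$ (l, j))) \<circ> (\<lambda>x. M x $$ (k, l)))"
      by (rule continuous_map_compose)
    then show "continuous_map U euclidean (\<lambda>x. A $$ (i, k) * (M x $$ (k, l) * C $$ (l, j)))"
      by (simp add: o_def)
  qed
  fix x assume "x \<in> topspace U"
  note Mx = M[OF this]
  note dims = carrier_matD[OF A] carrier_matD[OF C] carrier_matD[OF Mx]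
  have "(A * (M x * C)) $$ (i, j) = (\<Sum>k<b. A $$ (i, k) * (M x * C) $$ (k, j))"
    using dims ij by (subst mult_index_sum) simp_all
  also have "\<dots> = (\<Sum>k<b. \<Sum>l<c. A $$ (i, k) * (M x $$ (k, l) * C $$ (l, j)))"
  proof (rule sum.cong)
    fix k assume "k \<in> {..<b}"
    then have "(M x * C) $$ (k, j) = (\<Sum>l<c. M x $$ (k, l) * C $$ (l, j))"
      using dims ij by (subst mult_index_sum) simp_all
    then show "A $$ (i, k) * (M x * C) $$ (k, j) = (\<Sum>l<c. A $$ (i, k) * (M x $$ (k, l) * C $$ (l, j)))"
      by (simp only: sum_distrib_left)
  qed simp
  finally show "(\<Sum>k<b. \<Sum>l<c. A $$ (i, k) * (M x $$ (k, l) * C $$ (l, j))) = (A * (M x * C)) $$ (i, j)" ..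
qed

section \<open>Isometry groups and centralizers\<close>

text \<open>Allows the groups to be treated as plain isometry groups, with the determinant condition
  restored by \<open>reduced_norm_isometry\<close>.\<close>

lemma isometry_SL:
  assumes J: "J \<in> carrier_mat m m" and K: "K \<in> carrier_mat m m" and JK: "J * K = 1\<^sub>m m"
  shows "g \<in> SL_H m \<and> adjoint_mat g * J * g = J \<longleftrightarrow> g \<in> carrier_mat m m \<and> adjoint_mat g * J * g = J"
  using reduced_norm_isometry[OF _ J K JK] unfolding SL_H_def by blast

context skew_frame
begin

text \<open>The isometry equation itself exhibits K g' J, with g' the adjoint of g, as a left
  inverse; it is two-sided, and multiplying the equation by it from both sides shows that it is
  again an isometry.\<close>

lemma isometry_inverse:
  assumes g: "g \<in> carrier_mat n n" and iso: "adjoint_mat g * J * g = J"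
  obtains g' where "g' \<in> carrier_mat n n" "adjoint_mat g' * J * g' = J" "g * g' = 1\<^sub>m n" "g' * g = 1\<^sub>m n"
proof -
  let ?h = "K * (adjoint_mat g * J)"
  have ag: "adjoint_mat g \<in> carrier_mat n n" using g by simp
  note agJ = mult_carrier_mat[OF ag J_carrier]
  note h = mult_carrier_mat[OF K_carrier agJ]
  have hg: "?h * g = 1\<^sub>m n"
    unfolding assoc_mult_mat[OF K_carrier agJ g] iso by (rule KJ)
  note gh = quat_mat_left_right_inverse[OF h g hg]
  have ah: "adjoint_mat ?h \<in> carrier_mat n n" using h by (rule adjoint_mat_carrier)
  have "adjoint_mat ?h * (adjoint_mat g * J * g) * ?h = (adjoint_mat ?h * adjoint_mat g) * J * (g * ?h)"
    unfolding assoc_mult_mat[OF ah mult_carrier_mat[OF agJ g] h] assoc_mult_mat[OF agJ g h]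
      assoc_mult_mat[OF ag J_carrier mult_carrier_mat[OF g h]]
      assoc_mult_mat[OF mult_carrier_mat[OF ah ag] J_carrier mult_carrier_mat[OF g h]]
      assoc_mult_mat[OF ah ag mult_carrier_mat[OF J_carrier mult_carrier_mat[OF g h]]] ..
  also have "adjoint_mat ?h * adjoint_mat g = 1\<^sub>m n"
    using adjoint_mat_mult[of g ?h] carrier_matD[OF g] carrier_matD[OF h] unfolding gh by simp
  finally have "adjoint_mat ?h * J * ?h = J"
    unfolding iso gh by simp
  with h gh hg that show thesis by blast
qed

lemma SO_star_form_carrier:
  assumes B: "sesquilinear n B" and J: "gram_mat n B = J"
  shows "g \<in> carrier (SO_star_form n B) \<longleftrightarrow> g \<in> carrier_mat n n \<and> adjoint_mat g * J * g = J"
  unfolding SO_star_form_iff[OF B] J by (rule isometry_SL[OF J_carrier K_carrier JK])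

text \<open>\<open>inv\<close> is a definite description over the group, so an inverse in the group
  and its uniqueness are supplied before conjugation is rewritten as commutation.\<close>

lemma Ad_fixed_iff:
  assumes B: "sesquilinear n B" and J: "gram_mat n B = J"
    and g: "g \<in> carrier (SO_star_form n B)" and A: "A \<in> carrier_mat n n"
  shows "Ad (SO_star_form n B) g A = A \<longleftrightarrow> g * A = A * g"
proof -
  let ?G = "SO_star_form n B"
  note carrier = SO_star_form_carrier[OF B J]
  have gc: "g \<in> carrier_mat n n" and giso: "adjoint_mat g * J * g = J" using g unfolding carrier by blast+
  obtain g' where g': "g' \<in> carrier_mat n n" "adjoint_mat g' * J * g' = J" "g * g' = 1\<^sub>m n" "g' * g = 1\<^sub>m n"
    by (rule isometry_inverse[OF gc giso])
  have mult: "x \<otimes>\<^bsub>?G\<^esub> y = x * y" and one: "\<one>\<^bsub>?G\<^esub> = 1\<^sub>m n" for x y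
    by (simp_all add: SO_star_form_def mat_group_def)
  have "inv\<^bsub>?G\<^esub> g = g'"
    unfolding m_inv_def mult one
  proof (rule the_equality)
    show "g' \<in> carrier ?G \<and> g * g' = 1\<^sub>m n \<and> g' * g = 1\<^sub>m n"
      using g' unfolding carrier by blast
    fix y assume y: "y \<in> carrier ?G \<and> g * y = 1\<^sub>m n \<and> y * g = 1\<^sub>m n"
    then have yc: "y \<in> carrier_mat n n" unfolding carrier by blast
    have "y = g' * g * y" unfolding g'(4) using yc by simp
    also have "\<dots> = g' * (g * y)" by (rule assoc_mult_mat[OF g'(1) gc yc])
    also have "\<dots> = g'" using y g'(1) by simp
    finally show "y = g'" .
  qed
  then have Ad: "Ad ?G g A = g * A * g'" by (simp add: Ad_def)
  show ?thesis
    unfolding Ad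
  proof
    assume eq: "g * A * g' = A"
    have "g * A = g * A * (g' * g)" unfolding g'(4) using gc A by simp
    also have "\<dots> = g * A * g' * g" by (rule assoc_mult_mat[OF mult_carrier_mat[OF gc A] g'(1) gc, symmetric])
    finally show "g * A = A * g" unfolding eq .
  next
    assume "g * A = A * g"
    then have "g * A * g' = A * (g * g')" using assoc_mult_mat[OF A gc g'(1)] by simp
    then show "g * A * g' = A" unfolding g'(3) using A by simp
  qed
qed

lemma triple_centralizer_carrier:
  assumes B: "sesquilinear n B" and J: "gram_mat n B = J"
  shows "carrier (triple_centralizer (SO_star_form n B) X H Y) = centralizer"
proof -
  note carrier = SO_star_form_carrier[OF B J] and Ad = Ad_fixed_iff[OF B J]
  show ?thesis
    unfolding triple_centralizer_def centralizer_def
    using carrier Ad[OF _ X_carrier] Ad[OF _ H_carrier] Ad[OF _ Y_carrier] by auto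
qed

text \<open>The index set is split in two because odd and even parts contribute separate products of
  different groups. \<open>N1\<close> and \<open>N2\<close> are the matrix sizes with which the
  factor topologies are formed.\<close>

lemma centralizer_iso:
  fixes Z :: "quat mat monoid" and G1 G2 :: "nat \<Rightarrow> quat mat monoid"
  assumes Z: "carrier Z = centralizer" "\<And>x y. x \<otimes>\<^bsub>Z\<^esub> y = x * y"
    and D: "D1 \<union> D2 = D" "D1 \<inter> D2 = {}"
    and G1: "\<And>d. d \<in> D1 \<Longrightarrow> carrier (G1 d) = block_group d" "\<And>d x y. x \<otimes>\<^bsub>G1 d\<^esub> y = x * y"
      "\<And>d. d \<in> D1 \<Longrightarrow> N1 d = T d"
    and G2: "\<And>d. d \<in> D2 \<Longrightarrow> carrier (G2 d) = block_group d" "\<And>d x y. x \<otimes>\<^bsub>G2 d\<^esub> y = x * y"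
      "\<And>d. d \<in> D2 \<Longrightarrow> N2 d = T d"
  shows "lie_group_iso Z (group_topology n Z) (product_group D1 G1 \<times>\<times> product_group D2 G2)
    (prod_topology (product_topology (\<lambda>d. group_topology (N1 d) (G1 d)) D1)
      (product_topology (\<lambda>d. group_topology (N2 d) (G2 d)) D2))"
proof -
  let ?P1 = "product_topology (\<lambda>d. group_topology (N1 d) (G1 d)) D1"
    and ?P2 = "product_topology (\<lambda>d. group_topology (N2 d) (G2 d)) D2"
  define f where "f g = (restrict (\<lambda>d. phi d g) D1, restrict (\<lambda>d. phi d g) D2)" for g
  \<comment> \<open>Glues the two families into one on \<open>D\<close>; since \<open>D1\<close> and
    \<open>D2\<close> are disjoint, the default branch gives the second family on all of
    \<open>D2\<close>.\<close>
  define join where "join ab d = (if d \<in> D1 then fst ab d else snd ab d)"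
    for ab :: "(nat \<Rightarrow> quat mat) \<times> (nat \<Rightarrow> quat mat)" and d
  define f' where "f' ab = psi (join ab)" for ab
  let ?C = "(\<Pi>\<^sub>E d\<in>D1. block_group d) \<times> (\<Pi>\<^sub>E d\<in>D2. block_group d)"
  have D1: "d \<in> D" if "d \<in> D1" for d using that D by blast
  have D2: "d \<in> D" "d \<notin> D1" if "d \<in> D2" for d using that D by blast+
  have bg: "block_group d \<subseteq> carrier_mat (T d) (T d)" for d using block_group_carrier by blast
  have Zc: "carrier Z \<subseteq> carrier_mat n n" unfolding Z(1) centralizer_def by blast
  have c1: "carrier (G1 d) \<subseteq> carrier_mat (N1 d) (N1 d)" if "d \<in> D1" for d
    unfolding G1(1)[OF that] G1(3)[OF that] by (rule bg)
  have c2: "carrier (G2 d) \<subseteq> carrier_mat (N2 d) (N2 d)" if "d \<in> D2" for d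
    unfolding G2(1)[OF that] G2(3)[OF that] by (rule bg)
  have top1: "topspace ?P1 = (\<Pi>\<^sub>E d\<in>D1. block_group d)"
    unfolding topspace_product_topology
    by (rule PiE_cong) (simp add: topspace_group_topology[OF c1] G1(1))
  have top2: "topspace ?P2 = (\<Pi>\<^sub>E d\<in>D2. block_group d)"
    unfolding topspace_product_topology
    by (rule PiE_cong) (simp add: topspace_group_topology[OF c2] G2(1))
  have topZ: "topspace (group_topology n Z) = centralizer"
    unfolding topspace_group_topology[OF Zc] by (rule Z(1))
  have carrier_target: "carrier (product_group D1 G1 \<times>\<times> product_group D2 G2) = ?C"
    unfolding DirProd_def partial_object.select_convs carrier_product_group
    by (intro arg_cong2[where f = "(\<times>)"] PiE_cong G1(1) G2(1))
  have f_mem: "f g \<in> ?C" if g: "g \<in> centralizer" for g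
    unfolding f_def using phi_block_group[OF _ g] D1 D2(1) by auto
  have join_block: "\<forall>d\<in>D. join ab d \<in> block_group d" if "ab \<in> ?C" for ab
    using that D unfolding join_def by auto
  have join_carrier: "\<forall>d\<in>D. join ab d \<in> carrier_mat (T d) (T d)" if "ab \<in> ?C" for ab
    using join_block[OF that] bg by blast
  have f'_mem: "f' ab \<in> centralizer" if "ab \<in> ?C" for ab
    unfolding f'_def by (rule psi_centralizer[OF join_block[OF that]])
  have f'f: "f' (f g) = g" if g: "g \<in> centralizer" for g
    unfolding f'_def
  proof (rule psi_phi[OF g], intro ballI)
    fix d assume "d \<in> D"
    then show "join (f g) d = phi d g" using D unfolding join_def f_def by auto
  qed
  have ff': "f (f' ab) = ab" if ab: "ab \<in> ?C" for ab
  proof -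
    obtain a b where eq: "ab = (a, b)" by (cases ab)
    have phi_join: "phi d (psi (join ab)) = join ab d" if "d \<in> D" for d
      by (rule phi_psi[OF join_carrier[OF ab] that])
    have "restrict (\<lambda>d. phi d (f' ab)) D1 = a"
    proof (rule extensionalityI[of _ D1])
      show "a \<in> extensional D1" using ab eq by (auto simp: PiE_def)
      fix d assume d: "d \<in> D1"
      show "restrict (\<lambda>d. phi d (f' ab)) D1 d = a d"
        unfolding f'_def phi_join[OF D1[OF d]] restrict_apply'[OF d] using d by (simp add: join_def eq)
    qed simp
    moreover have "restrict (\<lambda>d. phi d (f' ab)) D2 = b"
    proof (rule extensionalityI[of _ D2])
      show "b \<in> extensional D2" using ab eq by (auto simp: PiE_def)
      fix d assume d: "d \<in> D2"
      show "restrict (\<lambda>d. phi d (f' ab)) D2 d = b d"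
        unfolding f'_def phi_join[OF D2(1)[OF d]] restrict_apply'[OF d] using D2(2)[OF d]
        by (simp add: join_def eq)
    qed simp
    ultimately show ?thesis unfolding f_def eq by simp
  qed
  have hom: "f \<in> hom Z (product_group D1 G1 \<times>\<times> product_group D2 G2)"
  proof (rule homI)
    fix g assume "g \<in> carrier Z"
    then show "f g \<in> carrier (product_group D1 G1 \<times>\<times> product_group D2 G2)"
      unfolding carrier_target Z(1) by (rule f_mem)
  next
    fix g h assume "g \<in> carrier Z" "h \<in> carrier Z"
    then have g: "g \<in> carrier_mat n n" and h: "h \<in> centralizer" using Zc unfolding Z(1) by blast+
    have "restrict (\<lambda>d. phi d (g * h)) D1 = (\<lambda>d\<in>D1. restrict (\<lambda>d. phi d g) D1 d \<otimes>\<^bsub>G1 d\<^esub> restrict (\<lambda>d. phi d h) D1 d)"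
      by (rule restrict_ext) (simp add: G1(2) phi_mult[OF D1 g h])
    moreover have "restrict (\<lambda>d. phi d (g * h)) D2 = (\<lambda>d\<in>D2. restrict (\<lambda>d. phi d g) D2 d \<otimes>\<^bsub>G2 d\<^esub> restrict (\<lambda>d. phi d h) D2 d)"
      by (rule restrict_ext) (simp add: G2(2) phi_mult[OF D2(1) g h])
    ultimately show "f (g \<otimes>\<^bsub>Z\<^esub> h) = f g \<otimes>\<^bsub>product_group D1 G1 \<times>\<times> product_group D2 G2\<^esub> f h"
      unfolding Z(2) f_def by (simp add: DirProd_def product_group_def)
  qed
  have bij: "bij_betw f (carrier Z) (carrier (product_group D1 G1 \<times>\<times> product_group D2 G2))"
    unfolding carrier_target Z(1)
    by (rule bij_betwI[of _ _ _ f']) (use f_mem f'_mem f'f ff' in blast)+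
  have entry_phi: "continuous_map (group_topology n Z) euclidean (\<lambda>g. phi d g $$ (i, j))"
    if d: "d \<in> D" and ij: "i < T d" "j < T d" for d i j
    unfolding phi_def
  proof (rule continuous_map_sandwich[OF Fm_carrier[OF d] E_carrier[OF d]])
    show "g \<in> carrier_mat n n" if "g \<in> topspace (group_topology n Z)" for g
      using that Zc unfolding topspace_group_topology[OF Zc] by blast
  qed (use ij in \<open>simp_all add: continuous_map_entry\<close>)
  have cont1: "continuous_map (group_topology n Z) ?P1 (\<lambda>g. restrict (\<lambda>d. phi d g) D1)"
    unfolding continuous_map_componentwise
  proof (intro conjI ballI)
    fix d assume d: "d \<in> D1"
    have "continuous_map (group_topology n Z) (group_topology (N1 d) (G1 d)) (\<lambda>g. phi d g)"
    proof (rule continuous_map_into_group[OF c1[OF d]])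
      show "phi d \<in> topspace (group_topology n Z) \<rightarrow> carrier (G1 d)"
        unfolding topZ G1(1)[OF d] using phi_block_group[OF D1[OF d]] by blast
    qed (use entry_phi[OF D1[OF d]] in \<open>simp add: G1(3)[OF d]\<close>)
    then show "continuous_map (group_topology n Z) (group_topology (N1 d) (G1 d)) (\<lambda>g. restrict (\<lambda>d. phi d g) D1 d)"
      using d by simp
  qed auto
  have cont2: "continuous_map (group_topology n Z) ?P2 (\<lambda>g. restrict (\<lambda>d. phi d g) D2)"
    unfolding continuous_map_componentwise
  proof (intro conjI ballI)
    fix d assume d: "d \<in> D2"
    have "continuous_map (group_topology n Z) (group_topology (N2 d) (G2 d)) (\<lambda>g. phi d g)"
    proof (rule continuous_map_into_group[OF c2[OF d]])
      show "phi d \<in> topspace (group_topology n Z) \<rightarrow> carrier (G2 d)"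
        unfolding topZ G2(1)[OF d] using phi_block_group[OF D2(1)[OF d]] by blast
    qed (use entry_phi[OF D2(1)[OF d]] in \<open>simp add: G2(3)[OF d]\<close>)
    then show "continuous_map (group_topology n Z) (group_topology (N2 d) (G2 d)) (\<lambda>g. restrict (\<lambda>d. phi d g) D2 d)"
      using d by simp
  qed auto
  have cont: "continuous_map (group_topology n Z) (prod_topology ?P1 ?P2) f"
    unfolding f_def by (rule continuous_map_pairedI[OF cont1 cont2])
  have top: "topspace (prod_topology ?P1 ?P2) = ?C"
    unfolding topspace_prod_topology top1 top2 ..
  have entry_join: "continuous_map (prod_topology ?P1 ?P2) euclidean (\<lambda>ab. join ab d $$ (k, l))"
    if d: "d \<in> D" and kl: "k < T d" "l < T d" for d k l
  proof (cases "d \<in> D1")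
    case True
    have kl': "k < N1 d" "l < N1 d" using kl G1(3)[OF True] by simp_all
    have "continuous_map (prod_topology ?P1 ?P2) (group_topology (N1 d) (G1 d)) ((\<lambda>x. x d) \<circ> fst)"
      by (rule continuous_map_compose[OF continuous_map_fst continuous_map_product_projection[OF True]])
    from continuous_map_compose[OF this continuous_map_entry[OF kl', of "G1 d"]]
    show ?thesis using True by (simp add: join_def o_def)
  next
    case False
    then have d2: "d \<in> D2" using d D by blast
    have kl': "k < N2 d" "l < N2 d" using kl G2(3)[OF d2] by simp_all
    have "continuous_map (prod_topology ?P1 ?P2) (group_topology (N2 d) (G2 d)) ((\<lambda>x. x d) \<circ> snd)"
      by (rule continuous_map_compose[OF continuous_map_snd continuous_map_product_projection[OF d2]])
    from continuous_map_compose[OF this continuous_map_entry[OF kl', of "G2 d"]]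
    show ?thesis using False by (simp add: join_def o_def)
  qed
  have cont': "continuous_map (prod_topology ?P1 ?P2) (group_topology n Z) f'"
  proof (rule continuous_map_into_group[OF Zc])
    show "f' \<in> topspace (prod_topology ?P1 ?P2) \<rightarrow> carrier Z"
      unfolding top Z(1) using f'_mem by blast
    fix i j assume ij: "i < n" "j < n"
    have "continuous_map (prod_topology ?P1 ?P2) euclidean
        (\<lambda>ab. \<Sum>k\<in>index_set. case k of (d, l) \<Rightarrow> (Pm d l * (join ab d * Fm d l)) $$ (i, j))"
    proof (rule continuous_map_sum[OF finite_index_set])
      fix k assume k: "k \<in> index_set"
      obtain d l where dl: "k = (d, l)" by (cases k)
      with k have d: "d \<in> D" by (simp add: index_set_iff)
      have "continuous_map (prod_topology ?P1 ?P2) euclidean (\<lambda>ab. (Pm d l * (join ab d * Fm d l)) $$ (i, j))"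
      proof (rule continuous_map_sandwich[OF Pm_carrier[OF d] Fm_carrier[OF d] _ entry_join[OF d] ij])
        show "join ab d \<in> carrier_mat (T d) (T d)" if "ab \<in> topspace (prod_topology ?P1 ?P2)" for ab
          using join_carrier that d unfolding top by blast
      qed
      then show "continuous_map (prod_topology ?P1 ?P2) euclidean
          (\<lambda>ab. case k of (d, l) \<Rightarrow> (Pm d l * (join ab d * Fm d l)) $$ (i, j))"
        unfolding dl prod.case .
    qed
    then show "continuous_map (prod_topology ?P1 ?P2) euclidean (\<lambda>ab. f' ab $$ (i, j))"
      using ij by (simp add: f'_def psi_def)
  qed
  have "homeomorphic_maps (group_topology n Z) (prod_topology ?P1 ?P2) f f'"
    unfolding homeomorphic_maps_def topZ top using cont cont' f'f ff' by blast
  then have "homeomorphic_map (group_topology n Z) (prod_topology ?P1 ?P2) f"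
    unfolding homeomorphic_map_maps by blast
  with hom bij show ?thesis
    unfolding lie_group_iso_def iso_def by blast
qed

end

section \<open>Reading the signs off the diagram and assembling the isomorphism\<close>

lemma count_list_replicate_eq: "count_list (replicate k x) y = (if x = y then k else 0)"
  by (induction k) auto

text \<open>\<open>block_form\<close> and \<open>block\<close> are known to agree only on vectors of
  the right dimension; this transports the predicate under the choice operator of
  \<open>signature\<close>.\<close>

lemma is_orthogonal_basis_cong:
  assumes W: "\<And>x y. x \<in> W \<Longrightarrow> y \<in> W \<Longrightarrow> h x y = h' x y"
  shows "is_orthogonal_basis n W h bs = is_orthogonal_basis n W h' bs"
proof (cases "is_basis UNIV n W bs")
  case True
  then have "bs ! i \<in> W" if "i < length bs" for i
    using nth_mem[OF that] unfolding is_basis_def by blast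
  then have "h (bs ! i) (bs ! j) = h' (bs ! i) (bs ! j)" if "i < length bs" "j < length bs" for i j
    using W that by blast
  with True show ?thesis unfolding is_orthogonal_basis_def by simp
qed (simp add: is_orthogonal_basis_def)

theorem proposition3p33:
  fixes n :: nat and B :: "quat vec \<Rightarrow> quat vec \<Rightarrow> quat" and X H Y :: "quat mat"
    and t p q :: "nat \<Rightarrow> nat" and Ed Od :: "nat set"
  assumes form: "skew_hermitian n B" "nondegenerate n B"
    and X: "X \<in> lie_algebra n (SO_star_form n B)" "X \<noteq> 0\<^sub>m n n" "nilpotent_mat n X"
    and triple: "sl2_triple n (lie_algebra n (SO_star_form n B)) X H Y"
    and t: "\<And>d. t d = multiplicity_of n X H Y d"
    and Ed: "Ed = {d \<in> parts n X H Y. even d}"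
    and Od: "Od = {d \<in> parts n X H Y. odd d}"
    and p: "\<And>\<eta>. \<eta> \<in> Ed \<Longrightarrow> p \<eta> = count_list (first_column n B X H Y \<eta>) 1"
    and q: "\<And>\<eta>. \<eta> \<in> Ed \<Longrightarrow> q \<eta> = count_list (first_column n B X H Y \<eta>) (- 1)"
  shows "lie_group_iso
    (triple_centralizer (SO_star_form n B) X H Y)
    (group_topology n (triple_centralizer (SO_star_form n B) X H Y))
    (product_group Od (\<lambda>\<theta>. SO_star (t \<theta>)) \<times>\<times> product_group Ed (\<lambda>\<eta>. Sp (p \<eta>) (q \<eta>)))
    (prod_topology
      (product_topology (\<lambda>\<theta>. group_topology (t \<theta>) (SO_star (t \<theta>))) Od)
      (product_topology (\<lambda>\<eta>. group_topology (p \<eta> + q \<eta>) (Sp (p \<eta>) (q \<eta>))) Ed))"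
proof -
  have B: "sesquilinear n B" using form(1) by (simp add: skew_hermitian_def)
  let ?\<gg> = "lie_algebra n (SO_star_form n B)" and ?J = "gram_mat n B"
  obtain K where K: "K \<in> carrier_mat n n" "?J * K = 1\<^sub>m n" "K * ?J = 1\<^sub>m n"
    by (rule gram_mat_invertible[OF form])
  have XHY: "X \<in> ?\<gg>" "H \<in> ?\<gg>" "Y \<in> ?\<gg>"
    and brackets: "H * X - X * H = 2 \<cdot>\<^sub>m X" "H * Y - Y * H = (- 2) \<cdot>\<^sub>m Y" "X * Y - Y * X = H"
    using triple unfolding sl2_triple_def bracket_def by blast+
  have carriers: "X \<in> carrier_mat n n" "H \<in> carrier_mat n n" "Y \<in> carrier_mat n n"
    using XHY unfolding lie_algebra_def by blast+
  \<comment> \<open>Interpreted separately to obtain \<open>Y_nilpotent\<close>, which the larger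
    locale demands as an assumption.\<close>
  interpret sl2_mats n X H Y
    by unfold_locales (fact carriers brackets)+
  interpret skew_rep n X H Y ?J K
  proof
    show "\<exists>k. X ^\<^sub>m k = 0\<^sub>m n n" using X(3) by (simp only: nilpotent_mat_def)
    show "\<exists>k. Y ^\<^sub>m k = 0\<^sub>m n n" by (rule Y_nilpotent)
    show "adjoint_mat ?J = - ?J" by (rule adjoint_gram_mat[OF form(1)])
    show "adjoint_mat X * ?J = - (?J * X)" "adjoint_mat H * ?J = - (?J * H)" "adjoint_mat Y * ?J = - (?J * Y)"
      by (rule lie_algebra_skew_adjoint[OF B], rule XHY)+
  qed (fact K gram_mat_carrier)+
  have frm: "B x y = frm x y" if "x \<in> carrier_vec n" "y \<in> carrier_vec n" for x y
    unfolding frm_def by (rule sesquilinear_gram[OF B that])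
  let ?D = "parts n X H Y"
  \<comment> \<open>For even \<open>d\<close> the frame size is counted from the signature, so that
    it agrees with the size of \<open>Sp (p d) (q d)\<close> by definition.\<close>
  define T where "T d = (if even d then p d + q d else t d)" for d
  define S where "S d = (if even d then I_mat (p d) (q d) else gram_mat (t d) (std_skew_form (t d)))" for d
  define R where "R d = (if even d then I_mat (p d) (q d) else - gram_mat (t d) (std_skew_form (t d)))" for d
  define frame where "frame d E \<longleftrightarrow> E \<in> carrier_mat n (T d) \<and> (\<forall>c\<in>carrier_vec (T d). E *\<^sub>v c \<in> Ld d) \<and>
    (\<forall>v\<in>Ld d. \<exists>c\<in>carrier_vec (T d). v = E *\<^sub>v c) \<and>
    (\<forall>x\<in>carrier_vec (T d). \<forall>y\<in>carrier_vec (T d).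
      block d (E *\<^sub>v x) (E *\<^sub>v y) = std_inner (T d) x (S d *\<^sub>v y))" for d E
  have "\<exists>E. frame d E" if d: "d \<in> ?D" for d
  proof (cases "even d")
    case False
    then have T: "T d = t d" and S: "S d = gram_mat (t d) (std_skew_form (t d))"
      by (simp_all add: T_def S_def)
    show ?thesis unfolding frame_def T S by (rule odd_frame[OF False parts_pos[OF d] t])
  next
    case True
    then have dE: "d \<in> Ed" using d by (simp add: Ed)
    have T: "T d = p d + q d" and S: "S d = I_mat (p d) (q d)" using True by (simp_all add: T_def S_def)
    note d1 = parts_pos[OF d]
    let ?h = "block_form B X d"
    have h: "?h x y = block d x y" if "x \<in> Ld d" "y \<in> Ld d" for x y
      by (rule block_form_eq_block[OF frm LdD(1)[OF that(1)] LdD(1)[OF that(2)]])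
    have basis_iff: "is_orthogonal_basis n (Ld d) ?h bs = is_orthogonal_basis n (Ld d) (block d) bs" for bs
      by (rule is_orthogonal_basis_cong) (rule h)
    \<comment> \<open>The very choice made inside \<open>signature\<close>, so that the counts in
      the diagram are the counts for this basis.\<close>
    define bs where "bs = (SOME bs. is_orthogonal_basis n (Ld d) ?h bs)"
    obtain bs' where "is_orthogonal_basis n (Ld d) (block d) bs'" by (rule Ld_basis[OF d1])
    then have "is_orthogonal_basis n (Ld d) ?h bs'" unfolding basis_iff .
    then have "is_orthogonal_basis n (Ld d) ?h bs" unfolding bs_def by (rule someI)
    then have bs: "is_orthogonal_basis n (Ld d) (block d) bs" unfolding basis_iff .
    have bsL: "bs ! i \<in> Ld d" if "i < length bs" for i
      using bs nth_mem[OF that] unfolding is_orthogonal_basis_def is_basis_def by blast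
    have sign: "signature n (lowest n X H Y d) ?h =
        (card {i. i < length bs \<and> QRe (block d (bs ! i) (bs ! i)) > 0},
         card {i. i < length bs \<and> QRe (block d (bs ! i) (bs ! i)) < 0})" (is "_ = (?p, ?q)")
      unfolding signature_def lowest_eq_Ld[OF d1] bs_def[symmetric] Let_def
      by (simp add: h[OF bsL bsL] cong: conj_cong)
    have "first_column n B X H Y d = replicate ?p 1 @ replicate ?q (- 1)"
      unfolding first_column_def sign using True by simp
    then have pq: "p d = ?p" "q d = ?q"
      using p[OF dE] q[OF dE] by (simp_all add: count_list_append count_list_replicate_eq)
    show ?thesis
      unfolding frame_def T S by (rule even_frame[OF True d1 bs pq])
  qed
  then obtain E where E: "\<And>d. d \<in> ?D \<Longrightarrow> frame d (E d)" by metis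
  have S_inverse: "S d \<in> carrier_mat (T d) (T d)" "R d \<in> carrier_mat (T d) (T d)" "S d * R d = 1\<^sub>m (T d)" for d
    by (simp_all add: S_def R_def T_def I_mat_inverse gram_std_skew_inverse)
  have outside: "Ld d = {0\<^sub>v n}" if "d \<ge> 1" "d \<notin> ?D" for d
    using Ld_multiplicity_0[OF that(1)] that(2) by (simp add: parts_def)
  interpret skew_frame n X H Y ?J K ?D T E S R
  proof
    show "finite ?D" by (rule finite_parts)
    fix d
    show "1 \<le> d" if "d \<in> ?D" by (rule parts_pos[OF that])
    show "E d \<in> carrier_mat n (T d)" if "d \<in> ?D" using E[OF that] by (simp add: frame_def)
    show "S d \<in> carrier_mat (T d) (T d)" "R d \<in> carrier_mat (T d) (T d)" "S d * R d = 1\<^sub>m (T d)"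
      by (rule S_inverse)+
    show "R d * S d = 1\<^sub>m (T d)" by (rule quat_mat_left_right_inverse[OF S_inverse])
    show "E d *\<^sub>v c \<in> Ld d" if "d \<in> ?D" "c \<in> carrier_vec (T d)" for c
      using E[OF that(1)] that(2) by (simp add: frame_def)
    show "\<exists>c\<in>carrier_vec (T d). v = E d *\<^sub>v c" if "d \<in> ?D" "v \<in> Ld d" for v
      using E[OF that(1)] that(2) by (simp add: frame_def)
    show "Ld d = {0\<^sub>v n}" if "1 \<le> d" "d \<notin> ?D" by (rule outside[OF that])
    show "block d (E d *\<^sub>v x) (E d *\<^sub>v y) = std_inner (T d) x (S d *\<^sub>v y)"
      if "d \<in> ?D" "x \<in> carrier_vec (T d)" "y \<in> carrier_vec (T d)" for x y
      using E[OF that(1)] that(2,3) by (simp add: frame_def)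
  qed
  \<comment> \<open>Restores the reduced norm condition that is part of the definitions of
    \<open>SO_star\<close> and \<open>Sp\<close>.\<close>
  have bg: "block_group d = {h \<in> SL_H (T d). adjoint_mat h * S d * h = S d}" for d
    unfolding block_group_def using isometry_SL[OF S_inverse] by blast
  show ?thesis
  proof (rule centralizer_iso)
    show "carrier (triple_centralizer (SO_star_form n B) X H Y) = centralizer"
      by (rule triple_centralizer_carrier[OF B refl])
    show "x \<otimes>\<^bsub>triple_centralizer (SO_star_form n B) X H Y\<^esub> y = x * y" for x y
      by (simp add: triple_centralizer_def SO_star_form_def mat_group_def)
    show "Od \<union> Ed = ?D" "Od \<inter> Ed = {}" unfolding Od Ed by blast+
    show "carrier (SO_star (t d)) = block_group d" "t d = T d" if "d \<in> Od" for d
    proof -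
      have odd: "odd d" using that by (simp add: Od)
      then show T: "t d = T d" by (simp add: T_def)
      have S: "S d = gram_mat (T d) (std_skew_form (T d))" using odd by (simp add: S_def T_def)
      show "carrier (SO_star (t d)) = block_group d"
        unfolding T SO_star_def bg S using SO_star_form_iff[OF std_skew_form_sesquilinear] by blast
    qed
    show "x \<otimes>\<^bsub>SO_star (t d)\<^esub> y = x * y" for d x y
      by (simp add: SO_star_def SO_star_form_def mat_group_def)
    show "carrier (Sp (p d) (q d)) = block_group d" "p d + q d = T d" if "d \<in> Ed" for d
    proof -
      have even: "even d" using that by (simp add: Ed)
      then show T: "p d + q d = T d" by (simp add: T_def)
      have S: "S d = I_mat (p d) (q d)" using even by (simp add: S_def)
      show "carrier (Sp (p d) (q d)) = block_group d"
        unfolding bg S Sp_def mat_group_def T by simp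
    qed
    show "x \<otimes>\<^bsub>Sp (p d) (q d)\<^esub> y = x * y" for d x y
      by (simp add: Sp_def mat_group_def)
  qed
qed

end
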